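(* Let $N\ge 1$ be an integer and $\hat t>0$. For $k=1,\dots,N$ let $A_k\in\mathbb{R}^{d_k\times d_k}$, $B_k\in\mathbb{R}^{d_k\times m_k}$, let $Q_k,\hat Q_k\in\mathbb{R}^{d_k\times d_k}$ be symmetric and non-negative definite, let $R_k\in\mathbb{R}^{m_k\times m_k}$ be symmetric and positive definite, let $\lambda_k>0$, and let $\bar x^k\in\mathbb{R}^{d_k}$. Put $d=\sum_k d_k$, $m=\sum_k m_k$, $A=\operatorname{blkdiag}(A_1,\dots,A_N)$, $B=\operatorname{blkdiag}(B_1,\dots,B_N)$, $Q=\operatorname{blkdiag}(Q_1,\dots,Q_N)$, $R=\operatorname{blkdiag}(R_1,\dots,R_N)$, $\hat Q=\operatorname{blkdiag}(\hat Q_1,\dots,\hat Q_N)$, $\bar x=(\bar x^1,\dots,\bar x^N)\in\mathbb{R}^d$, $\lambda_k'=\sum_{\ell\neq k}\lambda_\ell$, $\tilde\lambda=\sum_{k=1}^N\lambda_k$, and $$\mathbb{U}_{\mathrm{LQ}}=\bigcup_{k=1}^N\{0\}\times\cdots\times\mathbb{R}^{m_k}\times\cdots\times\{0\}\subset\mathbb{R}^m\quad(\mathbb{R}^{m_k}\text{ in the }k\text{-th factor}).$$ Consider the optimal control problem $$\text{minimize over }u:\quad \int_0^{\hat t}\Bigl(\tfrac12\bigl(\langle x(t),Qx(t)\rangle+\langle u(t),Ru(t)\rangle\bigr)-\sum_{k=1}^N\lambda_k\mathsf 1_{\{0\}}(u^k(t))\Bigr)dt+\tfrac12\langle x(\hat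 t),\hat Qx(\hat t)\rangle$$ subject to $\dot x(t)=Ax(t)+Bu(t)$ for a.e. $t\in[0,\hat t]$, $x(0)=\bar x$, and $u=(u^1,\dots,u^N):[0,\hat t]\to\mathbb{U}_{\mathrm{LQ}}$ measurable. If $[0,\hat t]\ni t\mapsto(x_*(t),u_*(t))\in\mathbb{R}^d\times\mathbb{U}_{\mathrm{LQ}}$ is a local minimizer of this problem, then there exist an absolutely continuous map $p=(p^1,\dots,p^N):[0,\hat t]\to\mathbb{R}^{d_1}\times\cdots\times\mathbb{R}^{d_N}$ and a measurable map $\sigma:[0,\hat t]\to\{1,\dots,N\}$ such that $x_*(0)=\bar x$, $p(\hat t)=-\hat Qx_*(\hat t)$ and, for a.e. $t\in[0,\hat t]$: $\bullet$ $\dot x_*(t)=Ax_*(t)+Bu_*(t)$ and $\dot p(t)=-A^\top p(t)+Qx_*(t)$; $\bullet$ for each $k=1,\dots,N$, if $k\ne\sigma(t)$ then $u_*^k(t)=0$, while if $k=\sigma(t)$ then $$u_*^k(t)\in\begin{cases}\{R_k^{-1}B_k^\top p^k(t)\}&\text{if }\|p^k(t)\|^2_{B_kR_k^{-1}B_k^\top}>2\lambda_k,\\ \{0\}\cup\{R_k^{-1}B_k^\top p^k(t)\}&\text{if }\|p^k(t)\|^2_{B_kR_k^{-1}B_k^\top}=2\lambda_k,\\ \{0\}&\text{otherwise;}\end{cases}$$ $\bullet$ $$\sigma(t)\in\arg\max_{k\in\{1,\dots,N\}}\begin{cases}\lambda_k'+\tfrac12\|p^k(t)\|^2_{B_kR_k^{-1}B_k^\top}&\text{if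 }\|p^k(t)\|^2_{B_kR_k^{-1}B_k^\top}\ge2\lambda_k,\\ \tilde\lambda&\text{otherwise.}\end{cases}$$ Moreover, the map $$[0,\hat t]\ni t\mapsto\langle p(t),Ax_*(t)+Bu_*(t)\rangle+\sum_{k=1}^N\lambda_k\mathsf 1_{\{0\}}(u_*^k(t))-\tfrac12\bigl(\langle x_*(t),Qx_*(t)\rangle+\langle u_*(t),Ru_*(t)\rangle\bigr)\in\mathbb{R}$$ is constant a.e.
   Context: Measurability and "a.e." refer to Lebesgue measure. $\langle v,w\rangle=v^\top w$ is the standard inner product, and for a symmetric non-negative definite matrix $M$, $\|v\|_M=\sqrt{\langle v,Mv\rangle}$. $\mathsf 1_{\{0\}}(z)=1$ if $z=0$ and $0$ otherwise. $\operatorname{blkdiag}$ denotes the block-diagonal matrix with the listed blocks. Vectors in $\mathbb{R}^d$ and $\mathbb{R}^m$ are partitioned into $N$ blocks, with the $k$-th block in $\mathbb{R}^{d_k}$ and $\mathbb{R}^{m_k}$ respectively, and the block is indicated by a superscript $k$. An admissible state-action trajectory is a pair $(x,u)$ satisfying all constraints of the problem, where $x$ is the absolutely continuous (Carathéodory) solution of the differential equation under $u$; its cost is an element of $(-\infty,+\infty]$. A local minimizer is an admissible state-action trajectory $(x_*,u_* )$ for which there is $\varepsilon>0$ such that the cost of $(x_*,u_* )$ does not exceed the cost of any admissible $(x,u)$ with $\sup_{t\in[0,\hat t]}\|x(t)-x_*(t)\|\le\varepsilon$. *)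

theory Defs
  imports "HOL-Analysis.Analysis" "Jordan_Normal_Form.Gauss_Jordan_Elimination"
begin

text \<open>
  Vectors and matrices are those of Jordan_Normal_Form, because the block sizes \<open>d\<^sub>k\<close>, \<open>m\<^sub>k\<close> vary
  with the block index. Blocks are numbered \<open>1, \<dots>, N\<close>; entries within a vector are numbered from 0.
  The functions are written in prefix form where HOL-Analysis uses the same infix symbol.
\<close>

subsection \<open>Linear algebra\<close>

definition vnorm :: "real Matrix.vec \<Rightarrow> real" where
  "vnorm v = sqrt (scalar_prod v v)"

definition mnorm :: "real mat \<Rightarrow> real Matrix.vec \<Rightarrow> real" where
  "mnorm M v = sqrt (scalar_prod v (M *\<^sub>v v))"

definition sym_nonneg_def :: "nat \<Rightarrow> real mat \<Rightarrow> bool" where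
  "sym_nonneg_def n M \<longleftrightarrow> M \<in> carrier_mat n n \<and> transpose_mat M = M \<and>
     (\<forall>v \<in> carrier_vec n. 0 \<le> scalar_prod v (M *\<^sub>v v))"

definition sym_pos_def :: "nat \<Rightarrow> real mat \<Rightarrow> bool" where
  "sym_pos_def n M \<longleftrightarrow> M \<in> carrier_mat n n \<and> transpose_mat M = M \<and>
     (\<forall>v \<in> carrier_vec n. v \<noteq> 0\<^sub>v n \<longrightarrow> 0 < scalar_prod v (M *\<^sub>v v))"

text \<open>Only used for invertible matrices, for which \<^const>\<open>mat_inverse\<close> returns a value.\<close>

definition mat_inv :: "real mat \<Rightarrow> real mat" where
  "mat_inv M = the (mat_inverse M)"

definition blkdiag :: "nat \<Rightarrow> (nat \<Rightarrow> real mat) \<Rightarrow> real mat" where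
  "blkdiag N M = diag_block_mat (map M [1..<Suc N])"

definition blkvec :: "nat \<Rightarrow> (nat \<Rightarrow> real Matrix.vec) \<Rightarrow> real Matrix.vec" where
  "blkvec N v = foldr (@\<^sub>v) (map v [1..<Suc N]) (0\<^sub>v 0)"

text \<open>\<open>blk n k v\<close> is the \<open>k\<close>-th block of \<open>v\<close>, where the blocks have sizes \<open>n 1, n 2, \<dots>\<close>\<close>

definition blk :: "(nat \<Rightarrow> nat) \<Rightarrow> nat \<Rightarrow> real Matrix.vec \<Rightarrow> real Matrix.vec" where
  "blk n k v = Matrix.vec (n k) (\<lambda>i. vec_index v ((\<Sum>l = 1..<k. n l) + i))"

subsection \<open>Trajectories on \<open>[0, T]\<close>\<close>

definition vec_abs_continuous :: "real \<Rightarrow> (real \<Rightarrow> real Matrix.vec) \<Rightarrow> bool" where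
  "vec_abs_continuous T f \<longleftrightarrow>
     (\<forall>\<epsilon>>0. \<exists>\<delta>>0. \<forall>(n::nat) (a :: nat \<Rightarrow> real) (b :: nat \<Rightarrow> real).
        (\<forall>i<n. 0 \<le> a i \<and> a i \<le> b i \<and> b i \<le> T) \<and>
        (\<forall>i<n. \<forall>j<n. i \<noteq> j \<longrightarrow> {a i<..<b i} \<inter> {a j<..<b j} = {}) \<and>
        (\<Sum>i<n. b i - a i) < \<delta> \<longrightarrow>
        (\<Sum>i<n. vnorm (f (b i) - f (a i))) < \<epsilon>)"

definition vec_has_deriv_at ::
    "real \<Rightarrow> nat \<Rightarrow> (real \<Rightarrow> real Matrix.vec) \<Rightarrow> real Matrix.vec \<Rightarrow> real \<Rightarrow> bool" where
  "vec_has_deriv_at T n f f' t \<longleftrightarrow>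
     (\<forall>i<n. ((\<lambda>s. vec_index (f s) i) has_real_derivative vec_index f' i) (at t within {0..T}))"

definition vec_measurable :: "real \<Rightarrow> nat \<Rightarrow> (real \<Rightarrow> real Matrix.vec) \<Rightarrow> bool" where
  "vec_measurable T n f \<longleftrightarrow>
     (\<forall>i<n. (\<lambda>t. vec_index (f t) i) \<in> borel_measurable (lebesgue_on {0..T}))"

text \<open>The Lebesgue integral of \<open>f\<close> over \<open>[0, T]\<close> with values in \<open>[-\<infinity>, \<infinity>]\<close>, as the integral of
  the positive part minus that of the negative part\<close>

definition ext_integral :: "real \<Rightarrow> (real \<Rightarrow> real) \<Rightarrow> ereal" where
  "ext_integral T f =
     enn2ereal (\<integral>\<^sup>+ t. ennreal (f t) \<partial>lebesgue_on {0..T})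
     - enn2ereal (\<integral>\<^sup>+ t. ennreal (- f t) \<partial>lebesgue_on {0..T})"

subsection \<open>The optimal control problem\<close>

definition U_LQ :: "nat \<Rightarrow> (nat \<Rightarrow> nat) \<Rightarrow> real Matrix.vec set" where
  "U_LQ N m = (\<Union>k \<in> {1..N}.
     {u \<in> carrier_vec (\<Sum>l = 1..N. m l). \<forall>l \<in> {1..N} - {k}. blk m l u = 0\<^sub>v (m l)})"

text \<open>\<open>\<Sum>\<^sub>k \<lambda>\<^sub>k 1\<^bsub>{0}\<^esub>(u\<^sup>k)\<close>\<close>

definition sparsity :: "nat \<Rightarrow> (nat \<Rightarrow> nat) \<Rightarrow> (nat \<Rightarrow> real) \<Rightarrow> real Matrix.vec \<Rightarrow> real" where
  "sparsity N m lam u = (\<Sum>k = 1..N. lam k * (if blk m k u = 0\<^sub>v (m k) then 1 else 0))"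

definition quad_cost :: "real mat \<Rightarrow> real mat \<Rightarrow> real Matrix.vec \<Rightarrow> real Matrix.vec \<Rightarrow> real" where
  "quad_cost Q R x u = 1/2 * (scalar_prod x (Q *\<^sub>v x) + scalar_prod u (R *\<^sub>v u))"

definition lq_cost ::
    "real \<Rightarrow> nat \<Rightarrow> (nat \<Rightarrow> nat) \<Rightarrow> (nat \<Rightarrow> real) \<Rightarrow> real mat \<Rightarrow> real mat \<Rightarrow> real mat \<Rightarrow>
     (real \<Rightarrow> real Matrix.vec) \<Rightarrow> (real \<Rightarrow> real Matrix.vec) \<Rightarrow> ereal" where
  "lq_cost T N m lam Q R Qh x u =
     ext_integral T (\<lambda>t. quad_cost Q R (x t) (u t) - sparsity N m lam (u t))
     + ereal (1/2 * scalar_prod (x T) (Qh *\<^sub>v x T))"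

definition lq_admissible ::
    "real \<Rightarrow> nat \<Rightarrow> (nat \<Rightarrow> nat) \<Rightarrow> (nat \<Rightarrow> nat) \<Rightarrow> real mat \<Rightarrow> real mat \<Rightarrow> real Matrix.vec \<Rightarrow>
     (real \<Rightarrow> real Matrix.vec) \<Rightarrow> (real \<Rightarrow> real Matrix.vec) \<Rightarrow> bool" where
  "lq_admissible T N d m A B xbar x u \<longleftrightarrow>
     (\<forall>t \<in> {0..T}. x t \<in> carrier_vec (\<Sum>k = 1..N. d k)) \<and>
     vec_abs_continuous T x \<and>
     (AE t in lebesgue_on {0..T}.
        vec_has_deriv_at T (\<Sum>k = 1..N. d k) x (A *\<^sub>v x t + B *\<^sub>v u t) t) \<and>
     x 0 = xbar \<and>
     (\<forall>t \<in> {0..T}. u t \<in> U_LQ N m) \<and>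
     vec_measurable T (\<Sum>k = 1..N. m k) u"

definition local_minimizer ::
    "real \<Rightarrow> ((real \<Rightarrow> real Matrix.vec) \<Rightarrow> (real \<Rightarrow> real Matrix.vec) \<Rightarrow> bool) \<Rightarrow>
     ((real \<Rightarrow> real Matrix.vec) \<Rightarrow> (real \<Rightarrow> real Matrix.vec) \<Rightarrow> ereal) \<Rightarrow>
     (real \<Rightarrow> real Matrix.vec) \<Rightarrow> (real \<Rightarrow> real Matrix.vec) \<Rightarrow> bool" where
  "local_minimizer T adm J xs us \<longleftrightarrow> adm xs us \<and>
     (\<exists>\<epsilon>>0. \<forall>x u. adm x u \<and> (SUP t\<in>{0..T}. vnorm (x t - xs t)) \<le> \<epsilon> \<longrightarrow> J xs us \<le> J x u)"

end

theory Submission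
  imports Defs "Jordan_Normal_Form.Determinant"
begin

text \<open>
  The proof compares the minimizer with needle perturbations. Let \<open>u\<^sub>*\<close> be the optimal control, \<open>p\<close> the
  solution of the adjoint equation with \<open>p(T) = -Qh x\<^sub>*(T)\<close>, and
  \<open>H(t, u) = \<langle>p(t), B u\<rangle> - 1/2 \<langle>u, R u\<rangle> + \<Sum>\<^sub>k \<lambda>\<^sub>k 1\<^bsub>{0}\<^esub>(u\<^sup>k)\<close>. Replace \<open>u\<^sub>*\<close> on a short interval
  \<open>[a, b]\<close> by another control \<open>v\<close>. The dynamics are linear and the cost is quadratic in the state, so
  integration by parts against \<open>p\<close> gives the change of the cost exactly: it is
  \<open>\<integral>\<^sub>a\<^sup>b H(t, u\<^sub>*(t)) - H(t, v(t)) dt\<close> plus quadratic terms in the state perturbation \<open>y\<close>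
  (\<open>cost_increment\<close>). Moreover \<open>|y|\<close> is at most a constant times \<open>\<integral>\<^sub>a\<^sup>b |B (v - u\<^sub>*)| dt\<close>. The integrand is
  integrable, so this integral is \<open>O(b - a)\<close> as \<open>b\<close> tends to \<open>a\<close>, for almost every \<open>a\<close>, and its square is
  \<open>o(b - a)\<close>. Dividing by \<open>b - a\<close> yields \<open>H(t, v(t)) \<le> H(t, u\<^sub>*(t))\<close> for almost every \<open>t\<close>
  (\<open>AE_ctrl_ham_le\<close>).

  This is applied with \<open>N + 1\<close> test controls. A value in \<open>U_LQ\<close> has at most one nonzero block, and
  completing the square in that block shows that the maximum of \<open>H(t, -)\<close> over \<open>U_LQ\<close> is attained at \<open>0\<close> or at a
  vector whose only nonzero block, the \<open>k\<close>-th one for some \<open>k\<close>, is \<open>R\<^sub>k\<^sup>-\<^sup>1 B\<^sub>k\<^sup>T p\<^sup>k(t)\<close>. These candidates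
  depend continuously on \<open>t\<close>. Comparing with them determines \<open>u\<^sub>*(t)\<close> and its active block
  (\<open>maximizing_control\<close>).

  Before this, the minimal cost has to be finite, because the class of controls contains functions
  that are not square integrable. Truncating \<open>u\<^sub>*\<close> at level \<open>k\<close> gives bounded controls of finite
  cost; their trajectories converge uniformly to \<open>x\<^sub>*\<close>, since \<open>B u\<^sub>*\<close>, as \<open>x\<^sub>*' - A x\<^sub>*\<close>, is integrable. Hence one
  of them competes with the minimizer (\<open>us_cost_integrable\<close>).

  The Hamiltonian is constant for the following reason. Let \<open>h(t)\<close> be its maximum over the control
  set at \<open>(x\<^sub>*(t), p(t))\<close>. It is a sum of absolutely continuous functions and a maximum of finitely many
  such functions, hence absolutely continuous and differentiable almost everywhere. For almost every
  \<open>t\<close>, keeping the control fixed at the value \<open>u\<^sub>*(t)\<close> produces a function that lies below \<open>h\<close>, agrees with it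
  at \<open>t\<close>, and has derivative \<open>0\<close> at \<open>t\<close> by the two differential equations. So \<open>h' = 0\<close> almost everywhere
  (\<open>max_hamiltonian_constant\<close>).

  The analysis rests on absolutely continuous functions on \<open>[0, T]\<close>: they are the integrals of their
  derivatives if these exist almost everywhere, every integral of a Lebesgue integrable function is
  one of them, and linear systems with an integrable inhomogeneity are solved by the variation of
  constants formula.
\<close>

section \<open>Absolutely continuous functions\<close>

text \<open>The hypothesis that \<open>vec_abs_continuous\<close> makes on finitely many intervals of total length less than \<open>\<delta>\<close>.\<close>

definition short_family :: "real \<Rightarrow> real \<Rightarrow> nat \<Rightarrow> (nat \<Rightarrow> real) \<Rightarrow> (nat \<Rightarrow> real) \<Rightarrow> bool" where
  "short_family T \<delta> n a b \<longleftrightarrow>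
     (\<forall>i<n. 0 \<le> a i \<and> a i \<le> b i \<and> b i \<le> T) \<and>
     (\<forall>i<n. \<forall>j<n. i \<noteq> j \<longrightarrow> {a i<..<b i} \<inter> {a j<..<b j} = {}) \<and>
     (\<Sum>i<n. b i - a i) < \<delta>"

text \<open>Absolute continuity for an arbitrary measure \<open>D x y\<close> of the increment over \<open>[x, y]\<close>. Scalar and
  vector-valued absolute continuity are the instances \<open>\<bar>f y - f x\<bar>\<close> and \<open>vnorm (f y - f x)\<close>, so that all
  closure properties follow from comparing increments.\<close>

definition small_increments :: "real \<Rightarrow> (real \<Rightarrow> real \<Rightarrow> real) \<Rightarrow> bool" where
  "small_increments T D \<longleftrightarrow>
     (\<forall>\<epsilon>>0. \<exists>\<delta>>0. \<forall>n a b. short_family T \<delta> n a b \<longrightarrow> (\<Sum>i<n. D (a i) (b i)) < \<epsilon>)"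

definition abs_cont :: "real \<Rightarrow> (real \<Rightarrow> real) \<Rightarrow> bool" where
  "abs_cont T f \<longleftrightarrow> small_increments T (\<lambda>x y. \<bar>f y - f x\<bar>)"

lemma small_incrementsI:
  assumes "\<And>\<epsilon>. \<epsilon> > 0 \<Longrightarrow> \<exists>\<delta>>0. \<forall>n a b. short_family T \<delta> n a b \<longrightarrow> (\<Sum>i<n. D (a i) (b i)) < \<epsilon>"
  shows "small_increments T D"
  unfolding small_increments_def using assms by simp

lemma small_incrementsD:
  assumes "small_increments T D" "\<epsilon> > 0"
  shows "\<exists>\<delta>>0. \<forall>n a b. short_family T \<delta> n a b \<longrightarrow> (\<Sum>i<n. D (a i) (b i)) < \<epsilon>"
  using assms(1)[unfolded small_increments_def, rule_format, OF assms(2)] .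

text \<open>Divisions and tagged divisions are indexed by sets or by pairs, not by an initial segment of the
  natural numbers.\<close>

lemma small_increments_finite_family:
  assumes "small_increments T D" "\<epsilon> > 0"
  shows "\<exists>\<delta>>0. \<forall>(I :: 'i set) a b. finite I \<longrightarrow> (\<forall>i\<in>I. 0 \<le> a i \<and> a i \<le> b i \<and> b i \<le> T) \<longrightarrow>
       (\<forall>i\<in>I. \<forall>j\<in>I. i \<noteq> j \<longrightarrow> {a i<..<b i} \<inter> {a j<..<b j} = {}) \<longrightarrow>
       (\<Sum>i\<in>I. b i - a i) < \<delta> \<longrightarrow> (\<Sum>i\<in>I. D (a i) (b i)) < \<epsilon>"
proof -
  obtain \<delta> where \<delta>: "\<delta> > 0" and *: "\<forall>n a b. short_family T \<delta> n a b \<longrightarrow> (\<Sum>i<n. D (a i) (b i)) < \<epsilon>"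
    using small_incrementsD[OF assms] by (elim exE conjE)
  have "(\<Sum>i\<in>I. D (a i) (b i)) < \<epsilon>"
    if fin: "finite I" and le: "\<forall>i\<in>I. 0 \<le> a i \<and> a i \<le> b i \<and> b i \<le> T"
      and disj: "\<forall>i\<in>I. \<forall>j\<in>I. i \<noteq> j \<longrightarrow> {a i<..<b i} \<inter> {a j<..<b j} = {}"
      and small: "(\<Sum>i\<in>I. b i - a i) < \<delta>" for I :: "'i set" and a b
  proof -
    obtain h where h: "bij_betw h {..<card I} I"
      using fin by (metis atLeast0LessThan ex_bij_betw_nat_finite)
    have S: "(\<Sum>i\<in>I. f i) = (\<Sum>i<card I. f (h i))" for f :: "'i \<Rightarrow> real"
      using sum.reindex_bij_betw[OF h, of f] by simp
    have hI: "h i \<in> I" if "i < card I" for i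
      using h that by (auto simp: bij_betw_def)
    have hinj: "h i \<noteq> h j" if "i < card I" "j < card I" "i \<noteq> j" for i j
      using h that by (auto simp: bij_betw_def inj_on_def)
    have "short_family T \<delta> (card I) (\<lambda>i. a (h i)) (\<lambda>i. b (h i))"
      unfolding short_family_def
    proof (intro conjI)
      show "\<forall>i<card I. 0 \<le> a (h i) \<and> a (h i) \<le> b (h i) \<and> b (h i) \<le> T" using le hI by blast
      show "\<forall>i<card I. \<forall>j<card I. i \<noteq> j \<longrightarrow> {a (h i)<..<b (h i)} \<inter> {a (h j)<..<b (h j)} = {}"
        using disj hI hinj by blast
      show "(\<Sum>i<card I. b (h i) - a (h i)) < \<delta>" using small S[of "\<lambda>i. b i - a i"] by linarith
    qed
    with * have "(\<Sum>i<card I. D (a (h i)) (b (h i))) < \<epsilon>"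
      by (elim allE[where x="card I"] allE[where x="\<lambda>i. a (h i)"] allE[where x="\<lambda>i. b (h i)"]) simp
    then show ?thesis using S[of "\<lambda>i. D (a i) (b i)"] by linarith
  qed
  with \<delta> show ?thesis by (intro exI[of _ \<delta>]) simp
qed

lemma small_increments_mono:
  assumes "small_increments T D" and le: "\<And>x y. 0 \<le> x \<Longrightarrow> x \<le> y \<Longrightarrow> y \<le> T \<Longrightarrow> D' x y \<le> D x y"
  shows "small_increments T D'"
proof (rule small_incrementsI)
  fix \<epsilon> :: real assume "\<epsilon> > 0"
  from small_incrementsD[OF assms(1) this] obtain \<delta> where \<delta>: "\<delta> > 0"
    and *: "\<forall>n a b. short_family T \<delta> n a b \<longrightarrow> (\<Sum>i<n. D (a i) (b i)) < \<epsilon>"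
    by (elim exE conjE)
  have "(\<Sum>i<n. D' (a i) (b i)) < \<epsilon>" if "short_family T \<delta> n a b" for n a b
  proof -
    have "(\<Sum>i<n. D' (a i) (b i)) \<le> (\<Sum>i<n. D (a i) (b i))"
      using that unfolding short_family_def by (intro sum_mono le) auto
    also have "\<dots> < \<epsilon>" using *[rule_format, OF that] .
    finally show ?thesis .
  qed
  with \<delta> show "\<exists>\<delta>>0. \<forall>n a b. short_family T \<delta> n a b \<longrightarrow> (\<Sum>i<n. D' (a i) (b i)) < \<epsilon>"
    by (intro exI[of _ \<delta>]) simp
qed

lemma short_family_mono: "short_family T \<delta> n a b \<Longrightarrow> \<delta> \<le> \<delta>' \<Longrightarrow> short_family T \<delta>' n a b"
  unfolding short_family_def by (elim conjE, intro conjI) auto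

lemma small_increments_add:
  assumes "small_increments T D" "small_increments T D'"
  shows "small_increments T (\<lambda>x y. D x y + D' x y)"
proof (rule small_incrementsI)
  fix \<epsilon> :: real assume "\<epsilon> > 0"
  then have e2: "\<epsilon>/2 > 0" by simp
  obtain d where d: "d > 0" and *: "\<forall>n a b. short_family T d n a b \<longrightarrow> (\<Sum>i<n. D (a i) (b i)) < \<epsilon>/2"
    using small_incrementsD[OF assms(1) e2] by (elim exE conjE)
  obtain d' where d': "d' > 0" and **: "\<forall>n a b. short_family T d' n a b \<longrightarrow> (\<Sum>i<n. D' (a i) (b i)) < \<epsilon>/2"
    using small_incrementsD[OF assms(2) e2] by (elim exE conjE)
  have "(\<Sum>i<n. D (a i) (b i) + D' (a i) (b i)) < \<epsilon>" if "short_family T (min d d') n a b" for n a b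
  proof -
    have "(\<Sum>i<n. D (a i) (b i)) < \<epsilon>/2"
      using that short_family_mono *[rule_format, of n a b] by auto
    moreover have "(\<Sum>i<n. D' (a i) (b i)) < \<epsilon>/2"
      using that short_family_mono **[rule_format, of n a b] by auto
    ultimately show ?thesis by (simp add: sum.distrib)
  qed
  with d d' show "\<exists>\<delta>>0. \<forall>n a b. short_family T \<delta> n a b \<longrightarrow> (\<Sum>i<n. D (a i) (b i) + D' (a i) (b i)) < \<epsilon>"
    by (intro exI[of _ "min d d'"]) simp
qed

lemma small_increments_length: "small_increments T (\<lambda>x y. y - x)"
  unfolding small_increments_def short_family_def by (intro allI impI, rule_tac x=\<epsilon> in exI) simp

lemma small_increments_zero: "small_increments T (\<lambda>x y. 0)"
  by (rule small_incrementsI) (auto intro: exI[of _ 1])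

lemma small_increments_cmult:
  assumes "small_increments T D" "c \<ge> 0"
  shows "small_increments T (\<lambda>x y. c * D x y)"
proof (cases "c = 0")
  case True
  then show ?thesis by (simp add: small_increments_zero)
next
  case False
  with assms have c: "c > 0" by simp
  show ?thesis
  proof (rule small_incrementsI)
    fix \<epsilon> :: real assume "\<epsilon> > 0"
    with c have "\<epsilon>/c > 0" by simp
    from small_incrementsD[OF assms(1) this] obtain \<delta> where \<delta>: "\<delta> > 0"
      and *: "\<forall>n a b. short_family T \<delta> n a b \<longrightarrow> (\<Sum>i<n. D (a i) (b i)) < \<epsilon>/c"
      by (elim exE conjE)
    have "(\<Sum>i<n. c * D (a i) (b i)) < \<epsilon>" if "short_family T \<delta> n a b" for n a b
      unfolding sum_distrib_left[symmetric] using *[rule_format, OF that] c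
      by (simp add: pos_less_divide_eq mult.commute)
    with \<delta> show "\<exists>\<delta>>0. \<forall>n a b. short_family T \<delta> n a b \<longrightarrow> (\<Sum>i<n. c * D (a i) (b i)) < \<epsilon>"
      by (intro exI[of _ \<delta>]) simp
  qed
qed

lemma small_increments_sum:
  assumes "finite J" "\<And>j. j \<in> J \<Longrightarrow> small_increments T (D j)"
  shows "small_increments T (\<lambda>x y. \<Sum>j\<in>J. D j x y)"
  using assms
proof (induction J rule: finite_induct)
  case empty
  then show ?case by (simp add: small_increments_zero)
next
  case (insert j J)
  then show ?case by (simp add: small_increments_add)
qed

lemma abs_cont_lipschitz:
  assumes "\<And>x y. 0 \<le> x \<Longrightarrow> x \<le> y \<Longrightarrow> y \<le> T \<Longrightarrow> \<bar>f y - f x\<bar> \<le> C * (y - x)" "C \<ge> 0"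
  shows "abs_cont T f"
  unfolding abs_cont_def
  by (rule small_increments_mono[OF small_increments_cmult[OF small_increments_length \<open>C \<ge> 0\<close>]]) (use assms in auto)

lemma abs_cont_continuous:
  assumes "abs_cont T f"
  shows "continuous_on {0..T} f"
  unfolding continuous_on_iff dist_real_def
proof (intro ballI allI impI)
  fix x e :: real assume x: "x \<in> {0..T}" and e: "0 < e"
  obtain \<delta> where \<delta>: "\<delta> > 0" and *: "\<forall>n a b. short_family T \<delta> n a b \<longrightarrow> (\<Sum>i<n. \<bar>f (b i) - f (a i)\<bar>) < e"
    using small_incrementsD[OF assms[unfolded abs_cont_def] e] by (elim exE conjE)
  show "\<exists>d>0. \<forall>x'\<in>{0..T}. \<bar>x' - x\<bar> < d \<longrightarrow> \<bar>f x' - f x\<bar> < e"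
  proof (rule exI[of _ \<delta>], intro conjI \<delta> ballI impI)
    fix y assume y: "y \<in> {0..T}" "\<bar>y - x\<bar> < \<delta>"
    have "short_family T \<delta> 1 (\<lambda>_. min x y) (\<lambda>_. max x y)"
      using x y unfolding short_family_def by (auto simp: max_def min_def)
    from *[rule_format, OF this] show "\<bar>f y - f x\<bar> < e"
      by (auto simp: max_def min_def split: if_splits)
  qed
qed

lemma abs_cont_bounded:
  assumes "abs_cont T f"
  obtains C where "C \<ge> 0" "\<And>t. t \<in> {0..T} \<Longrightarrow> \<bar>f t\<bar> \<le> C"
proof -
  have "compact (f ` {0..T})"
    using abs_cont_continuous[OF assms] compact_continuous_image by blast
  then obtain C where "\<forall>y\<in>f ` {0..T}. norm y \<le> C" "C > 0"
    using compact_imp_bounded bounded_pos by metis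
  then show thesis by (intro that[of C]) auto
qed

lemma abs_cont_add:
  assumes "abs_cont T f" "abs_cont T g"
  shows "abs_cont T (\<lambda>t. f t + g t)"
  unfolding abs_cont_def
  by (rule small_increments_mono[OF small_increments_add[OF assms[unfolded abs_cont_def]]]) auto

lemma abs_cont_mult:
  assumes "abs_cont T f" "abs_cont T g"
  shows "abs_cont T (\<lambda>t. f t * g t)"
proof -
  obtain C where C: "C \<ge> 0" "\<And>t. t \<in> {0..T} \<Longrightarrow> \<bar>f t\<bar> \<le> C" using abs_cont_bounded[OF assms(1)] by blast
  obtain D where D: "D \<ge> 0" "\<And>t. t \<in> {0..T} \<Longrightarrow> \<bar>g t\<bar> \<le> D" using abs_cont_bounded[OF assms(2)] by blast
  have "\<bar>f y * g y - f x * g x\<bar> \<le> D * \<bar>f y - f x\<bar> + C * \<bar>g y - g x\<bar>"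
    if "0 \<le> x" "x \<le> y" "y \<le> T" for x y
  proof -
    have "f y * g y - f x * g x = (f y - f x) * g y + f x * (g y - g x)" by (simp add: algebra_simps)
    then have "\<bar>f y * g y - f x * g x\<bar> \<le> \<bar>f y - f x\<bar> * \<bar>g y\<bar> + \<bar>f x\<bar> * \<bar>g y - g x\<bar>"
      by (metis abs_mult abs_triangle_ineq)
    also have "\<dots> \<le> \<bar>f y - f x\<bar> * D + C * \<bar>g y - g x\<bar>"
      using C(2)[of x] D(2)[of y] that by (intro add_mono mult_mono) auto
    finally show ?thesis by (simp add: mult.commute)
  qed
  then show ?thesis
    unfolding abs_cont_def
    by (intro small_increments_mono[OF small_increments_add[OF small_increments_cmult[OF assms(1)[unfolded abs_cont_def] D(1)]
       small_increments_cmult[OF assms(2)[unfolded abs_cont_def] C(1)]]])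
qed

lemma abs_cont_const [simp]: "abs_cont T (\<lambda>t. c)"
  by (rule abs_cont_lipschitz[where C=0]) auto

lemma abs_cont_abs:
  assumes "abs_cont T f" shows "abs_cont T (\<lambda>t. \<bar>f t\<bar>)"
  unfolding abs_cont_def
  by (rule small_increments_mono[OF assms[unfolded abs_cont_def]]) auto

lemma abs_cont_cong:
  assumes "abs_cont T f" "\<And>t. t \<in> {0..T} \<Longrightarrow> f t = g t" shows "abs_cont T g"
  unfolding abs_cont_def
  by (rule small_increments_mono[OF assms(1)[unfolded abs_cont_def]]) (use assms(2) in auto)

section \<open>The fundamental theorem of calculus for absolutely continuous functions\<close>

lemma AE_lebesgue_on_negligible:
  fixes S :: "real set"
  assumes "AE t in lebesgue_on S. P t" "S \<in> sets lebesgue"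
  obtains N where "negligible N" "\<And>t. t \<in> S \<Longrightarrow> t \<notin> N \<Longrightarrow> P t"
proof -
  have "AE t in lebesgue. t \<in> S \<longrightarrow> P t"
    using assms by (simp add: AE_restrict_space_iff)
  then obtain N where N: "N \<in> null_sets lebesgue" "{t \<in> space lebesgue. \<not> (t \<in> S \<longrightarrow> P t)} \<subseteq> N"
    by (auto simp: eventually_ae_filter)
  show thesis
    by (rule that[of N]) (use N in \<open>auto simp: negligible_iff_null_sets\<close>)
qed

lemma AE_lebesgue_on_iff_negligible:
  fixes S :: "real set"
  assumes "S \<in> sets lebesgue"
  shows "(AE t in lebesgue_on S. P t) \<longleftrightarrow> (\<exists>N. negligible N \<and> (\<forall>t\<in>S - N. P t))"
proof
  assume "AE t in lebesgue_on S. P t"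
  then show "\<exists>N. negligible N \<and> (\<forall>t\<in>S - N. P t)"
    using AE_lebesgue_on_negligible[OF _ assms] by (metis DiffE)
next
  assume "\<exists>N. negligible N \<and> (\<forall>t\<in>S - N. P t)"
  then obtain N where N: "negligible N" "\<forall>t\<in>S - N. P t" by blast
  have "AE t in lebesgue. t \<in> S \<longrightarrow> P t"
    using N unfolding negligible_iff_null_sets
    by (intro AE_I'[of N]) auto
  then show "AE t in lebesgue_on S. P t"
    using assms by (simp add: AE_restrict_space_iff)
qed

lemma AE_lebesgue_onI:
  fixes S :: "real set"
  assumes "negligible N" "S \<in> sets lebesgue" "\<And>t. t \<in> S \<Longrightarrow> t \<notin> N \<Longrightarrow> P t"
  shows "AE t in lebesgue_on S. P t"
  unfolding AE_lebesgue_on_iff_negligible[OF assms(2)] using assms by (intro exI[of _ N]) simp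

text \<open>A gauge argument. At a point where the derivative exists, the gauge makes the difference quotient
  accurate. The exceptional points form a null set \<open>N\<close>; it is covered by an open set \<open>U\<close> of small
  measure, and the gauge keeps every interval with a tag in \<open>N\<close> inside \<open>U\<close>. These intervals then have
  small total length, and absolute continuity makes the sum of the increments of \<open>f\<close> over them small.\<close>

lemma abs_cont_has_integral_derivative:
  assumes ac: "abs_cont T f"
    and der: "AE t in lebesgue_on {0..T}. (f has_real_derivative g t) (at t within {0..T})"
    and ab: "0 \<le> a" "a \<le> b" "b \<le> T"
  shows "(g has_integral (f b - f a)) {a..b}"
proof (cases "a = b")
  case True
  then show ?thesis using has_integral_refl(2)[of g a] by simp
next
  case False
  with ab have lt: "a < b" by simp
  obtain N where N: "negligible N"
    and dN: "\<And>t. t \<in> {0..T} \<Longrightarrow> t \<notin> N \<Longrightarrow> (f has_real_derivative g t) (at t within {0..T})"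
    using AE_lebesgue_on_negligible[OF der] by auto
  \<comment> \<open>the integrand may be changed on the null set, and the value 0 removes its contribution from the Riemann sums\<close>
  define g' where "g' = (\<lambda>t. if t \<in> N then 0 else g t)"
  have "(g' has_integral (f b - f a)) {a..b}"
    unfolding has_integral_factor_content_real
  proof (intro allI impI)
    fix e :: real assume e: "e > 0"
    then have "e * (b - a) / 2 > 0" using lt by simp
    from small_increments_finite_family[OF ac[unfolded abs_cont_def] this, where 'i = "real \<times> real set"]
    obtain \<delta> where \<delta>: "\<delta> > 0" and *:
      "\<forall>(I :: (real \<times> real set) set) a' b'. finite I \<longrightarrow> (\<forall>i\<in>I. 0 \<le> a' i \<and> a' i \<le> b' i \<and> b' i \<le> T) \<longrightarrow>
       (\<forall>i\<in>I. \<forall>j\<in>I. i \<noteq> j \<longrightarrow> {a' i<..<b' i} \<inter> {a' j<..<b' j} = {}) \<longrightarrow>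
       (\<Sum>i\<in>I. b' i - a' i) < \<delta> \<longrightarrow> (\<Sum>i\<in>I. \<bar>f (b' i) - f (a' i)\<bar>) < e * (b - a) / 2"
      by (elim exE conjE)
    have Nset: "N \<in> sets lebesgue" "emeasure lebesgue N = 0"
      using N by (auto simp: negligible_iff_null_sets null_sets_def)
    obtain U where U: "open U" "N \<subseteq> U" "U - N \<in> lmeasurable" "emeasure lebesgue (U - N) < ennreal \<delta>"
      using sets_lebesgue_outer_open[OF Nset(1) \<delta>] by blast
    have Uset: "U \<in> lmeasurable"
      using fmeasurable.Un[OF U(3), of N] N U(2) by (simp add: negligible_imp_measurable Un_absorb2)
    have "emeasure lebesgue U = emeasure lebesgue (U - N)"
      using emeasure_Diff_null_set[of N lebesgue U] Nset Uset by (simp add: null_sets_def fmeasurableD)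
    with U(4) have mU: "measure lebesgue U < \<delta>"
      using Uset \<delta> by (simp add: measure_def enn2real_less_iff)
        (metis U(3) \<delta> emeasure_eq_measure2 ennreal_less_iff measure_def measure_nonneg)
    have "\<exists>r>0. (x \<in> N \<longrightarrow> ball x r \<subseteq> U) \<and>
      (x \<in> {a..b} \<longrightarrow> x \<notin> N \<longrightarrow> (\<forall>y\<in>{0..T}. \<bar>y - x\<bar> < r \<longrightarrow> \<bar>f y - f x - g x * (y - x)\<bar> \<le> e / 2 * \<bar>y - x\<bar>))" for x
    proof (cases "x \<in> N")
      case True
      then show ?thesis using U(1,2) openE by (metis subsetD)
    next
      case xN: False
      show ?thesis
      proof (cases "x \<in> {a..b}")
        case True
        then have "(f has_derivative (*) (g x)) (at x within {0..T})"
          using dN[of x] xN ab unfolding has_field_derivative_def by auto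
        then have "\<exists>r>0. \<forall>y\<in>{0..T}. norm (y - x) < r \<longrightarrow> norm (f y - f x - g x * (y - x)) \<le> e/2 * norm (y - x)"
          using e unfolding has_derivative_within_alt by (metis half_gt_zero)
        then show ?thesis using xN by auto
      qed (use xN in \<open>auto intro: exI[of _ 1]\<close>)
    qed
    then obtain r where r0: "\<And>x. r x > 0" and rN: "\<And>x. x \<in> N \<Longrightarrow> ball x (r x) \<subseteq> U"
      and rd: "\<And>x y. x \<in> {a..b} \<Longrightarrow> x \<notin> N \<Longrightarrow> y\<in>{0..T} \<Longrightarrow> \<bar>y - x\<bar> < r x \<Longrightarrow>
         \<bar>f y - f x - g x * (y - x)\<bar> \<le> e / 2 * \<bar>y - x\<bar>"
      by metis
    show "\<exists>d. gauge d \<and> (\<forall>p. p tagged_division_of {a..b} \<and> d fine p \<longrightarrow>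
       norm ((\<Sum>(x, k)\<in>p. measure lborel k *\<^sub>R g' x) - (f b - f a)) \<le> e * measure lborel {a..b})"
    proof (rule exI[of _ "\<lambda>x. ball x (r x)"], intro conjI allI impI)
      show "gauge (\<lambda>x. ball x (r x))" using r0 by (simp add: gauge_ball_dependent)
      fix p assume p: "p tagged_division_of {a..b} \<and> (\<lambda>x. ball x (r x)) fine p"
      then have tag: "p tagged_division_of {a..b}" and fine: "(\<lambda>x. ball x (r x)) fine p" by auto
      have fin: "finite p" using tag by blast
      have iv: "k = {Inf k..Sup k} \<and> Inf k \<le> x \<and> x \<le> Sup k \<and> a \<le> Inf k \<and> Sup k \<le> b \<and> x \<in> {a..b}
          \<and> measure lborel k = Sup k - Inf k \<and> k \<subseteq> ball x (r x)"
        if "(x, k) \<in> p" for x k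
      proof -
        from tagged_division_ofD(4)[OF tag that] obtain u v where k: "k = cbox u v" by blast
        have xk: "x \<in> k" "k \<subseteq> {a..b}" using tagged_division_ofD(2,3)[OF tag that] by auto
        then have uv: "u \<le> v" using k by auto
        have IS: "Inf k = u" "Sup k = v" using uv by (auto simp: k)
        have "a \<le> u" "v \<le> b" using xk(2) uv by (auto simp: k)
        moreover have "k \<subseteq> ball x (r x)" using fine that unfolding fine_def by blast
        ultimately show ?thesis unfolding IS using xk uv k by auto
      qed
      define pN where "pN = {q \<in> p. fst q \<in> N}"
      have finN: "finite pN" and subN: "pN \<subseteq> p" using fin by (auto simp: pN_def)
      have disj: "{Inf (snd i)<..<Sup (snd i)} \<inter> {Inf (snd j)<..<Sup (snd j)} = {}"
        if "i \<in> p" "j \<in> p" "i \<noteq> j" for i j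
      proof -
        obtain x k y l where ij: "i = (x, k)" "j = (y, l)" by (metis surj_pair)
        have kl: "k = {Inf k..Sup k}" "l = {Inf l..Sup l}" using iv[of x k] iv[of y l] that ij by auto
        have "interior k \<inter> interior l = {}"
          using tagged_division_ofD(5)[OF tag, of x k y l] that ij by blast
        then have "interior {Inf k..Sup k} \<inter> interior {Inf l..Sup l} = {}" using kl by metis
        then show ?thesis unfolding ij by simp
      qed
      have len: "(\<Sum>i\<in>pN. Sup (snd i) - Inf (snd i)) < \<delta>"
      proof -
        let ?A = "\<lambda>i. {Inf (snd i)<..<Sup (snd i)}"
        have "(\<Sum>i\<in>pN. Sup (snd i) - Inf (snd i)) = (\<Sum>i\<in>pN. measure lebesgue (?A i))"
        proof (rule sum.cong[OF refl])
          fix i assume "i \<in> pN"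
          then have "Inf (snd i) \<le> Sup (snd i)" using iv[of "fst i" "snd i"] subN by force
          then show "Sup (snd i) - Inf (snd i) = measure lebesgue (?A i)" by simp
        qed
        also have "\<dots> = measure lebesgue (\<Union>i\<in>pN. ?A i)"
        proof (rule measure_finite_Union[symmetric, OF finN])
          show "disjoint_family_on ?A pN"
            unfolding disjoint_family_on_def using disj subN by blast
          show "emeasure lebesgue (?A i) \<noteq> \<infinity>" if "i \<in> pN" for i
            using fmeasurableD2[of "box (Inf (snd i)) (Sup (snd i))" lebesgue] by simp
        qed auto
        also have "\<dots> \<le> measure lebesgue U"
        proof (rule measure_mono_fmeasurable[OF _ _ Uset])
          show "(\<Union>i\<in>pN. ?A i) \<subseteq> U"
          proof (rule UN_least)
            fix i assume i: "i \<in> pN"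
            then have ip: "(fst i, snd i) \<in> p" "fst i \<in> N" by (auto simp: pN_def)
            have "?A i \<subseteq> {Inf (snd i)..Sup (snd i)}" by auto
            also have "\<dots> = snd i" using iv[OF ip(1)] by simp
            also have "\<dots> \<subseteq> U" using iv[OF ip(1)] rN[OF ip(2)] by blast
            finally show "?A i \<subseteq> U" .
          qed
          show "(\<Union>i\<in>pN. ?A i) \<in> sets lebesgue" using finN by auto
        qed
        finally show ?thesis using mU by simp
      qed
      have bdN: "\<forall>i\<in>pN. 0 \<le> Inf (snd i) \<and> Inf (snd i) \<le> Sup (snd i) \<and> Sup (snd i) \<le> T"
      proof
        fix i assume "i \<in> pN"
        then have "(fst i, snd i) \<in> p" by (auto simp: pN_def)
        from iv[OF this] show "0 \<le> Inf (snd i) \<and> Inf (snd i) \<le> Sup (snd i) \<and> Sup (snd i) \<le> T" using ab by linarith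
      qed
      have sN: "(\<Sum>i\<in>pN. \<bar>f (Sup (snd i)) - f (Inf (snd i))\<bar>) < e * (b - a) / 2"
      proof -
        have d1: "\<forall>i\<in>pN. \<forall>j\<in>pN. i \<noteq> j \<longrightarrow> {Inf (snd i)<..<Sup (snd i)} \<inter> {Inf (snd j)<..<Sup (snd j)} = {}"
          using disj subN by blast
        show ?thesis
          using *[rule_format, of pN "\<lambda>i. Inf (snd i)" "\<lambda>i. Sup (snd i)"] finN bdN d1 len by simp
      qed
      have bound: "\<bar>measure lborel k * g' x - (f (Sup k) - f (Inf k))\<bar>
            \<le> e / 2 * measure lborel k + (if x \<in> N then \<bar>f (Sup k) - f (Inf k)\<bar> else 0)"
        if q: "(x, k) \<in> p" for x k
      proof (cases "x \<in> N")
        case True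
        then show ?thesis using e by (simp add: g'_def abs_minus_commute)
      next
        case xN: False
        note I = iv[OF q]
        have "Inf k \<in> k" "Sup k \<in> k" using I by (metis atLeastAtMost_iff order.trans order_refl)+
        then have "\<bar>Inf k - x\<bar> < r x" "\<bar>Sup k - x\<bar> < r x"
          using I by (auto simp: dist_real_def abs_minus_commute subset_iff)
        then have d1: "\<bar>f (Inf k) - f x - g x * (Inf k - x)\<bar> \<le> e / 2 * \<bar>Inf k - x\<bar>"
          and d2: "\<bar>f (Sup k) - f x - g x * (Sup k - x)\<bar> \<le> e / 2 * \<bar>Sup k - x\<bar>"
          using rd[of x "Inf k"] rd[of x "Sup k"] I xN ab by auto
        have "measure lborel k * g' x - (f (Sup k) - f (Inf k))
           = (f (Inf k) - f x - g x * (Inf k - x)) - (f (Sup k) - f x - g x * (Sup k - x))"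
        proof -
          have cI: "measure lborel k = Sup k - Inf k" using I by blast
          show ?thesis unfolding cI using xN by (simp add: g'_def algebra_simps)
        qed
        then have "\<bar>measure lborel k * g' x - (f (Sup k) - f (Inf k))\<bar> \<le> e / 2 * \<bar>Inf k - x\<bar> + e / 2 * \<bar>Sup k - x\<bar>"
          using d1 d2 by linarith
        also have "\<dots> = e / 2 * (\<bar>Inf k - x\<bar> + \<bar>Sup k - x\<bar>)" by (simp add: distrib_left)
        also have "\<bar>Inf k - x\<bar> + \<bar>Sup k - x\<bar> = measure lborel k" using I by linarith
        finally show ?thesis using xN by simp
      qed
      have fab: "(\<Sum>(x, k)\<in>p. f (Sup k) - f (Inf k)) = f b - f a"
        using additive_tagged_division_1[OF ab(2) tag, of f] by simp
      have "norm ((\<Sum>(x, k)\<in>p. measure lborel k *\<^sub>R g' x) - (f b - f a))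
          = \<bar>\<Sum>q\<in>p. measure lborel (snd q) * g' (fst q) - (f (Sup (snd q)) - f (Inf (snd q)))\<bar>"
        unfolding fab[symmetric] sum_subtractf[symmetric] by (simp add: case_prod_unfold sum_subtractf)
      also have "\<dots> \<le> (\<Sum>q\<in>p. \<bar>measure lborel (snd q) * g' (fst q) - (f (Sup (snd q)) - f (Inf (snd q)))\<bar>)"
        by (rule sum_abs)
      also have "\<dots> \<le> (\<Sum>q\<in>p. e / 2 * measure lborel (snd q) + (if fst q \<in> N then \<bar>f (Sup (snd q)) - f (Inf (snd q))\<bar> else 0))"
        by (rule sum_mono) (use bound in force)
      also have "\<dots> = e / 2 * (\<Sum>q\<in>p. measure lborel (snd q)) + (\<Sum>q\<in>pN. \<bar>f (Sup (snd q)) - f (Inf (snd q))\<bar>)"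
        unfolding sum.distrib sum_distrib_left pN_def using fin by (simp add: sum.inter_filter)
      also have "(\<Sum>q\<in>p. measure lborel (snd q)) = b - a"
        using additive_content_tagged_division[of p a b] tag ab(2) by (simp add: case_prod_unfold)
      also have "e / 2 * (b - a) + (\<Sum>q\<in>pN. \<bar>f (Sup (snd q)) - f (Inf (snd q))\<bar>) \<le> e * (b - a)"
        using sN by (simp add: field_simps)
      finally show "norm ((\<Sum>(x, k)\<in>p. measure lborel k *\<^sub>R g' x) - (f b - f a)) \<le> e * measure lborel {a..b}"
        using ab(2) by simp
    qed
  qed
  then show ?thesis
    by (rule has_integral_spike[OF N, rotated]) (simp add: g'_def)
qed

text \<open>On an interval shorter than the \<open>\<delta>\<close> that belongs to \<open>\<epsilon> = 1\<close>, absolute continuity bounds the variation of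
  \<open>f\<close> by 1, so there the derivative is absolutely integrable. Finitely many such intervals cover \<open>[0, T]\<close>.\<close>

lemma abs_cont_derivative_integrable:
  assumes ac: "abs_cont T f"
    and der: "AE t in lebesgue_on {0..T}. (f has_real_derivative g t) (at t within {0..T})"
    and T: "0 \<le> T"
  shows "integrable (lebesgue_on {0..T}) g"
proof -
  have "(0::real) < 1" by simp
  from small_increments_finite_family[OF ac[unfolded abs_cont_def] this, where 'i = "real set"]
  obtain \<delta> where \<delta>: "\<delta> > 0" and *:
      "\<forall>(I :: real set set) a' b'. finite I \<longrightarrow> (\<forall>i\<in>I. 0 \<le> a' i \<and> a' i \<le> b' i \<and> b' i \<le> T) \<longrightarrow>
       (\<forall>i\<in>I. \<forall>j\<in>I. i \<noteq> j \<longrightarrow> {a' i<..<b' i} \<inter> {a' j<..<b' j} = {}) \<longrightarrow>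
       (\<Sum>i\<in>I. b' i - a' i) < \<delta> \<longrightarrow> (\<Sum>i\<in>I. \<bar>f (b' i) - f (a' i)\<bar>) < 1"
    by (elim exE conjE)
  have piece: "g absolutely_integrable_on {c..d}" if cd: "0 \<le> c" "c \<le> d" "d \<le> T" "d - c < \<delta>" for c d
    unfolding box_real(2)[symmetric]
  proof (rule bounded_variation_absolutely_integrable_interval)
    show "g integrable_on cbox c d"
      using abs_cont_has_integral_derivative[OF ac der cd(1-3)] by (auto simp: integrable_on_def)
    fix D assume D: "D division_of (cbox c d)"
    have iv: "k = {Inf k..Sup k} \<and> c \<le> Inf k \<and> Inf k \<le> Sup k \<and> Sup k \<le> d \<and> measure lborel k = Sup k - Inf k"
      if "k \<in> D" for k
    proof -
      from division_ofD(4)[OF D that] obtain u v where k: "k = cbox u v" by blast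
      have sub: "k \<subseteq> cbox c d" "k \<noteq> {}" using division_ofD(2,3)[OF D that] by auto
      then have uv: "u \<le> v" using k by auto
      have IS: "Inf k = u" "Sup k = v" using uv by (auto simp: k)
      have "c \<le> u" "v \<le> d" using sub uv by (auto simp: k)
      then show ?thesis unfolding IS using uv k by auto
    qed
    have fin: "finite D" using D by blast
    have "(\<Sum>k\<in>D. norm (integral k g)) = (\<Sum>k\<in>D. \<bar>f (Sup k) - f (Inf k)\<bar>)"
    proof (rule sum.cong[OF refl])
      fix k assume k: "k \<in> D"
      have "(g has_integral (f (Sup k) - f (Inf k))) {Inf k..Sup k}"
        using iv[OF k] cd by (intro abs_cont_has_integral_derivative[OF ac der]) auto
      then have "integral {Inf k..Sup k} g = f (Sup k) - f (Inf k)" by (rule integral_unique)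
      then show "norm (integral k g) = \<bar>f (Sup k) - f (Inf k)\<bar>" using iv[OF k] by simp
    qed
    also have "\<dots> < 1"
    proof (rule *[rule_format, OF fin])
      show "0 \<le> Inf i \<and> Inf i \<le> Sup i \<and> Sup i \<le> T" if "i \<in> D" for i using iv[OF that] cd by auto
      show "{Inf i<..<Sup i} \<inter> {Inf j<..<Sup j} = {}" if ij: "i \<in> D" "j \<in> D" "i \<noteq> j" for i j
      proof -
        have "interior i \<inter> interior j = {}" using division_ofD(5)[OF D] ij by blast
        then have "interior {Inf i..Sup i} \<inter> interior {Inf j..Sup j} = {}" using iv ij by metis
        then show ?thesis by simp
      qed
      have "(\<Sum>i\<in>D. Sup i - Inf i) = (\<Sum>i\<in>D. measure lborel i)"
        by (rule sum.cong) (use iv in auto)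
      also have "\<dots> = d - c" using additive_content_division[OF D] cd by simp
      finally show "(\<Sum>i\<in>D. Sup i - Inf i) < \<delta>" using cd by simp
    qed
    finally show "(\<Sum>k\<in>D. norm (integral k g)) \<le> 1" by simp
  qed
  \<comment> \<open>cover \<open>[0, T]\<close> by steps of length \<open>\<delta>/2\<close>, the last one truncated at \<open>T\<close>\<close>
  have "g absolutely_integrable_on {0..min T (real n * (\<delta>/2))}" for n
  proof (induction n)
    case 0
    have "g absolutely_integrable_on cbox 0 0" by (rule absolutely_integrable_on_null) simp
    then show ?case using T by (simp only: box_real) simp
  next
    case (Suc n)
    have "g absolutely_integrable_on {min T (real n * (\<delta>/2))..min T (real (Suc n) * (\<delta>/2))}"
      using \<delta> T by (intro piece) (auto simp: algebra_simps min_def)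
    then have "g absolutely_integrable_on ({0..min T (real n * (\<delta>/2))} \<union> {min T (real n * (\<delta>/2))..min T (real (Suc n) * (\<delta>/2))})"
      using Suc by (intro absolutely_integrable_Un) auto
    also have "{0..min T (real n * (\<delta>/2))} \<union> {min T (real n * (\<delta>/2))..min T (real (Suc n) * (\<delta>/2))} = {0..min T (real (Suc n) * (\<delta>/2))}"
      using \<delta> T by (intro ivl_disj_un_two_touch(4)) (auto simp: algebra_simps min_def)
    finally show ?case .
  qed
  moreover obtain n where "T < real n * (\<delta>/2)"
    using reals_Archimedean3[of "\<delta>/2"] \<delta> by auto
  ultimately have "g absolutely_integrable_on {0..T}"
    by (metis min.absorb1 less_imp_le)
  then show ?thesis by (rule absolutely_integrable_imp_integrable) simp
qed

section \<open>Integrals of Lebesgue integrable functions\<close>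

text \<open>The notion of solution used throughout: \<open>f\<close> is absolutely continuous and \<open>g\<close> is its derivative almost
  everywhere. Differential equations are stated with it, and it is closed under the usual rules of
  differentiation.\<close>

definition ac_deriv :: "real \<Rightarrow> (real \<Rightarrow> real) \<Rightarrow> (real \<Rightarrow> real) \<Rightarrow> bool" where
  "ac_deriv T f g \<longleftrightarrow> abs_cont T f \<and>
     (AE t in lebesgue_on {0..T}. (f has_real_derivative g t) (at t within {0..T}))"

lemma ac_derivD:
  assumes "ac_deriv T f g"
  shows "abs_cont T f" "AE t in lebesgue_on {0..T}. (f has_real_derivative g t) (at t within {0..T})"
  using assms by (auto simp: ac_deriv_def)

lemma ac_deriv_cong_AE:
  assumes "ac_deriv T f g" "AE t in lebesgue_on {0..T}. g t = h t"
  shows "ac_deriv T f h"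
proof -
  have "AE t in lebesgue_on {0..T}. (f has_real_derivative h t) (at t within {0..T})"
    using ac_derivD(2)[OF assms(1)] assms(2) by eventually_elim simp
  then show ?thesis using ac_derivD(1)[OF assms(1)] by (simp add: ac_deriv_def)
qed

lemma ac_deriv_const: "ac_deriv T (\<lambda>t. c) (\<lambda>t. 0)"
  by (simp add: ac_deriv_def)

lemma ac_deriv_add:
  assumes "ac_deriv T f f'" "ac_deriv T g g'"
  shows "ac_deriv T (\<lambda>t. f t + g t) (\<lambda>t. f' t + g' t)"
proof -
  have "AE t in lebesgue_on {0..T}. ((\<lambda>t. f t + g t) has_real_derivative f' t + g' t) (at t within {0..T})"
    using ac_derivD(2)[OF assms(1)] ac_derivD(2)[OF assms(2)]
    by eventually_elim (rule DERIV_add)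
  then show ?thesis using assms by (simp add: ac_deriv_def abs_cont_add)
qed

lemma ac_deriv_mult:
  assumes "ac_deriv T f f'" "ac_deriv T g g'"
  shows "ac_deriv T (\<lambda>t. f t * g t) (\<lambda>t. f' t * g t + g' t * f t)"
proof -
  have "AE t in lebesgue_on {0..T}. ((\<lambda>t. f t * g t) has_real_derivative f' t * g t + g' t * f t) (at t within {0..T})"
    using ac_derivD(2)[OF assms(1)] ac_derivD(2)[OF assms(2)]
    by eventually_elim (rule DERIV_mult)
  then show ?thesis using assms by (simp add: ac_deriv_def abs_cont_mult)
qed

lemma ac_deriv_sum:
  assumes "finite J" "\<And>j. j \<in> J \<Longrightarrow> ac_deriv T (f j) (f' j)"
  shows "ac_deriv T (\<lambda>t. \<Sum>j\<in>J. f j t) (\<lambda>t. \<Sum>j\<in>J. f' j t)"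
  using assms
  by (induction J rule: finite_induct) (auto intro: ac_deriv_add ac_deriv_const)

lemma ac_deriv_cmult:
  assumes "ac_deriv T f f'"
  shows "ac_deriv T (\<lambda>t. c * f t) (\<lambda>t. c * f' t)"
  using ac_deriv_mult[OF ac_deriv_const[of T c] assms] by (simp add: mult.commute)

lemma ac_deriv_integral:
  assumes "ac_deriv T f g" "0 \<le> T"
  shows "integrable (lebesgue_on {0..T}) g" "f T - f 0 = (\<integral>t. g t \<partial>lebesgue_on {0..T})"
proof -
  show int: "integrable (lebesgue_on {0..T}) g"
    by (rule abs_cont_derivative_integrable[OF ac_derivD[OF assms(1)] assms(2)])
  have "(g has_integral (f T - f 0)) {0..T}"
    by (rule abs_cont_has_integral_derivative[OF ac_derivD[OF assms(1)]]) (use assms in auto)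
  then have "integral {0..T} g = f T - f 0" by (rule integral_unique)
  then show "f T - f 0 = (\<integral>t. g t \<partial>lebesgue_on {0..T})"
    using int by (simp add: lebesgue_integral_eq_integral)
qed

lemma ac_deriv_zero_constant:
  assumes "ac_deriv T f (\<lambda>t. 0)" "t \<in> {0..T}"
  shows "f t = f 0"
proof -
  have "((\<lambda>t. 0) has_integral (f t - f 0)) {0..t}"
    by (rule abs_cont_has_integral_derivative[OF ac_derivD[OF assms(1)]]) (use assms in auto)
  then have "f t - f 0 = 0" using has_integral_unique has_integral_0 by blast
  then show ?thesis by simp
qed

lemma ac_deriv_smooth:
  assumes der: "\<And>t. (f has_real_derivative f' t) (at t)" and cont: "continuous_on {0..T} f'"
  shows "ac_deriv T f f'"
proof -
  have "compact (f' ` {0..T})" using cont compact_continuous_image by blast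
  then obtain C where C: "\<forall>y\<in>f' ` {0..T}. norm y \<le> C" "C > 0"
    using compact_imp_bounded bounded_pos by metis
  have "\<bar>f y - f x\<bar> \<le> C * (y - x)" if "0 \<le> x" "x \<le> y" "y \<le> T" for x y
  proof (cases "x = y")
    case False
    with that have "x < y" by simp
    from MVT2[OF this, of f f'] obtain z where z: "x < z" "z < y" "f y - f x = (y - x) * f' z"
      using der by auto
    have "\<bar>f' z\<bar> \<le> C" using C(1) z that by auto
    then show ?thesis using z that by (simp add: abs_mult mult.commute mult_right_mono)
  qed auto
  then have "abs_cont T f" by (rule abs_cont_lipschitz) (use C in auto)
  moreover have "(f has_real_derivative f' t) (at t within {0..T})" for t
    using der has_field_derivative_at_within by blast
  ultimately show ?thesis by (simp add: ac_deriv_def)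
qed

lemma right_derivative_of_integral:
  fixes g :: "real \<Rightarrow> real"
  assumes int: "\<And>a b. g integrable_on {a..b}"
  obtains N where "negligible N"
    "\<And>x. x \<notin> N \<Longrightarrow> ((\<lambda>h. (integral {x..x + h} g) / h) \<longlongrightarrow> g x) (at_right 0)"
proof -
  obtain N where N: "negligible N" and *: "\<And>x e. \<lbrakk>x \<notin> N; 0 < e\<rbrakk> \<Longrightarrow>
     \<exists>d>0. \<forall>h. 0 < h \<and> h < d \<longrightarrow> norm(integral (cbox x (x + h *\<^sub>R One)) g /\<^sub>R h ^ DIM(real) - g x) < e"
    using integrable_ccontinuous_explicit[of g] int by (metis box_real(2))
  have "((\<lambda>h. (integral {x..x + h} g) / h) \<longlongrightarrow> g x) (at_right 0)" if "x \<notin> N" for x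
    unfolding tendsto_iff
  proof (intro allI impI)
    fix e :: real assume "e > 0"
    from *[OF that this] obtain d where d: "d > 0"
      "\<And>h. 0 < h \<Longrightarrow> h < d \<Longrightarrow> norm(integral (cbox x (x + h *\<^sub>R One)) g /\<^sub>R h ^ DIM(real) - g x) < e" by blast
    show "\<forall>\<^sub>F h in at_right 0. dist (integral {x..x + h} g / h) (g x) < e"
      unfolding eventually_at_right_field
      using d by (intro exI[of _ d]) (auto simp: dist_real_def divide_inverse mult.commute)
  qed
  with N that show thesis by blast
qed

text \<open>The Lebesgue differentiation theorem used here is one-sided. Applied to \<open>g\<close> and to its reflection
  \<open>t \<mapsto> g (-t)\<close>, both extended by 0, it gives the right and the left derivative of the integral.\<close>

lemma AE_has_derivative_integral:
  fixes g :: "real \<Rightarrow> real"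
  assumes int: "integrable (lebesgue_on {0..T}) g"
  shows "AE t in lebesgue_on {0..T}. ((\<lambda>t. integral {0..t} g) has_real_derivative g t) (at t within {0..T})"
proof -
  define g0 where "g0 = (\<lambda>t. if t \<in> {0..T} then g t else 0)"
  have gi: "g integrable_on {0..T}" using int by (intro integrable_on_lebesgue_on) auto
  have "g0 integrable_on UNIV" unfolding g0_def using gi by (simp only: integrable_restrict_UNIV)
  then have g0int: "g0 integrable_on {a..b}" for a b
    using integrable_on_subcbox[of g0 UNIV a b] by simp
  define g1 where "g1 = (\<lambda>t. g0 (- t))"
  have g1int: "g1 integrable_on {a..b}" for a b
    using Henstock_Kurzweil_Integration.integrable_reflect_real[where a="-b" and b="-a" and f=g0] g0int[of "-b" "-a"]
    unfolding g1_def by (simp only: minus_minus)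
  obtain N0 where N0: "negligible N0"
    "\<And>x. x \<notin> N0 \<Longrightarrow> ((\<lambda>h. (integral {x..x + h} g0) / h) \<longlongrightarrow> g0 x) (at_right 0)"
    using right_derivative_of_integral[of g0] g0int by blast
  obtain N1 where N1: "negligible N1"
    "\<And>x. x \<notin> N1 \<Longrightarrow> ((\<lambda>h. (integral {x..x + h} g1) / h) \<longlongrightarrow> g1 x) (at_right 0)"
    using right_derivative_of_integral[of g1] g1int by blast
  define N where "N = N0 \<union> uminus ` N1 \<union> {0, T}"
  have "negligible (uminus ` N1)"
  proof (rule negligible_locally_Lipschitz_image)
    show "\<exists>U B. open U \<and> x \<in> U \<and> (\<forall>y\<in>N1 \<inter> U. norm (- y - - x) \<le> B * norm (y - x))" for x
      by (intro exI[of _ UNIV] exI[of _ 1]) auto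
  qed (use N1 in auto)
  then have N: "negligible N" using N0 unfolding N_def by auto
  have "((\<lambda>t. integral {0..t} g) has_real_derivative g t) (at t within {0..T})"
    if t: "t \<in> {0..T}" "t \<notin> N" for t
  proof -
    have t0: "0 < t" "t < T" using t unfolding N_def by auto
    have g0t: "g0 t = g t" using t by (simp add: g0_def)
    have comb: "integral {0..b} g = integral {0..a} g + integral {a..b} g" if "0 \<le> a" "a \<le> b" "b \<le> T" for a b
      using Henstock_Kurzweil_Integration.integral_combine[of 0 a b g] that
        integrable_on_subinterval[OF gi, of 0 b] by auto
    have eq0: "integral {a..b} g0 = integral {a..b} g" if "0 \<le> a" "b \<le> T" for a b
      by (rule Henstock_Kurzweil_Integration.integral_cong) (use that in \<open>auto simp: g0_def\<close>)
    have eq1: "integral {a..b} g1 = integral {-b..-a} g0" for a b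
      using Henstock_Kurzweil_Integration.integral_reflect_real[where a="-b" and b="-a" and f=g0]
    unfolding g1_def by (simp only: minus_minus)
    have right: "((\<lambda>h. (integral {0..t + h} g - integral {0..t} g) / h) \<longlongrightarrow> g t) (at_right 0)"
    proof (rule Lim_transform_eventually)
      show "((\<lambda>h. (integral {t..t + h} g0) / h) \<longlongrightarrow> g t) (at_right 0)"
        using N0(2)[of t] t g0t unfolding N_def by auto
      have "integral {t..t + h} g0 = integral {0..t + h} g - integral {0..t} g" if "0 < h" "h < T - t" for h
        using comb[of t "t + h"] eq0[of t "t + h"] that t0 by simp
      then show "\<forall>\<^sub>F h in at_right 0. integral {t..t + h} g0 / h = (integral {0..t + h} g - integral {0..t} g) / h"
        unfolding eventually_at_right_field
        using t0 by (intro exI[of _ "T - t"]) simp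
    qed
    have left': "((\<lambda>h. (integral {0..t} g - integral {0..t - h} g) / h) \<longlongrightarrow> g t) (at_right 0)"
    proof (rule Lim_transform_eventually)
      have "- t \<notin> N1" using t unfolding N_def by force
      then show "((\<lambda>h. (integral {-t..-t + h} g1) / h) \<longlongrightarrow> g t) (at_right 0)"
        using N1(2)[of "-t"] g0t by (simp add: g1_def)
      have "integral {-t..-t + h} g1 = integral {0..t} g - integral {0..t - h} g" if "0 < h" "h < t" for h
        using eq1[of "-t" "-t+h"] eq0[of "t-h" t] comb[of "t-h" t] that t0 by simp
      then show "\<forall>\<^sub>F h in at_right 0. integral {-t..-t + h} g1 / h = (integral {0..t} g - integral {0..t - h} g) / h"
        unfolding eventually_at_right_field using t0 by (intro exI[of _ t]) auto
    qed
    have left: "((\<lambda>h. (integral {0..t + h} g - integral {0..t} g) / h) \<longlongrightarrow> g t) (at_left 0)"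
    proof -
      have "((\<lambda>h. (integral {0..t + - h} g - integral {0..t} g) / - h) \<longlongrightarrow> g t) (at_right 0)"
        using left' by (rule Lim_transform_eventually) (auto simp: eventually_at_right_field divide_simps intro!: exI[of _ 1])
      then show ?thesis
        using filterlim_at_left_to_right[of "\<lambda>h. (integral {0..t + h} g - integral {0..t} g) / h" "nhds (g t)" 0] by simp
    qed
    have "((\<lambda>h. (integral {0..t + h} g - integral {0..t} g) / h) \<longlongrightarrow> g t) (at 0)"
      using left right by (simp add: filterlim_split_at)
    then have "((\<lambda>t. integral {0..t} g) has_real_derivative g t) (at t)"
      unfolding DERIV_def .
    then show ?thesis using has_field_derivative_at_within by blast
  qed
  then show ?thesis using N AE_lebesgue_on_iff_negligible[of "{0..T}"] by auto
qed

lemma integral_if_mem: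
  fixes h :: "real \<Rightarrow> real"
  shows "integral S (\<lambda>t. if t \<in> K then h t else 0) = integral (K \<inter> S) h"
  unfolding integral_def integrable_on_def has_integral_restrict_Int by (rule refl)

text \<open>Split \<open>|g|\<close> at a level \<open>k\<close> such that the part \<open>\<psi>\<close> above \<open>k\<close> has integral less than \<open>\<epsilon>/2\<close>. Over disjoint
  intervals, the part below \<open>k\<close> contributes at most \<open>k\<close> times the total length, and \<open>\<psi>\<close> contributes at most
  its integral over \<open>[0, T]\<close>.\<close>

lemma abs_cont_integral:
  fixes g :: "real \<Rightarrow> real"
  assumes int: "integrable (lebesgue_on {0..T}) g"
  shows "abs_cont T (\<lambda>t. integral {0..t} g)"
  unfolding abs_cont_def
proof (rule small_incrementsI)
  fix \<epsilon> :: real assume \<epsilon>: "\<epsilon> > 0"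
  let ?M = "lebesgue_on {0..T}"
  have meas: "g \<in> borel_measurable ?M" using int by auto
  have intabs: "integrable ?M (\<lambda>t. \<bar>g t\<bar>)" using int by simp
  have intmin: "integrable ?M (\<lambda>t. min \<bar>g t\<bar> (real k))" for k
    by (rule Bochner_Integration.integrable_bound[OF intabs]) (use meas in auto)
  have "(\<lambda>k. \<integral>t. min \<bar>g t\<bar> (real k) \<partial>?M) \<longlonglongrightarrow> (\<integral>t. \<bar>g t\<bar> \<partial>?M)"
  proof (rule integral_dominated_convergence[where w="\<lambda>t. \<bar>g t\<bar>"])
    have "(\<lambda>k. min \<bar>g t\<bar> (real k)) \<longlonglongrightarrow> \<bar>g t\<bar>" for t
    proof (rule tendsto_eventually)
      obtain k0 where "\<bar>g t\<bar> \<le> real k0" using real_arch_simple by blast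
      then show "\<forall>\<^sub>F k in sequentially. min \<bar>g t\<bar> (real k) = \<bar>g t\<bar>"
        unfolding eventually_sequentially by (intro exI[of _ k0]) (auto simp: min_def)
    qed
    then show "AE x in ?M. (\<lambda>k. min \<bar>g x\<bar> (real k)) \<longlonglongrightarrow> \<bar>g x\<bar>" by simp
  qed (use meas intabs in auto)
  then have "\<forall>\<^sub>F k in sequentially. dist (\<integral>t. min \<bar>g t\<bar> (real k) \<partial>?M) (\<integral>t. \<bar>g t\<bar> \<partial>?M) < \<epsilon>/2"
    using \<epsilon> by (intro tendstoD) auto
  then obtain k where k: "dist (\<integral>t. min \<bar>g t\<bar> (real k) \<partial>?M) (\<integral>t. \<bar>g t\<bar> \<partial>?M) < \<epsilon>/2"
    using eventually_happens'[OF sequentially_bot] by blast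
  define \<psi> where "\<psi> = (\<lambda>t. \<bar>g t\<bar> - min \<bar>g t\<bar> (real k))"
  have \<psi>: "integrable ?M \<psi>" "\<And>t. \<psi> t \<ge> 0" unfolding \<psi>_def using intabs intmin by auto
  have small: "(\<integral>t. \<psi> t \<partial>?M) < \<epsilon>/2"
  proof -
    have "(\<integral>t. \<psi> t \<partial>?M) = (\<integral>t. \<bar>g t\<bar> \<partial>?M) - (\<integral>t. min \<bar>g t\<bar> (real k) \<partial>?M)"
      unfolding \<psi>_def by (rule Bochner_Integration.integral_diff[OF intabs intmin])
    then show ?thesis using k unfolding dist_real_def by linarith
  qed
  define \<delta> where "\<delta> = \<epsilon> / (2 * (real k + 1))"
  have \<delta>: "\<delta> > 0" using \<epsilon> by (simp add: \<delta>_def)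
  have gi: "g integrable_on {0..T}" using int by (intro integrable_on_lebesgue_on) auto
  have "(\<Sum>i<n. \<bar>integral {0..b i} g - integral {0..a i} g\<bar>) < \<epsilon>"
    if fam: "short_family T \<delta> n a b" for n a b
  proof -
    have ab: "0 \<le> a i" "a i \<le> b i" "b i \<le> T" if "i < n" for i
      using fam that by (auto simp: short_family_def)
    define I where "I = (\<lambda>i t. indicator {a i<..<b i} t :: real)"
    have I01: "0 \<le> I i t" "I i t \<le> 1" for i t by (auto simp: I_def indicator_def)
    have Imeas: "I i \<in> borel_measurable ?M" for i
      unfolding I_def by (intro measurable_restrict_space1 borel_measurable_indicator) auto
    have intI: "integrable ?M (I i)" for i
      by (rule finite_measure.integrable_const_bound[where B=1])
         (use I01 Imeas in \<open>auto intro!: finite_measure_lebesgue_on\<close>)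
    have intmul: "integrable ?M (\<lambda>t. I i t * h t)" if h: "integrable ?M h" for i h
    proof (rule Bochner_Integration.integrable_bound[OF h])
      show "(\<lambda>t. I i t * h t) \<in> borel_measurable ?M"
        using Imeas[of i] borel_measurable_integrable[OF h] by (rule borel_measurable_times)
      have "norm (I i t * h t) \<le> norm (h t)" for t
        using I01[of i t] by (simp add: abs_mult mult_left_le_one_le)
      then show "AE t in ?M. norm (I i t * h t) \<le> norm (h t)" by simp
    qed
    have intI\<psi>: "integrable ?M (\<lambda>t. I i t * \<psi> t)" for i by (rule intmul[OF \<psi>(1)])
    have bound: "\<bar>integral {0..b i} g - integral {0..a i} g\<bar> \<le> real k * (b i - a i) + (\<integral>t. I i t * \<psi> t \<partial>?M)"
      if i: "i < n" for i
    proof -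
      have "integral {0..b i} g = integral {0..a i} g + integral {a i..b i} g"
        using Henstock_Kurzweil_Integration.integral_combine[of 0 "a i" "b i" g] ab[OF i]
          integrable_on_subinterval[OF gi, of 0 "b i"] by auto
      then have "integral {0..b i} g - integral {0..a i} g = integral {a i..b i} g" by simp
      also have "\<dots> = integral {a i<..<b i} g"
        using integral_open_interval[of "a i" "b i" g] by simp
      also have "\<dots> = integral {0..T} (\<lambda>t. if t \<in> {a i<..<b i} then g t else 0)"
      proof -
        have "{a i<..<b i} \<inter> {0..T} = {a i<..<b i}" using ab[OF i] by auto
        then show ?thesis by (simp only: integral_if_mem)
      qed
      also have "\<dots> = integral {0..T} (\<lambda>t. I i t * g t)"
        by (rule Henstock_Kurzweil_Integration.integral_cong) (simp add: I_def)
      also have "\<dots> = (\<integral>t. I i t * g t \<partial>?M)"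
        by (intro lebesgue_integral_eq_integral[symmetric] intmul[OF int]) simp
      finally have "\<bar>integral {0..b i} g - integral {0..a i} g\<bar> = \<bar>\<integral>t. I i t * g t \<partial>?M\<bar>" by simp
      also have "\<dots> \<le> (\<integral>t. \<bar>I i t * g t\<bar> \<partial>?M)" by (rule integral_abs_bound)
      also have "\<dots> \<le> (\<integral>t. real k * I i t + I i t * \<psi> t \<partial>?M)"
      proof (rule integral_mono)
        show "integrable ?M (\<lambda>t. \<bar>I i t * g t\<bar>)" by (intro integrable_abs intmul[OF int])
        show "integrable ?M (\<lambda>t. real k * I i t + I i t * \<psi> t)"
          by (intro Bochner_Integration.integrable_add integrable_mult_right intI intI\<psi>)
        show "\<bar>I i t * g t\<bar> \<le> real k * I i t + I i t * \<psi> t" for t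
        proof -
          have "I i t * \<bar>g t\<bar> \<le> I i t * (real k + \<psi> t)"
            unfolding \<psi>_def by (intro mult_left_mono I01) auto
          then show ?thesis using I01[of i t] by (simp add: abs_mult algebra_simps)
        qed
      qed
      also have "\<dots> = real k * (\<integral>t. I i t \<partial>?M) + (\<integral>t. I i t * \<psi> t \<partial>?M)"
        using intI[of i] intI\<psi>[of i] by simp
      also have "(\<integral>t. I i t \<partial>?M) = b i - a i"
      proof -
        have sub: "{a i<..<b i} \<subseteq> {0..T}" using ab[OF i] by auto
        then have "(\<integral>t. I i t \<partial>?M) = measure ?M {a i<..<b i}"
          unfolding I_def using Bochner_Integration.integral_indicator[of ?M "{a i<..<b i}"]
          by (simp only: space_restrict_space Int_absorb2) (simp add: Int_absorb2)
        also have "\<dots> = measure lebesgue {a i<..<b i}"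
          using sub by (intro measure_restrict_space) auto
        also have "\<dots> = b i - a i" using ab[OF i] by simp
        finally show ?thesis .
      qed
      finally show ?thesis .
    qed
    have "(\<Sum>i<n. \<bar>integral {0..b i} g - integral {0..a i} g\<bar>) \<le>
        (\<Sum>i<n. real k * (b i - a i) + (\<integral>t. I i t * \<psi> t \<partial>?M))"
      by (rule sum_mono) (use bound in auto)
    also have "\<dots> = real k * (\<Sum>i<n. b i - a i) + (\<Sum>i<n. (\<integral>t. I i t * \<psi> t \<partial>?M))"
      unfolding sum.distrib sum_distrib_left ..
    also have "(\<Sum>i<n. (\<integral>t. I i t * \<psi> t \<partial>?M)) = (\<integral>t. (\<Sum>i<n. I i t * \<psi> t) \<partial>?M)"
      by (rule Bochner_Integration.integral_sum[symmetric]) (rule intI\<psi>)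
    also have "\<dots> \<le> (\<integral>t. \<psi> t \<partial>?M)"
    proof (rule integral_mono)
      show "integrable ?M (\<lambda>t. \<Sum>i<n. I i t * \<psi> t)"
        by (rule Bochner_Integration.integrable_sum) (rule intI\<psi>)
      show "(\<Sum>i<n. I i t * \<psi> t) \<le> \<psi> t" for t
      proof -
        have "disjoint_family_on (\<lambda>i. {a i<..<b i}) {..<n}"
          using fam unfolding short_family_def disjoint_family_on_def by blast
        then have "(\<Sum>i<n. I i t) = indicator (\<Union>i<n. {a i<..<b i}) t"
          unfolding I_def by (subst indicator_UN_disjoint) auto
        also have "\<dots> \<le> 1" by (simp add: indicator_def)
        finally have "(\<Sum>i<n. I i t) * \<psi> t \<le> 1 * \<psi> t" using \<psi>(2) by (rule mult_right_mono)
        then show ?thesis by (simp add: sum_distrib_right)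
      qed
    qed (rule \<psi>(1))
    finally have le: "(\<Sum>i<n. \<bar>integral {0..b i} g - integral {0..a i} g\<bar>) \<le> real k * (\<Sum>i<n. b i - a i) + (\<integral>t. \<psi> t \<partial>?M)"
      by simp
    have sum0: "0 \<le> (\<Sum>i<n. b i - a i)" by (rule sum_nonneg) (use ab in auto)
    have "(\<Sum>i<n. b i - a i) \<le> \<delta>" using fam by (simp add: short_family_def)
    then have "real k * (\<Sum>i<n. b i - a i) \<le> (real k + 1) * \<delta>"
      using sum0 by (intro mult_mono) auto
    also have "\<dots> = \<epsilon> / 2" by (simp add: \<delta>_def field_simps)
    finally show ?thesis using small le by linarith
  qed
  with \<delta> show "\<exists>\<delta>>0. \<forall>n a b. short_family T \<delta> n a b \<longrightarrow> (\<Sum>i<n. \<bar>integral {0..b i} g - integral {0..a i} g\<bar>) < \<epsilon>"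
    by (intro exI[of _ \<delta>]) simp
qed

lemma ac_deriv_of_integral:
  fixes g :: "real \<Rightarrow> real"
  assumes "integrable (lebesgue_on {0..T}) g"
  shows "ac_deriv T (\<lambda>t. integral {0..t} g) g"
  using abs_cont_integral[OF assms] AE_has_derivative_integral[OF assms] by (simp add: ac_deriv_def)

section \<open>Linear systems with integrable inhomogeneity\<close>

text \<open>Powers of the \<open>n \<times> n\<close> matrix with entries \<open>A i j\<close>, given as functions of the indices so that the
  exponential series can be treated entrywise as a real power series.\<close>

primrec mpow :: "nat \<Rightarrow> (nat \<Rightarrow> nat \<Rightarrow> real) \<Rightarrow> nat \<Rightarrow> nat \<Rightarrow> nat \<Rightarrow> real" where
  "mpow n A 0 i j = (if i = j then 1 else 0)"
| "mpow n A (Suc k) i j = (\<Sum>l<n. A i l * mpow n A k l j)"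

lemma mpow_Suc_right:
  assumes "i < n" "j < n"
  shows "mpow n A (Suc k) i j = (\<Sum>l<n. mpow n A k i l * A l j)"
  using assms(1)
proof (induction k arbitrary: i)
  case 0
  have "(\<Sum>l<n. A i l * (if l = j then 1 else 0)) = A i j"
    using assms(2) by (simp add: sum.delta' if_distrib cong: if_cong)
  moreover have "(\<Sum>l<n. (if i = l then 1 else 0) * A l j) = A i j"
    using 0 by (simp add: if_distrib[of "\<lambda>x. x * _"] sum.delta cong: if_cong)
  ultimately show ?case by simp
next
  case (Suc k)
  have "mpow n A (Suc (Suc k)) i j = (\<Sum>l<n. A i l * mpow n A (Suc k) l j)" by simp
  also have "\<dots> = (\<Sum>l<n. A i l * (\<Sum>m<n. mpow n A k l m * A m j))"
    by (rule sum.cong) (use Suc.IH in auto)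
  also have "\<dots> = (\<Sum>l<n. \<Sum>m<n. A i l * mpow n A k l m * A m j)"
    by (simp add: sum_distrib_left mult.assoc)
  also have "\<dots> = (\<Sum>m<n. \<Sum>l<n. A i l * mpow n A k l m * A m j)"
    by (rule sum.swap)
  also have "\<dots> = (\<Sum>m<n. mpow n A (Suc k) i m * A m j)"
    by (simp add: sum_distrib_right)
  finally show ?case .
qed

text \<open>The sum of the absolute values of all entries bounds every row sum, so it dominates each entry of a power
  by its own power, and the exponential series by a scalar one.\<close>

lemma mpow_bound:
  assumes "i < n"
  shows "\<bar>mpow n A k i j\<bar> \<le> (\<Sum>i<n. \<Sum>l<n. \<bar>A i l\<bar>) ^ k"
  using assms
proof (induction k arbitrary: i)
  case 0
  then show ?case by simp
next
  case (Suc k)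
  let ?a = "\<Sum>i<n. \<Sum>l<n. \<bar>A i l\<bar>"
  have a0: "?a \<ge> 0" by (intro sum_nonneg) auto
  have row: "(\<Sum>l<n. \<bar>A i l\<bar>) \<le> ?a"
    using Suc.prems by (intro member_le_sum[of i "{..<n}" "\<lambda>i. \<Sum>l<n. \<bar>A i l\<bar>"]) (auto intro: sum_nonneg)
  have "\<bar>mpow n A (Suc k) i j\<bar> \<le> (\<Sum>l<n. \<bar>A i l * mpow n A k l j\<bar>)" by simp
  also have "\<dots> \<le> (\<Sum>l<n. \<bar>A i l\<bar> * ?a ^ k)"
    by (rule sum_mono) (use Suc.IH in \<open>auto simp: abs_mult intro!: mult_left_mono\<close>)
  also have "\<dots> = (\<Sum>l<n. \<bar>A i l\<bar>) * ?a ^ k" by (simp add: sum_distrib_right)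
  also have "\<dots> \<le> ?a * ?a ^ k" using row a0 by (intro mult_right_mono) auto
  finally show ?case by simp
qed

definition mexp :: "nat \<Rightarrow> (nat \<Rightarrow> nat \<Rightarrow> real) \<Rightarrow> real \<Rightarrow> nat \<Rightarrow> nat \<Rightarrow> real" where
  "mexp n A t i j = (\<Sum>k. mpow n A k i j / fact k * t ^ k)"

lemma mexp_summable:
  assumes "i < n"
  shows "summable (\<lambda>k. mpow n A k i j / fact k * t ^ k)"
proof (rule summable_comparison_test)
  let ?a = "\<Sum>i<n. \<Sum>l<n. \<bar>A i l\<bar>"
  show "summable (\<lambda>k. inverse (fact k) * (?a * \<bar>t\<bar>) ^ k)" by (rule summable_exp)
  have "norm (mpow n A k i j / fact k * t ^ k) \<le> inverse (fact k) * (?a * \<bar>t\<bar>) ^ k" for k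
  proof -
    have "norm (mpow n A k i j / fact k * t ^ k) = \<bar>mpow n A k i j\<bar> * (inverse (fact k) * \<bar>t\<bar> ^ k)"
      by (simp add: abs_mult power_abs divide_inverse)
    also have "\<dots> \<le> ?a ^ k * (inverse (fact k) * \<bar>t\<bar> ^ k)"
      by (intro mult_right_mono mpow_bound assms) auto
    finally show ?thesis by (simp add: power_mult_distrib mult_ac)
  qed
  then show "\<exists>N. \<forall>k\<ge>N. norm (mpow n A k i j / fact k * t ^ k) \<le> inverse (fact k) * (?a * \<bar>t\<bar>) ^ k"
    by blast
qed

lemma mexp_zero: "mexp n A 0 i j = (if i = j then 1 else 0)"
  unfolding mexp_def by (subst powser_zero) simp

lemma mexp_deriv_series:
  assumes "i < n"
  shows "((\<lambda>t. mexp n A t i j) has_real_derivative (\<Sum>k. mpow n A (Suc k) i j / fact k * t ^ k)) (at t)"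
proof -
  have "diffs (\<lambda>k. mpow n A k i j / fact k) = (\<lambda>k. mpow n A (Suc k) i j / fact k)"
  proof
    fix k
    have "real (Suc k) * (mpow n A (Suc k) i j / fact (Suc k)) = mpow n A (Suc k) i j / fact k"
      unfolding fact_Suc using of_nat_neq_0[of k, where 'a=real] by (simp del: mpow.simps of_nat_Suc)
    then show "diffs (\<lambda>k. mpow n A k i j / fact k) k = mpow n A (Suc k) i j / fact k"
      by (simp only: diffs_def)
  qed
  then show ?thesis
    unfolding mexp_def
    using termdiffs_strong_converges_everywhere[of "\<lambda>k. mpow n A k i j / fact k" t] mexp_summable[OF assms]
    by simp
qed

lemma mexp_deriv_left:
  assumes "i < n"
  shows "((\<lambda>t. mexp n A t i j) has_real_derivative (\<Sum>l<n. A i l * mexp n A t l j)) (at t)"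
proof -
  have "(\<Sum>k. mpow n A (Suc k) i j / fact k * t ^ k) = (\<Sum>k. \<Sum>l<n. A i l * (mpow n A k l j / fact k * t ^ k))"
    by (simp add: sum_divide_distrib sum_distrib_right mult.assoc)
  also have "\<dots> = (\<Sum>l<n. \<Sum>k. A i l * (mpow n A k l j / fact k * t ^ k))"
    by (intro suminf_sum summable_mult mexp_summable) simp
  also have "\<dots> = (\<Sum>l<n. A i l * mexp n A t l j)"
    unfolding mexp_def by (rule sum.cong[OF refl], rule suminf_mult) (use mexp_summable in auto)
  finally show ?thesis using mexp_deriv_series[OF assms, of A j t] by simp
qed

lemma mexp_deriv_right:
  assumes "i < n" "j < n"
  shows "((\<lambda>t. mexp n A t i j) has_real_derivative (\<Sum>l<n. mexp n A t i l * A l j)) (at t)"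
proof -
  have "(\<Sum>k. mpow n A (Suc k) i j / fact k * t ^ k) = (\<Sum>k. \<Sum>l<n. (mpow n A k i l / fact k * t ^ k) * A l j)"
    unfolding mpow_Suc_right[OF assms] sum_divide_distrib sum_distrib_right
    by (intro suminf_cong sum.cong refl) simp
  also have "\<dots> = (\<Sum>l<n. \<Sum>k. (mpow n A k i l / fact k * t ^ k) * A l j)"
    by (intro suminf_sum summable_mult2 mexp_summable assms)
  also have "\<dots> = (\<Sum>l<n. mexp n A t i l * A l j)"
    unfolding mexp_def by (rule sum.cong[OF refl], rule suminf_mult2[symmetric]) (use mexp_summable[OF assms(1)] in auto)
  finally show ?thesis using mexp_deriv_series[OF assms(1), of A j t] by simp
qed

lemma mexp_minus_deriv:
  assumes "i < n"
  shows "((\<lambda>t. mexp n A (- t) i j) has_real_derivative - (\<Sum>l<n. A i l * mexp n A (- t) l j)) (at t)"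
proof -
  have "((\<lambda>t. mexp n A (- t) i j) has_real_derivative (\<Sum>l<n. A i l * mexp n A (- t) l j) * - 1) (at t)"
    by (rule DERIV_chain2[OF mexp_deriv_left[OF assms]]) (auto intro!: derivative_eq_intros)
  then show ?thesis by simp
qed

text \<open>The product \<open>e\<^sup>t\<^sup>A e\<^sup>-\<^sup>t\<^sup>A\<close> has derivative \<open>e\<^sup>t\<^sup>A A e\<^sup>-\<^sup>t\<^sup>A - e\<^sup>t\<^sup>A A e\<^sup>-\<^sup>t\<^sup>A = 0\<close>. This is why the derivative of
  \<open>e\<^sup>t\<^sup>A\<close> is computed with the factor \<open>A\<close> on the right as well as on the left.\<close>

lemma mexp_inverse:
  assumes "i < n" "j < n"
  shows "(\<Sum>l<n. mexp n A t i l * mexp n A (- t) l j) = (if i = j then 1 else 0)"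
proof -
  let ?Z = "\<lambda>t. \<Sum>l<n. mexp n A t i l * mexp n A (- t) l j"
  have "(?Z has_real_derivative 0) (at t)" for t
  proof -
    have "(?Z has_real_derivative (\<Sum>l<n. (\<Sum>m<n. mexp n A t i m * A m l) * mexp n A (- t) l j
        + - (\<Sum>m<n. A l m * mexp n A (- t) m j) * mexp n A t i l)) (at t)"
      by (intro DERIV_sum DERIV_mult mexp_deriv_right mexp_minus_deriv assms) auto
    also have "(\<Sum>l<n. (\<Sum>m<n. mexp n A t i m * A m l) * mexp n A (- t) l j
        + - (\<Sum>m<n. A l m * mexp n A (- t) m j) * mexp n A t i l)
      = (\<Sum>l<n. \<Sum>m<n. mexp n A t i m * A m l * mexp n A (- t) l j)
        - (\<Sum>l<n. \<Sum>m<n. mexp n A t i l * A l m * mexp n A (- t) m j)"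
      by (simp add: sum_distrib_left sum_distrib_right sum_subtractf mult_ac)
    also have "\<dots> = 0"
      by (subst sum.swap) simp
    finally show ?thesis .
  qed
  then have "?Z t = ?Z 0" by (intro DERIV_isconst_all) auto
  also have "\<dots> = (if i = j then 1 else 0)"
    using assms by (simp add: mexp_zero if_distrib[of "\<lambda>x. x * _"] sum.delta cong: if_cong)
  finally show ?thesis .
qed

lemma mexp_continuous: "i < n \<Longrightarrow> continuous_on S (\<lambda>t. mexp n A t i j)"
  using mexp_deriv_left by (meson DERIV_isCont continuous_at_imp_continuous_on)

lemma mexp_minus_continuous: "i < n \<Longrightarrow> continuous_on S (\<lambda>t. mexp n A (- t) i j)"
  using mexp_minus_deriv by (meson DERIV_isCont continuous_at_imp_continuous_on)

lemma mexp_bounded: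
  obtains K where "K \<ge> 0" "\<And>i j t. i < n \<Longrightarrow> j < n \<Longrightarrow> t \<in> {0..T} \<Longrightarrow> \<bar>mexp n A t i j\<bar> \<le> K \<and> \<bar>mexp n A (- t) i j\<bar> \<le> K"
proof -
  have "\<exists>K. \<forall>t\<in>{-\<bar>T\<bar>..\<bar>T\<bar>}. \<bar>mexp n A t i j\<bar> \<le> K" if "i < n" for i j
  proof -
    have "compact ((\<lambda>t. mexp n A t i j) ` {-\<bar>T\<bar>..\<bar>T\<bar>})"
      by (intro compact_continuous_image mexp_continuous that compact_Icc)
    then obtain K where "\<forall>y\<in>(\<lambda>t. mexp n A t i j) ` {-\<bar>T\<bar>..\<bar>T\<bar>}. norm y \<le> K"
      using compact_imp_bounded bounded_iff by metis
    then show ?thesis by auto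
  qed
  then obtain K where K: "\<And>i j t. i < n \<Longrightarrow> t \<in> {-\<bar>T\<bar>..\<bar>T\<bar>} \<Longrightarrow> \<bar>mexp n A t i j\<bar> \<le> K i j" by metis
  define K' where "K' = (\<Sum>i<n. \<Sum>j<n. \<bar>K i j\<bar>)"
  have le: "K i j \<le> K'" if "i < n" "j < n" for i j
  proof -
    have "K i j \<le> \<bar>K i j\<bar>" by simp
    also have "\<dots> \<le> (\<Sum>j<n. \<bar>K i j\<bar>)"
      using that by (intro member_le_sum[of j "{..<n}" "\<lambda>j. \<bar>K i j\<bar>"]) auto
    also have "\<dots> \<le> K'" unfolding K'_def
      using that by (intro member_le_sum[of i "{..<n}" "\<lambda>i. \<Sum>j<n. \<bar>K i j\<bar>"]) (auto intro: sum_nonneg)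
    finally show ?thesis .
  qed
  show thesis
  proof (rule that[of K'])
    show "K' \<ge> 0" unfolding K'_def by (intro sum_nonneg) auto
    fix i j t assume h: "i < n" "j < n" "t \<in> {0..T}"
    then have "t \<in> {-\<bar>T\<bar>..\<bar>T\<bar>}" "- t \<in> {-\<bar>T\<bar>..\<bar>T\<bar>}" by auto
    then show "\<bar>mexp n A t i j\<bar> \<le> K' \<and> \<bar>mexp n A (- t) i j\<bar> \<le> K'"
      using K[of i t j] K[of i "- t" j] le[of i j] h by linarith
  qed
qed

text \<open>Variation of constants: the solution of \<open>y' = A y + g\<close>, \<open>y(0) = y\<^sub>0\<close> is
  \<open>y(t) = e\<^sup>t\<^sup>A (y\<^sub>0 + \<integral>\<^sub>0\<^sup>t e\<^sup>-\<^sup>s\<^sup>A g(s) ds)\<close>.\<close>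

definition duhamel_integrand :: "nat \<Rightarrow> (nat \<Rightarrow> nat \<Rightarrow> real) \<Rightarrow> (nat \<Rightarrow> real \<Rightarrow> real) \<Rightarrow> nat \<Rightarrow> real \<Rightarrow> real" where
  "duhamel_integrand n A g j s = (\<Sum>l<n. mexp n A (- s) j l * g l s)"

definition duhamel :: "nat \<Rightarrow> (nat \<Rightarrow> nat \<Rightarrow> real) \<Rightarrow> (nat \<Rightarrow> real) \<Rightarrow> (nat \<Rightarrow> real \<Rightarrow> real) \<Rightarrow> nat \<Rightarrow> real \<Rightarrow> real" where
  "duhamel n A y0 g i t = (\<Sum>j<n. mexp n A t i j * (y0 j + integral {0..t} (duhamel_integrand n A g j)))"

lemma integrable_bounded_mult:
  fixes g h :: "real \<Rightarrow> real"
  assumes g: "integrable (lebesgue_on {0..T}) g"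
    and h: "h \<in> borel_measurable (lebesgue_on {0..T})" and K: "\<And>t. t \<in> {0..T} \<Longrightarrow> \<bar>h t\<bar> \<le> K"
  shows "integrable (lebesgue_on {0..T}) (\<lambda>t. h t * g t)"
proof (rule Bochner_Integration.integrable_bound)
  show "integrable (lebesgue_on {0..T}) (\<lambda>t. K * g t)" using g by simp
  show "(\<lambda>t. h t * g t) \<in> borel_measurable (lebesgue_on {0..T})"
    using h borel_measurable_integrable[OF g] by (rule borel_measurable_times)
  show "AE t in lebesgue_on {0..T}. norm (h t * g t) \<le> norm (K * g t)"
  proof (rule AE_I2)
    fix t assume "t \<in> space (lebesgue_on {0..T})"
    then have "\<bar>h t\<bar> \<le> \<bar>K\<bar>" using K[of t] by (simp add: space_restrict_space)
    then show "norm (h t * g t) \<le> norm (K * g t)" by (simp add: abs_mult mult_right_mono)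
  qed
qed

lemma integrable_continuous_mult:
  fixes g h :: "real \<Rightarrow> real"
  assumes g: "integrable (lebesgue_on {0..T}) g" and h: "continuous_on {0..T} h"
  shows "integrable (lebesgue_on {0..T}) (\<lambda>t. h t * g t)"
proof -
  have "compact (h ` {0..T})" using h compact_continuous_image by blast
  then obtain K where K: "\<forall>y\<in>h ` {0..T}. norm y \<le> K"
    using compact_imp_bounded bounded_iff by metis
  show ?thesis
    by (rule integrable_bounded_mult[OF g, where K=K])
      (use K h in \<open>auto intro: continuous_imp_measurable_on_sets_lebesgue\<close>)
qed

lemma duhamel_integrand_integrable:
  assumes "\<And>l. l < n \<Longrightarrow> integrable (lebesgue_on {0..T}) (g l)" "j < n"
  shows "integrable (lebesgue_on {0..T}) (duhamel_integrand n A g j)"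
proof -
  have "integrable (lebesgue_on {0..T}) (\<lambda>s. \<Sum>l<n. mexp n A (- s) j l * g l s)"
    by (intro Bochner_Integration.integrable_sum integrable_continuous_mult mexp_minus_continuous assms) auto
  then show ?thesis by (simp add: duhamel_integrand_def[abs_def])
qed

lemma duhamel_ac_deriv:
  assumes g: "\<And>l. l < n \<Longrightarrow> integrable (lebesgue_on {0..T}) (g l)" and i: "i < n"
  shows "ac_deriv T (duhamel n A y0 g i) (\<lambda>t. (\<Sum>j<n. A i j * duhamel n A y0 g j t) + g i t)"
proof -
  let ?e = "mexp n A" and ?w = "duhamel_integrand n A g"
  let ?c = "\<lambda>j t. y0 j + integral {0..t} (?w j)"
  have e: "ac_deriv T (\<lambda>t. ?e t i j) (\<lambda>t. \<Sum>l<n. A i l * ?e t l j)" for j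
  proof (rule ac_deriv_smooth[OF mexp_deriv_left[OF i]])
    show "continuous_on {0..T} (\<lambda>t. \<Sum>l<n. A i l * ?e t l j)"
      by (intro continuous_intros mexp_continuous) auto
  qed
  have c: "ac_deriv T (?c j) (?w j)" if "j < n" for j
    using ac_deriv_add[OF ac_deriv_const[of T "y0 j"] ac_deriv_of_integral[OF duhamel_integrand_integrable[OF g that]]]
    by simp
  have "ac_deriv T (\<lambda>t. \<Sum>j<n. ?e t i j * ?c j t)
      (\<lambda>t. \<Sum>j<n. (\<Sum>l<n. A i l * ?e t l j) * ?c j t + ?w j t * ?e t i j)"
    by (intro ac_deriv_sum ac_deriv_mult e c) auto
  moreover have "(\<Sum>j<n. (\<Sum>l<n. A i l * ?e t l j) * ?c j t + ?w j t * ?e t i j)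
      = (\<Sum>l<n. A i l * duhamel n A y0 g l t) + g i t" for t
  proof -
    have "(\<Sum>j<n. (\<Sum>l<n. A i l * ?e t l j) * ?c j t) = (\<Sum>j<n. \<Sum>l<n. A i l * (?e t l j * ?c j t))"
      by (simp only: sum_distrib_right mult.assoc)
    also have "\<dots> = (\<Sum>l<n. \<Sum>j<n. A i l * (?e t l j * ?c j t))" by (rule sum.swap)
    also have "\<dots> = (\<Sum>l<n. A i l * duhamel n A y0 g l t)"
      by (simp only: duhamel_def sum_distrib_left)
    finally have 1: "(\<Sum>j<n. (\<Sum>l<n. A i l * ?e t l j) * ?c j t) = (\<Sum>l<n. A i l * duhamel n A y0 g l t)" .
    have "(\<Sum>j<n. ?w j t * ?e t i j) = (\<Sum>j<n. \<Sum>l<n. (?e t i j * ?e (- t) j l) * g l t)"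
      unfolding duhamel_integrand_def sum_distrib_right by (intro sum.cong refl) simp
    also have "\<dots> = (\<Sum>l<n. \<Sum>j<n. (?e t i j * ?e (- t) j l) * g l t)" by (rule sum.swap)
    also have "\<dots> = (\<Sum>l<n. (\<Sum>j<n. ?e t i j * ?e (- t) j l) * g l t)"
      by (simp only: sum_distrib_right)
    also have "\<dots> = (\<Sum>l<n. (if i = l then 1 else 0) * g l t)"
      by (rule sum.cong) (use mexp_inverse[OF i] in auto)
    also have "\<dots> = g i t"
      using i by (simp add: if_distrib[of "\<lambda>x. x * _"] sum.delta cong: if_cong)
    finally have 2: "(\<Sum>j<n. ?w j t * ?e t i j) = g i t" .
    show ?thesis unfolding sum.distrib 1 2 ..
  qed
  ultimately show ?thesis by (simp add: duhamel_def[abs_def])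
qed

lemma duhamel_zero: "i < n \<Longrightarrow> duhamel n A y0 g i 0 = y0 i"
  unfolding duhamel_def
  by (simp add: mexp_zero if_distrib[of "\<lambda>x. x * _"] sum.delta cong: if_cong)

text \<open>The initial value that leads to a prescribed value \<open>y\<^sub>T\<close> at time \<open>T\<close> is
  \<open>e\<^sup>-\<^sup>T\<^sup>A y\<^sub>T - \<integral>\<^sub>0\<^sup>T e\<^sup>-\<^sup>s\<^sup>A g(s) ds\<close>. The adjoint state is obtained in this way.\<close>

lemma linear_ode_terminal:
  fixes n :: nat and A :: "nat \<Rightarrow> nat \<Rightarrow> real"
  assumes g: "\<And>l. l < n \<Longrightarrow> integrable (lebesgue_on {0..T}) (g l)"
  obtains y where "\<And>i. i < n \<Longrightarrow> ac_deriv T (y i) (\<lambda>t. (\<Sum>j<n. A i j * y j t) + g i t)"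
    "\<And>i. i < n \<Longrightarrow> y i T = yT i"
proof -
  define y0 where "y0 = (\<lambda>j. (\<Sum>k<n. mexp n A (- T) j k * yT k) - integral {0..T} (duhamel_integrand n A g j))"
  have "duhamel n A y0 g i T = yT i" if i: "i < n" for i
  proof -
    have "duhamel n A y0 g i T = (\<Sum>j<n. mexp n A T i j * (\<Sum>k<n. mexp n A (- T) j k * yT k))"
      by (simp add: duhamel_def y0_def)
    also have "\<dots> = (\<Sum>j<n. \<Sum>k<n. mexp n A T i j * mexp n A (- T) j k * yT k)"
      by (simp add: sum_distrib_left mult.assoc)
    also have "\<dots> = (\<Sum>k<n. \<Sum>j<n. mexp n A T i j * mexp n A (- T) j k * yT k)" by (rule sum.swap)
    also have "\<dots> = (\<Sum>k<n. (\<Sum>j<n. mexp n A T i j * mexp n A (- T) j k) * yT k)"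
      by (simp add: sum_distrib_right)
    also have "\<dots> = (\<Sum>k<n. (if i = k then 1 else 0) * yT k)"
      by (rule sum.cong) (use mexp_inverse[OF i] in auto)
    also have "\<dots> = yT i"
      using i by (simp add: if_distrib[of "\<lambda>x. x * _"] sum.delta cong: if_cong)
    finally show ?thesis .
  qed
  with duhamel_ac_deriv[of n T g, OF g] show thesis by (intro that[of "duhamel n A y0 g"])
qed

text \<open>The constant does not depend on \<open>g\<close>: state perturbations are controlled by the \<open>L\<^sup>1\<close> norm of the
  perturbation of the right-hand side alone.\<close>

lemma linear_ode_forced:
  fixes n :: nat and A :: "nat \<Rightarrow> nat \<Rightarrow> real"
  obtains C where "C \<ge> 0"
    "\<And>g. (\<And>l. l < n \<Longrightarrow> integrable (lebesgue_on {0..T}) (g l)) \<Longrightarrow>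
      \<exists>y. (\<forall>i<n. ac_deriv T (y i) (\<lambda>t. (\<Sum>j<n. A i j * y j t) + g i t) \<and> y i 0 = 0 \<and>
        (\<forall>t\<in>{0..T}. \<bar>y i t\<bar> \<le> C * (\<integral>s. (\<Sum>l<n. \<bar>g l s\<bar>) \<partial>lebesgue_on {0..T})))"
proof -
  obtain K where K: "K \<ge> 0" "\<And>i j t. i < n \<Longrightarrow> j < n \<Longrightarrow> t \<in> {0..T} \<Longrightarrow> \<bar>mexp n A t i j\<bar> \<le> K \<and> \<bar>mexp n A (- t) i j\<bar> \<le> K"
    using mexp_bounded[of n T A] by blast
  show thesis
  proof (rule that[of "real n * (K * K)"])
    show "0 \<le> real n * (K * K)" using K by simp
    fix g :: "nat \<Rightarrow> real \<Rightarrow> real" assume g: "\<And>l. l < n \<Longrightarrow> integrable (lebesgue_on {0..T}) (g l)"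
    let ?M = "lebesgue_on {0..T}"
    let ?L = "\<integral>s. (\<Sum>l<n. \<bar>g l s\<bar>) \<partial>?M"
    let ?y = "duhamel n A (\<lambda>_. 0) g"
    have gs: "integrable ?M (\<lambda>s. \<Sum>l<n. \<bar>g l s\<bar>)" using g by auto
    have gs': "integrable ?M (\<lambda>s. K * (\<Sum>l<n. \<bar>g l s\<bar>))" by (rule integrable_mult_right) (rule gs)
    have w: "\<bar>integral {0..t} (duhamel_integrand n A g j)\<bar> \<le> K * ?L" if t: "t \<in> {0..T}" and j: "j < n" for t j
    proof -
      have wi: "integrable ?M (duhamel_integrand n A g j)" by (rule duhamel_integrand_integrable[OF g j])
      have hi: "(\<lambda>s. K * (\<Sum>l<n. \<bar>g l s\<bar>)) integrable_on {0..T}"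
        by (rule integrable_on_lebesgue_on[OF gs']) simp
      have "norm (integral {0..t} (duhamel_integrand n A g j)) \<le> integral {0..t} (\<lambda>s. K * (\<Sum>l<n. \<bar>g l s\<bar>))"
      proof (rule integral_norm_bound_integral)
        show "duhamel_integrand n A g j integrable_on {0..t}"
          using integrable_on_subinterval[OF integrable_on_lebesgue_on[OF wi]] t by auto
        show "(\<lambda>s. K * (\<Sum>l<n. \<bar>g l s\<bar>)) integrable_on {0..t}"
          using integrable_on_subinterval[OF hi] t by auto
        show "norm (duhamel_integrand n A g j s) \<le> K * (\<Sum>l<n. \<bar>g l s\<bar>)" if "s \<in> {0..t}" for s
        proof -
          have "norm (duhamel_integrand n A g j s) \<le> (\<Sum>l<n. \<bar>mexp n A (- s) j l * g l s\<bar>)"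
            unfolding duhamel_integrand_def by simp
          also have "\<dots> \<le> (\<Sum>l<n. K * \<bar>g l s\<bar>)"
            by (rule sum_mono) (use K(2)[OF j, of _ s] that t in \<open>auto simp: abs_mult intro!: mult_right_mono\<close>)
          finally show ?thesis by (simp add: sum_distrib_left)
        qed
      qed
      also have "\<dots> \<le> integral {0..T} (\<lambda>s. K * (\<Sum>l<n. \<bar>g l s\<bar>))"
        by (rule integral_subset_le)
          (use hi t K in \<open>auto intro!: integrable_on_subinterval[OF hi] mult_nonneg_nonneg sum_nonneg\<close>)
      also have "\<dots> = K * ?L"
        using lebesgue_integral_eq_integral[OF gs'] by simp argo
      finally show ?thesis by simp
    qed
    have "\<bar>?y i t\<bar> \<le> real n * (K * K) * ?L" if i: "i < n" and t: "t \<in> {0..T}" for i t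
    proof -
      have "\<bar>?y i t\<bar> \<le> (\<Sum>j<n. \<bar>mexp n A t i j\<bar> * \<bar>integral {0..t} (duhamel_integrand n A g j)\<bar>)"
        unfolding duhamel_def by (simp add: abs_mult[symmetric])
      also have "\<dots> \<le> (\<Sum>j<n. K * (K * ?L))"
        by (rule sum_mono) (use K(1) K(2)[OF i _ t] w[OF t] in \<open>auto intro!: mult_mono\<close>)
      finally show ?thesis by (simp add: mult_ac)
    qed
    then show "\<exists>y. (\<forall>i<n. ac_deriv T (y i) (\<lambda>t. (\<Sum>j<n. A i j * y j t) + g i t) \<and> y i 0 = 0 \<and>
        (\<forall>t\<in>{0..T}. \<bar>y i t\<bar> \<le> real n * (K * K) * ?L))"
      using duhamel_ac_deriv[of n T g, OF g] by (intro exI[of _ ?y]) (simp add: duhamel_zero)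
  qed
qed

section \<open>Maxima of absolutely continuous functions\<close>

text \<open>A zero with nonzero derivative is isolated among the zeros. Enclosing each such zero in an interval with
  rational endpoints that contains no other zero gives an injection into pairs of rationals.\<close>

lemma countable_zeros_nonzero_derivative:
  fixes f f' :: "real \<Rightarrow> real"
  shows "countable {t \<in> S. f t = 0 \<and> f' t \<noteq> 0 \<and> (f has_real_derivative f' t) (at t within S)}" (is "countable ?Z")
proof -
  have "\<exists>r>0. \<forall>s\<in>S. s \<noteq> t \<longrightarrow> \<bar>s - t\<bar> < r \<longrightarrow> f s \<noteq> 0" if "t \<in> ?Z" for t
  proof -
    have "((\<lambda>s. (f s - f t) / (s - t)) \<longlongrightarrow> f' t) (at t within S)"
      using that unfolding has_field_derivative_iff by blast
    then have "\<forall>\<^sub>F s in at t within S. (f s - f t) / (s - t) \<noteq> 0"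
      using that by (intro tendsto_imp_eventually_ne) auto
    then obtain r where "r > 0" "\<forall>s\<in>S. s \<noteq> t \<and> dist s t < r \<longrightarrow> (f s - f t) / (s - t) \<noteq> 0"
      unfolding eventually_at by blast
    then show ?thesis using that by (intro exI[of _ r]) (auto simp: dist_real_def)
  qed
  then have "\<forall>t\<in>?Z. \<exists>r. r > 0 \<and> (\<forall>s\<in>S. s \<noteq> t \<longrightarrow> \<bar>s - t\<bar> < r \<longrightarrow> f s \<noteq> 0)" by blast
  from bchoice[OF this] obtain r where
    r: "\<forall>t\<in>?Z. r t > 0 \<and> (\<forall>s\<in>S. s \<noteq> t \<longrightarrow> \<bar>s - t\<bar> < r t \<longrightarrow> f s \<noteq> 0)" by (elim exE)
  have "\<forall>t\<in>?Z. \<exists>pq :: rat \<times> rat. t - r t < of_rat (fst pq) \<and> of_rat (fst pq) < t \<and> t < of_rat (snd pq) \<and> of_rat (snd pq) < t + r t"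
  proof
    fix t assume "t \<in> ?Z"
    then have "r t > 0" using r by blast
    then obtain p q where "t - r t < of_rat p" "of_rat p < t" "t < of_rat q" "of_rat q < t + r t"
      using of_rat_dense[of "t - r t" t] of_rat_dense[of t "t + r t"] by auto
    then show "\<exists>pq :: rat \<times> rat. t - r t < of_rat (fst pq) \<and> of_rat (fst pq) < t \<and> t < of_rat (snd pq) \<and> of_rat (snd pq) < t + r t"
      by (intro exI[of _ "(p, q)"]) simp
  qed
  from bchoice[OF this] obtain pq :: "real \<Rightarrow> rat \<times> rat" where pq: "\<forall>t\<in>?Z.
     t - r t < of_rat (fst (pq t)) \<and> of_rat (fst (pq t)) < t \<and> t < of_rat (snd (pq t)) \<and> of_rat (snd (pq t)) < t + r t"
    by (elim exE)
  have "inj_on pq ?Z"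
  proof (rule inj_onI, rule ccontr)
    fix t s assume h: "t \<in> ?Z" "s \<in> ?Z" "pq t = pq s" "t \<noteq> s"
    then have "of_rat (fst (pq t)) < s" "s < of_rat (snd (pq t))" using pq by auto
    then have "\<bar>s - t\<bar> < r t" using bspec[OF pq h(1)] by linarith
    then show False using bspec[OF r h(1)] h by auto
  qed
  then show ?thesis by (rule countableI') 
qed

text \<open>The absolute value fails to be differentiable only where \<open>f\<close> crosses 0 with nonzero slope. If the slope
  is 0 as well, the derivative is 0, which the factor \<open>sgn (f t) = 0\<close> accounts for.\<close>

lemma has_real_derivative_abs_comp:
  fixes f :: "real \<Rightarrow> real"
  assumes d: "(f has_real_derivative D) (at t within S)" and nz: "f t = 0 \<Longrightarrow> D = 0" and t: "t \<in> S"
  shows "((\<lambda>s. \<bar>f s\<bar>) has_real_derivative sgn (f t) * D) (at t within S)"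
proof (cases "f t = 0")
  case True
  then have "((\<lambda>s. f s / (s - t)) \<longlongrightarrow> 0) (at t within S)"
    using d nz unfolding has_field_derivative_iff by simp
  then have "((\<lambda>s. \<bar>f s / (s - t)\<bar>) \<longlongrightarrow> 0) (at t within S)"
    by (rule tendsto_rabs_zero)
  then have "((\<lambda>s. \<bar>f s\<bar> / (s - t)) \<longlongrightarrow> 0) (at t within S)"
    by (subst tendsto_rabs_zero_iff[symmetric]) (simp add: abs_divide)
  then show ?thesis using True unfolding has_field_derivative_iff by simp
next
  case False
  have cont: "(f \<longlongrightarrow> f t) (at t within S)"
    using DERIV_continuous[OF d] by (simp add: continuous_within)
  have "\<forall>\<^sub>F s in at t within S. sgn (f t) * f s = \<bar>f s\<bar>"
  proof (cases "f t > 0")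
    case True
    then have "\<forall>\<^sub>F s in at t within S. f s > 0" using cont by (intro order_tendstoD) auto
    then show ?thesis by eventually_elim (use True in simp)
  next
    case neg: False
    with False have "f t < 0" by simp
    then have "\<forall>\<^sub>F s in at t within S. f s < 0" using cont by (intro order_tendstoD) auto
    then show ?thesis by eventually_elim (use \<open>f t < 0\<close> in simp)
  qed
  then obtain e where e: "e > 0" "\<forall>s\<in>S. s \<noteq> t \<and> dist s t < e \<longrightarrow> sgn (f t) * f s = \<bar>f s\<bar>"
    unfolding eventually_at by blast
  have "((\<lambda>s. sgn (f t) * f s) has_real_derivative sgn (f t) * D) (at t within S)"
    using DERIV_cmult[OF d] .
  then show ?thesis
    by (rule has_field_derivative_transform_within[OF _ e(1) t])
      (use e(2) False in \<open>auto simp: abs_sgn mult.commute\<close>)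
qed

lemma ac_deriv_abs:
  assumes "ac_deriv T f f'"
  shows "ac_deriv T (\<lambda>t. \<bar>f t\<bar>) (\<lambda>t. sgn (f t) * f' t)"
proof -
  let ?S = "{0..T}"
  let ?Z = "{t \<in> ?S. f t = 0 \<and> f' t \<noteq> 0 \<and> (f has_real_derivative f' t) (at t within ?S)}"
  obtain N where N: "negligible N" "\<forall>t\<in>?S - N. (f has_real_derivative f' t) (at t within ?S)"
    using ac_derivD(2)[OF assms] AE_lebesgue_on_iff_negligible[of ?S] by auto
  have neg: "negligible (N \<union> ?Z)"
    using N(1) countable_imp_null_set_lborel[OF countable_zeros_nonzero_derivative[of ?S f f']]
    by (intro negligible_Un) (auto simp: negligible_iff_null_sets intro: null_sets_completionI)
  have "((\<lambda>s. \<bar>f s\<bar>) has_real_derivative sgn (f t) * f' t) (at t within ?S)" if "t \<in> ?S" "t \<notin> N \<union> ?Z" for t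
    using N(2) that by (intro has_real_derivative_abs_comp) auto
  then have "AE t in lebesgue_on ?S. ((\<lambda>s. \<bar>f s\<bar>) has_real_derivative sgn (f t) * f' t) (at t within ?S)"
    by (intro AE_lebesgue_onI[OF neg]) auto
  then show ?thesis
    using abs_cont_abs[OF ac_derivD(1)[OF assms]] by (simp add: ac_deriv_def)
qed

text \<open>Use \<open>max a b = (a + b + |a - b|) / 2\<close>.\<close>

lemma ac_deriv_max:
  assumes "ac_deriv T f f'" "ac_deriv T g g'"
  shows "\<exists>h'. ac_deriv T (\<lambda>t. max (f t) (g t)) h'"
proof -
  have neg: "ac_deriv T (\<lambda>t. - 1 * g t) (\<lambda>t. - 1 * g' t)" by (rule ac_deriv_cmult[OF assms(2)])
  have "(\<lambda>t. 1/2 * ((f t + g t) + \<bar>f t + - 1 * g t\<bar>)) = (\<lambda>t. max (f t) (g t))"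
    by (rule ext) (simp add: max_def)
  with ac_deriv_cmult[OF ac_deriv_add[OF ac_deriv_add[OF assms] ac_deriv_abs[OF ac_deriv_add[OF assms(1) neg]]], of "1/2"]
  show ?thesis by (simp only:) (rule exI)
qed

lemma ac_deriv_Max:
  assumes "finite K" "K \<noteq> {}" "\<And>k. k \<in> K \<Longrightarrow> \<exists>f'. ac_deriv T (f k) f'"
  shows "\<exists>h'. ac_deriv T (\<lambda>t. MAX k\<in>K. f k t) h'"
  using assms
proof (induction K rule: finite_ne_induct)
  case (singleton k)
  then show ?case by simp
next
  case (insert k K)
  from insert.prems[of k] obtain f' where "ac_deriv T (f k) f'" by blast
  moreover from insert obtain h' where "ac_deriv T (\<lambda>t. MAX k\<in>K. f k t) h'" by blast
  ultimately have "ac_deriv T (f k) f'" "ac_deriv T (\<lambda>t. MAX k\<in>K. f k t) h'" .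
  from ac_deriv_max[OF this] show ?case using insert.hyps by simp
qed

text \<open>At an interior point where \<open>h\<close> is differentiable, \<open>h - \<phi>\<close> has a minimum, so the two derivatives agree and
  \<open>h' = 0\<close>. This holds almost everywhere, and an absolutely continuous function with this property is
  constant.\<close>

lemma constant_if_touched_from_below:
  assumes h: "ac_deriv T h h'"
    and touch: "AE t in lebesgue_on {0..T}. \<exists>\<phi>. (\<phi> has_real_derivative 0) (at t within {0..T}) \<and>
        \<phi> t = h t \<and> (\<forall>s\<in>{0..T}. \<phi> s \<le> h s)"
    and t: "t \<in> {0..T}"
  shows "h t = h 0"
proof -
  let ?S = "{0..T}"
  let ?P = "\<lambda>t. (h has_real_derivative h' t) (at t within ?S) \<and> (\<exists>\<phi>. (\<phi> has_real_derivative 0) (at t within ?S) \<and>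
        \<phi> t = h t \<and> (\<forall>s\<in>?S. \<phi> s \<le> h s))"
  have "AE t in lebesgue_on ?S. ?P t"
    using ac_derivD(2)[OF h] touch by eventually_elim simp
  from AE_lebesgue_on_negligible[OF this] obtain N where N: "negligible N" "\<And>t. t \<in> ?S \<Longrightarrow> t \<notin> N \<Longrightarrow> ?P t"
    by simp blast
  have "h' s = 0" if s: "s \<in> ?S - (N \<union> {0, T})" for s
  proof -
    have s01: "0 < s" "s < T" and sN: "s \<in> ?S - N" using s by auto
    have P: "?P s" using N(2)[of s] sN by blast
    then obtain \<phi> where \<phi>: "(\<phi> has_real_derivative 0) (at s within ?S)" "\<phi> s = h s" "\<forall>r\<in>?S. \<phi> r \<le> h r"
      by blast
    have "((\<lambda>r. h r - \<phi> r) has_real_derivative h' s - 0) (at s within ?S)"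
      using P \<phi>(1) by (intro DERIV_diff) auto
    then have "((\<lambda>r. h r - \<phi> r) has_real_derivative h' s) (at s)"
      using s01 by (simp add: at_within_Icc_at)
    then show "h' s = 0"
    proof (rule DERIV_local_min[where d="min s (T - s)"])
      show "\<forall>y. \<bar>s - y\<bar> < min s (T - s) \<longrightarrow> h s - \<phi> s \<le> h y - \<phi> y"
      proof (intro allI impI)
        fix y assume "\<bar>s - y\<bar> < min s (T - s)"
        then have "y \<in> ?S" by auto
        then show "h s - \<phi> s \<le> h y - \<phi> y" using \<phi> by auto
      qed
    qed (use s01 in auto)
  qed
  moreover have "negligible (N \<union> {0, T})" using N(1) by auto
  ultimately have "AE s in lebesgue_on ?S. h' s = 0"
    by (intro AE_lebesgue_onI[of "N \<union> {0, T}"]) auto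
  from ac_deriv_zero_constant[OF ac_deriv_cong_AE[OF h this] t] show ?thesis .
qed

section \<open>Vector-valued trajectories\<close>

lemma scalar_prod_sum:
  "w \<in> carrier_vec n \<Longrightarrow> scalar_prod v w = (\<Sum>i<n. vec_index v i * vec_index w i)"
  by (auto simp: scalar_prod_def lessThan_atLeast0)

lemma mult_mat_vec_sum:
  assumes "M \<in> carrier_mat r c" "x \<in> carrier_vec c" "i < r"
  shows "vec_index (M *\<^sub>v x) i = (\<Sum>j<c. M $$ (i, j) * vec_index x j)"
proof -
  have "vec_index (M *\<^sub>v x) i = scalar_prod (row M i) x" using assms by simp
  also have "\<dots> = (\<Sum>j<c. vec_index (row M i) j * vec_index x j)"
    by (rule scalar_prod_sum[OF assms(2)])
  also have "\<dots> = (\<Sum>j<c. M $$ (i, j) * vec_index x j)"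
    using assms by (intro sum.cong) auto
  finally show ?thesis .
qed

lemma vnorm_eq_L2_set:
  assumes "v \<in> carrier_vec n"
  shows "vnorm v = L2_set (vec_index v) {..<n}"
  using assms by (simp add: vnorm_def L2_set_def scalar_prod_sum[OF assms] power2_eq_square)

lemma vnorm_le_sum_abs: "v \<in> carrier_vec n \<Longrightarrow> vnorm v \<le> (\<Sum>i<n. \<bar>vec_index v i\<bar>)"
  by (simp add: vnorm_eq_L2_set L2_set_le_sum_abs)

lemma abs_index_le_vnorm:
  assumes "v \<in> carrier_vec n" "i < n"
  shows "\<bar>vec_index v i\<bar> \<le> vnorm v"
proof -
  have "\<bar>vec_index v i\<bar> = sqrt ((vec_index v i)\<^sup>2)" by simp
  also have "\<dots> \<le> vnorm v"
    unfolding vnorm_eq_L2_set[OF assms(1)] L2_set_def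
    using assms(2) by (intro real_sqrt_le_mono member_le_sum) auto
  finally show ?thesis .
qed

lemma ac_deriv_cong_on:
  assumes "ac_deriv T f f'" "\<And>t. t \<in> {0..T} \<Longrightarrow> f t = g t" "\<And>t. t \<in> {0..T} \<Longrightarrow> f' t = g' t"
  shows "ac_deriv T g g'"
proof -
  have "AE t in lebesgue_on {0..T}. (f has_real_derivative f' t) (at t within {0..T})"
    by (rule ac_derivD(2)[OF assms(1)])
  then have "AE t in lebesgue_on {0..T}. (g has_real_derivative g' t) (at t within {0..T})"
  proof (rule AE_mp, intro AE_I2 impI)
    fix t assume t: "t \<in> space (lebesgue_on {0..T})"
      and d: "(f has_real_derivative f' t) (at t within {0..T})"
    then have tS: "t \<in> {0..T}" by (simp add: space_restrict_space)
    have "(g has_real_derivative f' t) (at t within {0..T})"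
      by (rule has_field_derivative_transform_within[OF d, where d=1]) (use assms(2) tS in auto)
    then show "(g has_real_derivative g' t) (at t within {0..T})" using assms(3)[OF tS] by simp
  qed
  then show ?thesis
    using abs_cont_cong[OF ac_derivD(1)[OF assms(1)]] assms(2) by (auto simp: ac_deriv_def)
qed

text \<open>Componentwise, so that the scalar theory applies to vectors whose dimension is a natural number and not
  a type.\<close>

definition vec_ac_deriv :: "real \<Rightarrow> nat \<Rightarrow> (real \<Rightarrow> real Matrix.vec) \<Rightarrow> (real \<Rightarrow> real Matrix.vec) \<Rightarrow> bool" where
  "vec_ac_deriv T n f f' \<longleftrightarrow>
     (\<forall>i<n. ac_deriv T (\<lambda>t. vec_index (f t) i) (\<lambda>t. vec_index (f' t) i))"

lemma vec_ac_derivI: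
  assumes "vec_abs_continuous T f" "\<And>t. t \<in> {0..T} \<Longrightarrow> f t \<in> carrier_vec n"
    "AE t in lebesgue_on {0..T}. vec_has_deriv_at T n f (f' t) t"
  shows "vec_ac_deriv T n f f'"
  unfolding vec_ac_deriv_def ac_deriv_def
proof (intro allI impI conjI)
  fix i assume i: "i < n"
  have "small_increments T (\<lambda>x y. vnorm (f y - f x))"
    using assms(1) unfolding vec_abs_continuous_def small_increments_def short_family_def .
  then show "abs_cont T (\<lambda>t. vec_index (f t) i)"
    unfolding abs_cont_def
  proof (rule small_increments_mono)
    fix x y assume xy: "0 \<le> x" "x \<le> y" "y \<le> T"
    then have c: "f x \<in> carrier_vec n" "f y \<in> carrier_vec n" using assms(2) by auto
    then have "vec_index (f y) i - vec_index (f x) i = vec_index (f y - f x) i"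
      using i by simp
    then show "\<bar>vec_index (f y) i - vec_index (f x) i\<bar> \<le> vnorm (f y - f x)"
      using abs_index_le_vnorm[of "f y - f x" n i] c i by simp
  qed
  show "AE t in lebesgue_on {0..T}. ((\<lambda>t. vec_index (f t) i) has_real_derivative vec_index (f' t) i) (at t within {0..T})"
    using assms(3) by (rule AE_mp) (auto simp: vec_has_deriv_at_def i)
qed

lemma vec_ac_deriv_imp_abs_continuous:
  assumes "vec_ac_deriv T n f f'" "\<And>t. t \<in> {0..T} \<Longrightarrow> f t \<in> carrier_vec n"
  shows "vec_abs_continuous T f"
proof -
  have "small_increments T (\<lambda>x y. \<Sum>i<n. \<bar>vec_index (f y) i - vec_index (f x) i\<bar>)"
    using assms(1) unfolding vec_ac_deriv_def ac_deriv_def abs_cont_def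
    by (intro small_increments_sum) auto
  then have "small_increments T (\<lambda>x y. vnorm (f y - f x))"
  proof (rule small_increments_mono)
    fix x y assume xy: "0 \<le> x" "x \<le> y" "y \<le> T"
    then have c: "f x \<in> carrier_vec n" "f y \<in> carrier_vec n" using assms(2) by auto
    then have "vnorm (f y - f x) \<le> (\<Sum>i<n. \<bar>vec_index (f y - f x) i\<bar>)"
      by (intro vnorm_le_sum_abs) auto
    also have "\<dots> = (\<Sum>i<n. \<bar>vec_index (f y) i - vec_index (f x) i\<bar>)"
      using c by (intro sum.cong) auto
    finally show "vnorm (f y - f x) \<le> (\<Sum>i<n. \<bar>vec_index (f y) i - vec_index (f x) i\<bar>)" .
  qed
  then show ?thesis
    unfolding vec_abs_continuous_def small_increments_def short_family_def .
qed

lemma vec_ac_deriv_imp_AE: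
  assumes "vec_ac_deriv T n f f'"
  shows "AE t in lebesgue_on {0..T}. vec_has_deriv_at T n f (f' t) t"
proof -
  have "AE t in lebesgue_on {0..T}. \<forall>i\<in>{..<n}.
      ((\<lambda>s. vec_index (f s) i) has_real_derivative vec_index (f' t) i) (at t within {0..T})"
    by (rule AE_finite_allI) (use assms in \<open>auto simp: vec_ac_deriv_def ac_deriv_def\<close>)
  then show ?thesis by (rule AE_mp) (auto simp: vec_has_deriv_at_def)
qed

lemma vec_ac_deriv_add:
  assumes "vec_ac_deriv T n f f'" "vec_ac_deriv T n g g'"
    and "\<And>t. t \<in> {0..T} \<Longrightarrow> g t \<in> carrier_vec n" "\<And>t. t \<in> {0..T} \<Longrightarrow> g' t \<in> carrier_vec n"
  shows "vec_ac_deriv T n (\<lambda>t. f t + g t) (\<lambda>t. f' t + g' t)"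
  unfolding vec_ac_deriv_def
proof (intro allI impI)
  fix i assume i: "i < n"
  have "ac_deriv T (\<lambda>t. vec_index (f t) i + vec_index (g t) i) (\<lambda>t. vec_index (f' t) i + vec_index (g' t) i)"
    using assms(1,2) i by (intro ac_deriv_add) (auto simp: vec_ac_deriv_def)
  then show "ac_deriv T (\<lambda>t. vec_index (f t + g t) i) (\<lambda>t. vec_index (f' t + g' t) i)"
    by (rule ac_deriv_cong_on) (use assms(3,4)[THEN carrier_vecD] i in auto)
qed

lemma vec_ac_deriv_cong_on:
  assumes "vec_ac_deriv T n f f'" "\<And>t. t \<in> {0..T} \<Longrightarrow> f t = g t" "\<And>t. t \<in> {0..T} \<Longrightarrow> f' t = g' t"
  shows "vec_ac_deriv T n g g'"
  unfolding vec_ac_deriv_def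
proof (intro allI impI)
  fix i assume i: "i < n"
  show "ac_deriv T (\<lambda>t. vec_index (g t) i) (\<lambda>t. vec_index (g' t) i)"
    by (rule ac_deriv_cong_on[of T "\<lambda>t. vec_index (f t) i" "\<lambda>t. vec_index (f' t) i"])
      (use assms i in \<open>auto simp: vec_ac_deriv_def\<close>)
qed

lemma ac_deriv_scalar_prod:
  assumes "vec_ac_deriv T n f f'" "vec_ac_deriv T n g g'"
    and "\<And>t. t \<in> {0..T} \<Longrightarrow> g t \<in> carrier_vec n" "\<And>t. t \<in> {0..T} \<Longrightarrow> g' t \<in> carrier_vec n"
  shows "ac_deriv T (\<lambda>t. scalar_prod (f t) (g t)) (\<lambda>t. scalar_prod (f' t) (g t) + scalar_prod (f t) (g' t))"
proof -
  have "ac_deriv T (\<lambda>t. \<Sum>i<n. vec_index (f t) i * vec_index (g t) i)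
    (\<lambda>t. \<Sum>i<n. vec_index (f' t) i * vec_index (g t) i + vec_index (g' t) i * vec_index (f t) i)"
    using assms(1,2) by (intro ac_deriv_sum ac_deriv_mult) (auto simp: vec_ac_deriv_def)
  then show ?thesis
    by (rule ac_deriv_cong_on)
      (simp_all only: scalar_prod_sum[OF assms(3)] scalar_prod_sum[OF assms(4)] sum.distrib
        mult.commute[of "vec_index (g' _) _"])
qed

lemma vec_ac_deriv_mult_mat_vec:
  assumes M: "M \<in> carrier_mat r n" and f: "vec_ac_deriv T n f f'"
    and c: "\<And>t. t \<in> {0..T} \<Longrightarrow> f t \<in> carrier_vec n" "\<And>t. t \<in> {0..T} \<Longrightarrow> f' t \<in> carrier_vec n"
  shows "vec_ac_deriv T r (\<lambda>t. M *\<^sub>v f t) (\<lambda>t. M *\<^sub>v f' t)"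
  unfolding vec_ac_deriv_def
proof (intro allI impI)
  fix i assume i: "i < r"
  have "ac_deriv T (\<lambda>t. \<Sum>j<n. M $$ (i, j) * vec_index (f t) j) (\<lambda>t. \<Sum>j<n. M $$ (i, j) * vec_index (f' t) j)"
    using f by (intro ac_deriv_sum ac_deriv_cmult) (auto simp: vec_ac_deriv_def)
  then show "ac_deriv T (\<lambda>t. vec_index (M *\<^sub>v f t) i) (\<lambda>t. vec_index (M *\<^sub>v f' t) i)"
    by (rule ac_deriv_cong_on) (simp_all only: mult_mat_vec_sum[OF M c(1) i] mult_mat_vec_sum[OF M c(2) i])
qed

lemma vec_ac_deriv_linear_system:
  assumes A: "A \<in> carrier_mat n n" and g: "\<And>t. g t \<in> carrier_vec n"
    and y: "\<And>i. i < n \<Longrightarrow> ac_deriv T (y i) (\<lambda>t. (\<Sum>j<n. A $$ (i, j) * y j t) + vec_index (g t) i)"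
  shows "vec_ac_deriv T n (\<lambda>t. Matrix.vec n (\<lambda>i. y i t)) (\<lambda>t. A *\<^sub>v Matrix.vec n (\<lambda>i. y i t) + g t)"
  unfolding vec_ac_deriv_def
proof (intro allI impI)
  fix i assume i: "i < n"
  let ?Y = "\<lambda>t. Matrix.vec n (\<lambda>i. y i t)"
  have "vec_index (A *\<^sub>v ?Y t + g t) i = (\<Sum>j<n. A $$ (i, j) * y j t) + vec_index (g t) i" for t
  proof -
    have "vec_index (A *\<^sub>v ?Y t + g t) i = vec_index (A *\<^sub>v ?Y t) i + vec_index (g t) i"
      using g[of t] i by simp
    also have "vec_index (A *\<^sub>v ?Y t) i = (\<Sum>j<n. A $$ (i, j) * y j t)"
      unfolding mult_mat_vec_sum[OF A vec_carrier i] by (intro sum.cong) auto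
    finally show ?thesis .
  qed
  then show "ac_deriv T (\<lambda>t. vec_index (?Y t) i) (\<lambda>t. vec_index (A *\<^sub>v ?Y t + g t) i)"
    using y[OF i] i by simp
qed

lemma vec_linear_ode_terminal:
  assumes A: "A \<in> carrier_mat n n" and g: "\<And>t. g t \<in> carrier_vec n"
    and gi: "\<And>l. l < n \<Longrightarrow> integrable (lebesgue_on {0..T}) (\<lambda>t. vec_index (g t) l)"
    and yT: "yT \<in> carrier_vec n"
  obtains y where "\<And>t. y t \<in> carrier_vec n" "vec_ac_deriv T n y (\<lambda>t. A *\<^sub>v y t + g t)" "y T = yT"
proof -
  obtain y where y: "\<And>i. i < n \<Longrightarrow> ac_deriv T (y i) (\<lambda>t. (\<Sum>j<n. A $$ (i, j) * y j t) + vec_index (g t) i)"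
    "\<And>i. i < n \<Longrightarrow> y i T = vec_index yT i"
    using linear_ode_terminal[of n T "\<lambda>l t. vec_index (g t) l" "\<lambda>i j. A $$ (i, j)" "vec_index yT"] gi by blast
  show thesis
    by (rule that[OF _ vec_ac_deriv_linear_system[OF A g y(1)]]) (use yT y(2) in \<open>auto intro!: eq_vecI\<close>)
qed

lemma vec_linear_ode_forced:
  assumes A: "A \<in> carrier_mat n n"
  obtains C where "C \<ge> 0"
    "\<And>g. (\<And>t. g t \<in> carrier_vec n) \<Longrightarrow>
      (\<And>l. l < n \<Longrightarrow> integrable (lebesgue_on {0..T}) (\<lambda>t. vec_index (g t) l)) \<Longrightarrow>
      \<exists>y. (\<forall>t. y t \<in> carrier_vec n) \<and> vec_ac_deriv T n y (\<lambda>t. A *\<^sub>v y t + g t) \<and> y 0 = 0\<^sub>v n \<and>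
        (\<forall>t\<in>{0..T}. \<forall>i<n. \<bar>vec_index (y t) i\<bar> \<le> C * (\<integral>s. (\<Sum>l<n. \<bar>vec_index (g s) l\<bar>) \<partial>lebesgue_on {0..T}))"
proof -
  obtain C where C: "C \<ge> 0" and sol:
    "\<And>g. (\<And>l. l < n \<Longrightarrow> integrable (lebesgue_on {0..T}) (g l)) \<Longrightarrow>
      \<exists>y. (\<forall>i<n. ac_deriv T (y i) (\<lambda>t. (\<Sum>j<n. A $$ (i, j) * y j t) + g i t) \<and> y i 0 = 0 \<and>
        (\<forall>t\<in>{0..T}. \<bar>y i t\<bar> \<le> C * (\<integral>s. (\<Sum>l<n. \<bar>g l s\<bar>) \<partial>lebesgue_on {0..T})))"
    using linear_ode_forced[of n T "\<lambda>i j. A $$ (i, j)"] by blast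
  show thesis
  proof (rule that[OF C])
    fix g :: "real \<Rightarrow> real Matrix.vec"
    assume g: "\<And>t. g t \<in> carrier_vec n"
      and gi: "\<And>l. l < n \<Longrightarrow> integrable (lebesgue_on {0..T}) (\<lambda>t. vec_index (g t) l)"
    let ?L = "\<integral>s. (\<Sum>l<n. \<bar>vec_index (g s) l\<bar>) \<partial>lebesgue_on {0..T}"
    from sol[of "\<lambda>l t. vec_index (g t) l", OF gi] obtain y where
      y: "\<forall>i<n. ac_deriv T (y i) (\<lambda>t. (\<Sum>j<n. A $$ (i, j) * y j t) + vec_index (g t) i) \<and> y i 0 = 0 \<and>
        (\<forall>t\<in>{0..T}. \<bar>y i t\<bar> \<le> C * ?L)" by blast
    let ?Y = "\<lambda>t. Matrix.vec n (\<lambda>i. y i t)"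
    have "vec_ac_deriv T n ?Y (\<lambda>t. A *\<^sub>v ?Y t + g t)"
      by (rule vec_ac_deriv_linear_system[OF A g]) (use y in blast)
    moreover have "?Y 0 = 0\<^sub>v n" using y by (intro eq_vecI) auto
    moreover have "\<forall>t\<in>{0..T}. \<forall>i<n. \<bar>vec_index (?Y t) i\<bar> \<le> C * ?L" using y by auto
    ultimately show "\<exists>y. (\<forall>t. y t \<in> carrier_vec n) \<and> vec_ac_deriv T n y (\<lambda>t. A *\<^sub>v y t + g t) \<and> y 0 = 0\<^sub>v n \<and>
        (\<forall>t\<in>{0..T}. \<forall>i<n. \<bar>vec_index (y t) i\<bar> \<le> C * ?L)"
      by (intro exI[of _ ?Y]) simp
  qed
qed

text \<open>Integration by parts. In the derivative of \<open>\<langle>p, y\<rangle>\<close> the terms with \<open>A\<close> cancel because \<open>p\<close> solves the adjoint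
  equation.\<close>

lemma adjoint_identity:
  assumes A: "A \<in> carrier_mat n n" and Q: "Q \<in> carrier_mat n n" and T: "0 \<le> T"
    and c: "\<And>t. t \<in> {0..T} \<Longrightarrow> p t \<in> carrier_vec n" "\<And>t. t \<in> {0..T} \<Longrightarrow> x t \<in> carrier_vec n"
      "\<And>t. t \<in> {0..T} \<Longrightarrow> y t \<in> carrier_vec n" "\<And>t. t \<in> {0..T} \<Longrightarrow> g t \<in> carrier_vec n"
    and p: "vec_ac_deriv T n p (\<lambda>t. - (transpose_mat A *\<^sub>v p t) + Q *\<^sub>v x t)"
    and y: "vec_ac_deriv T n y (\<lambda>t. A *\<^sub>v y t + g t)" "y 0 = 0\<^sub>v n"
  shows "integrable (lebesgue_on {0..T}) (\<lambda>t. scalar_prod (Q *\<^sub>v x t) (y t) + scalar_prod (p t) (g t))"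
    and "scalar_prod (p T) (y T) =
      (\<integral>t. scalar_prod (Q *\<^sub>v x t) (y t) + scalar_prod (p t) (g t) \<partial>lebesgue_on {0..T})"
proof -
  have "ac_deriv T (\<lambda>t. scalar_prod (p t) (y t))
     (\<lambda>t. scalar_prod (- (transpose_mat A *\<^sub>v p t) + Q *\<^sub>v x t) (y t) + scalar_prod (p t) (A *\<^sub>v y t + g t))"
    by (rule ac_deriv_scalar_prod[OF p y(1)]) (use A c in auto)
  then have *: "ac_deriv T (\<lambda>t. scalar_prod (p t) (y t))
     (\<lambda>t. scalar_prod (Q *\<^sub>v x t) (y t) + scalar_prod (p t) (g t))"
  proof (rule ac_deriv_cong_on)
    fix t assume t: "t \<in> {0..T}"
    note cc = c(1)[OF t] c(2)[OF t] c(3)[OF t] c(4)[OF t]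
    have "scalar_prod (- (transpose_mat A *\<^sub>v p t) + Q *\<^sub>v x t) (y t)
        = scalar_prod (- (transpose_mat A *\<^sub>v p t)) (y t) + scalar_prod (Q *\<^sub>v x t) (y t)"
      by (rule add_scalar_prod_distrib[of _ n]) (use A Q cc in auto)
    also have "scalar_prod (- (transpose_mat A *\<^sub>v p t)) (y t) = - scalar_prod (transpose_mat A *\<^sub>v p t) (y t)"
      by (rule scalar_prod_uminus_left) (use A cc in auto)
    also have "scalar_prod (transpose_mat A *\<^sub>v p t) (y t) = scalar_prod (p t) (A *\<^sub>v y t)"
      by (rule transpose_vec_mult_scalar[OF A]) (use cc in auto)
    finally have 1: "scalar_prod (- (transpose_mat A *\<^sub>v p t) + Q *\<^sub>v x t) (y t)
        = - scalar_prod (p t) (A *\<^sub>v y t) + scalar_prod (Q *\<^sub>v x t) (y t)" .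
    have 2: "scalar_prod (p t) (A *\<^sub>v y t + g t) = scalar_prod (p t) (A *\<^sub>v y t) + scalar_prod (p t) (g t)"
      by (rule scalar_prod_add_distrib[of _ n]) (use A cc in auto)
    show "scalar_prod (- (transpose_mat A *\<^sub>v p t) + Q *\<^sub>v x t) (y t) + scalar_prod (p t) (A *\<^sub>v y t + g t)
       = scalar_prod (Q *\<^sub>v x t) (y t) + scalar_prod (p t) (g t)"
      unfolding 1 2 by simp
  qed simp
  show "integrable (lebesgue_on {0..T}) (\<lambda>t. scalar_prod (Q *\<^sub>v x t) (y t) + scalar_prod (p t) (g t))"
    by (rule ac_deriv_integral(1)[OF * T])
  have "scalar_prod (p 0) (y 0) = 0" using c(1)[of 0] T y(2) by simp
  then show "scalar_prod (p T) (y T) =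
      (\<integral>t. scalar_prod (Q *\<^sub>v x t) (y t) + scalar_prod (p t) (g t) \<partial>lebesgue_on {0..T})"
    using ac_deriv_integral(2)[OF * T] by simp
qed

section \<open>Block-diagonal matrices and quadratic forms\<close>

lemma blk_offset_less:
  fixes r :: "nat \<Rightarrow> nat"
  assumes "k \<in> {1..N}" "i < r k"
  shows "(\<Sum>l = 1..<k. r l) + i < (\<Sum>l = 1..N. r l)"
proof -
  have "(\<Sum>l = 1..<k. r l) + r k = (\<Sum>l = 1..<Suc k. r l)"
    using assms(1) by simp
  also have "\<dots> \<le> (\<Sum>l = 1..N. r l)"
    using assms(1) by (intro sum_mono2) auto
  finally show ?thesis using assms(2) by linarith
qed

lemma blk_carrier [simp]: "blk r k v \<in> carrier_vec (r k)"
  by (simp add: blk_def)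

lemma blk_index: "i < r k \<Longrightarrow> vec_index (blk r k v) i = vec_index v ((\<Sum>l = 1..<k. r l) + i)"
  by (simp add: blk_def)

lemma blkdiag_Suc:
  "blkdiag (Suc N) M = four_block_mat (blkdiag N M) (0\<^sub>m (dim_row (blkdiag N M)) (dim_col (M (Suc N))))
     (0\<^sub>m (dim_row (M (Suc N))) (dim_col (blkdiag N M))) (M (Suc N))"
proof -
  have "map M [1..<Suc (Suc N)] = map M [1..<Suc N] @ [M (Suc N)]" by simp
  then show ?thesis unfolding blkdiag_def by (simp only: diag_block_mat_last Let_def)
qed

lemma blkdiag_carrier:
  assumes "\<And>k. k \<in> {1..N} \<Longrightarrow> M k \<in> carrier_mat (r k) (c k)"
  shows "blkdiag N M \<in> carrier_mat (\<Sum>k = 1..N. r k) (\<Sum>k = 1..N. c k)"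
  using assms
proof (induction N)
  case 0
  then show ?case by (simp add: blkdiag_def)
next
  case (Suc N)
  have "blkdiag N M \<in> carrier_mat (\<Sum>k = 1..N. r k) (\<Sum>k = 1..N. c k)"
    by (rule Suc.IH) (use Suc.prems in auto)
  moreover have "M (Suc N) \<in> carrier_mat (r (Suc N)) (c (Suc N))" using Suc.prems by simp
  ultimately show ?case unfolding blkdiag_Suc by auto
qed

lemma blk_vec_first:
  fixes r :: "nat \<Rightarrow> nat"
  assumes "k \<in> {1..N}"
  shows "blk r k (vec_first v (\<Sum>l = 1..N. r l)) = blk r k v"
  using blk_offset_less[OF assms, of _ r] by (intro eq_vecI) (auto simp: blk_def vec_first_def)

lemma blk_vec_last:
  fixes r :: "nat \<Rightarrow> nat"
  assumes "v \<in> carrier_vec (\<Sum>l = 1..Suc N. r l)"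
  shows "vec_last v (r (Suc N)) = blk r (Suc N) v"
proof -
  have "dim_vec v - r (Suc N) = (\<Sum>l = 1..<Suc N. r l)"
    using assms by (simp add: atLeastLessThanSuc_atLeastAtMost)
  then show ?thesis by (simp add: blk_def vec_last_def)
qed

text \<open>Block-diagonal matrices enter the proof only through their bilinear forms, so this one identity
  transfers every question to the blocks.\<close>

lemma blkdiag_bilinear:
  assumes "\<And>k. k \<in> {1..N} \<Longrightarrow> M k \<in> carrier_mat (r k) (c k)"
    and "v \<in> carrier_vec (\<Sum>k = 1..N. r k)" "w \<in> carrier_vec (\<Sum>k = 1..N. c k)"
  shows "scalar_prod v (blkdiag N M *\<^sub>v w) = (\<Sum>k = 1..N. scalar_prod (blk r k v) (M k *\<^sub>v blk c k w))"
  using assms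
proof (induction N arbitrary: v w)
  case 0
  then show ?case by (simp add: blkdiag_def scalar_prod_def)
next
  case (Suc N)
  let ?r = "\<Sum>k = 1..N. r k" and ?c = "\<Sum>k = 1..N. c k"
  let ?v1 = "vec_first v ?r" and ?w1 = "vec_first w ?c"
  let ?v2 = "blk r (Suc N) v" and ?w2 = "blk c (Suc N) w"
  have D: "blkdiag N M \<in> carrier_mat ?r ?c"
    by (rule blkdiag_carrier) (use Suc.prems in auto)
  have MN: "M (Suc N) \<in> carrier_mat (r (Suc N)) (c (Suc N))" using Suc.prems by simp
  have v: "v = ?v1 @\<^sub>v ?v2" and w: "w = ?w1 @\<^sub>v ?w2"
    using Suc.prems vec_first_last_append[of v ?r "r (Suc N)"] vec_first_last_append[of w ?c "c (Suc N)"]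
    by (simp_all add: blk_vec_last)
  have "blkdiag (Suc N) M *\<^sub>v w = four_block_mat (blkdiag N M) (0\<^sub>m ?r (c (Suc N)))
     (0\<^sub>m (r (Suc N)) ?c) (M (Suc N)) *\<^sub>v (?w1 @\<^sub>v ?w2)"
    using D MN w unfolding blkdiag_Suc by auto
  also have "\<dots> = (blkdiag N M *\<^sub>v ?w1 + 0\<^sub>m ?r (c (Suc N)) *\<^sub>v ?w2) @\<^sub>v (0\<^sub>m (r (Suc N)) ?c *\<^sub>v ?w1 + M (Suc N) *\<^sub>v ?w2)"
    by (rule four_block_mat_mult_vec[OF D _ _ MN]) auto
  also have "\<dots> = (blkdiag N M *\<^sub>v ?w1) @\<^sub>v (M (Suc N) *\<^sub>v ?w2)"
  proof -
    have "0\<^sub>m ?r (c (Suc N)) *\<^sub>v ?w2 = 0\<^sub>v ?r" "0\<^sub>m (r (Suc N)) ?c *\<^sub>v ?w1 = 0\<^sub>v (r (Suc N))"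
      by (auto intro!: eq_vecI scalar_prod_left_zero)
    then show ?thesis
      using right_zero_vec[OF mult_mat_vec_carrier[OF D, of ?w1]] left_zero_vec[OF mult_mat_vec_carrier[OF MN, of ?w2]]
      by (simp only: vec_first_carrier blk_carrier simp_thms)
  qed
  finally have mult: "blkdiag (Suc N) M *\<^sub>v w = (blkdiag N M *\<^sub>v ?w1) @\<^sub>v (M (Suc N) *\<^sub>v ?w2)" .
  have "scalar_prod v (blkdiag (Suc N) M *\<^sub>v w)
     = scalar_prod (?v1 @\<^sub>v ?v2) ((blkdiag N M *\<^sub>v ?w1) @\<^sub>v (M (Suc N) *\<^sub>v ?w2))"
    unfolding mult using v by simp
  also have "\<dots> = scalar_prod ?v1 (blkdiag N M *\<^sub>v ?w1) + scalar_prod ?v2 (M (Suc N) *\<^sub>v ?w2)"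
    by (rule scalar_prod_append) (use mult_mat_vec_carrier[OF D, of ?w1] mult_mat_vec_carrier[OF MN, of ?w2] in auto)
  also have "scalar_prod ?v1 (blkdiag N M *\<^sub>v ?w1) = (\<Sum>k = 1..N. scalar_prod (blk r k ?v1) (M k *\<^sub>v blk c k ?w1))"
    by (rule Suc.IH) (use Suc.prems in auto)
  also have "\<dots> = (\<Sum>k = 1..N. scalar_prod (blk r k v) (M k *\<^sub>v blk c k w))"
    by (rule sum.cong[OF refl]) (simp only: blk_vec_first)
  finally show ?case by simp
qed

lemma symmetric_bilinear:
  assumes "M \<in> carrier_mat n n" "transpose_mat M = M" "v \<in> carrier_vec n" "w \<in> carrier_vec n"
  shows "scalar_prod v (M *\<^sub>v w) = scalar_prod (M *\<^sub>v v) (w :: real Matrix.vec)"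
  using transpose_vec_mult_scalar[OF assms(1,4,3)] assms(2) by simp

lemma blkdiag_symmetric:
  assumes M: "\<And>k. k \<in> {1..N} \<Longrightarrow> M k \<in> carrier_mat (r k) (r k) \<and> transpose_mat (M k) = M k"
    and v: "v \<in> carrier_vec (\<Sum>k = 1..N. r k)" and w: "w \<in> carrier_vec (\<Sum>k = 1..N. r k)"
  shows "scalar_prod v (blkdiag N M *\<^sub>v w) = scalar_prod (blkdiag N M *\<^sub>v v) w"
proof -
  have c: "k \<in> {1..N} \<Longrightarrow> M k \<in> carrier_mat (r k) (r k)" for k using M by blast
  have D: "blkdiag N M \<in> carrier_mat (\<Sum>k = 1..N. r k) (\<Sum>k = 1..N. r k)" by (rule blkdiag_carrier[OF c])
  have "scalar_prod v (blkdiag N M *\<^sub>v w) = (\<Sum>k = 1..N. scalar_prod (blk r k v) (M k *\<^sub>v blk r k w))"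
    by (rule blkdiag_bilinear[OF c v w])
  also have "\<dots> = (\<Sum>k = 1..N. scalar_prod (blk r k w) (M k *\<^sub>v blk r k v))"
  proof (rule sum.cong[OF refl])
    fix k assume k: "k \<in> {1..N}"
    have "scalar_prod (blk r k v) (M k *\<^sub>v blk r k w) = scalar_prod (M k *\<^sub>v blk r k v) (blk r k w)"
      by (rule symmetric_bilinear) (use M[OF k] in auto)
    also have "\<dots> = scalar_prod (blk r k w) (M k *\<^sub>v blk r k v)"
      by (rule comm_scalar_prod[of _ "r k"]) (use M[OF k] in auto)
    finally show "scalar_prod (blk r k v) (M k *\<^sub>v blk r k w) = scalar_prod (blk r k w) (M k *\<^sub>v blk r k v)" .
  qed
  also have "\<dots> = scalar_prod w (blkdiag N M *\<^sub>v v)"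
    by (rule blkdiag_bilinear[OF c w v, symmetric])
  also have "\<dots> = scalar_prod (blkdiag N M *\<^sub>v v) w"
    by (rule comm_scalar_prod[OF w]) (use D v in auto)
  finally show ?thesis .
qed

text \<open>A positive definite matrix has trivial kernel, hence nonzero determinant, and therefore
  \<open>mat_inverse\<close> returns a value.\<close>

lemma sym_pos_def_inverse:
  assumes "sym_pos_def n R"
  shows "mat_inv R \<in> carrier_mat n n" "R * mat_inv R = 1\<^sub>m n"
proof -
  have R: "R \<in> carrier_mat n n" using assms by (simp add: sym_pos_def_def)
  have "Determinant.det R \<noteq> 0"
  proof
    assume "Determinant.det R = 0"
    then obtain v where v: "v \<in> carrier_vec n" "v \<noteq> 0\<^sub>v n" "R *\<^sub>v v = 0\<^sub>v n"
      using det_0_iff_vec_prod_zero[OF R] by blast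
    then have "scalar_prod v (R *\<^sub>v v) = 0" by simp
    moreover have "0 < scalar_prod v (R *\<^sub>v v)" using assms v unfolding sym_pos_def_def by blast
    ultimately show False by simp
  qed
  then have unit: "R \<in> Units (ring_mat TYPE(real) n ())" by (rule det_non_zero_imp_unit[OF R])
  then have "mat_inverse R \<noteq> None" using mat_inverse(1)[OF R, of "()"] by blast
  then have "mat_inverse R = Some (mat_inv R)" by (simp add: mat_inv_def)
  from mat_inverse(2)[OF R this] show "mat_inv R \<in> carrier_mat n n" "R * mat_inv R = 1\<^sub>m n" by auto
qed

lemma sym_pos_def_form_nonneg:
  assumes "sym_pos_def n R" "v \<in> carrier_vec n"
  shows "0 \<le> scalar_prod v (R *\<^sub>v v)"
  using assms unfolding sym_pos_def_def by (cases "v = 0\<^sub>v n") (auto intro: less_imp_le)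

lemma sym_pos_def_form_zero:
  assumes "sym_pos_def n R" "v \<in> carrier_vec n" "scalar_prod v (R *\<^sub>v v) = 0"
  shows "v = 0\<^sub>v n"
  using assms unfolding sym_pos_def_def by force

text \<open>The unconstrained maximization of \<open>\<langle>p, B u\<rangle> - 1/2 \<langle>u, R u\<rangle>\<close> in one block. The maximizer \<open>opt\<close> solves
  \<open>R u = B\<^sup>T p\<close>, and \<open>1/2 \<langle>p, G p\<rangle>\<close> is the maximum.\<close>

locale single_block =
  fixes d m :: nat and B R :: "real mat" and p :: "real Matrix.vec"
  assumes B: "B \<in> carrier_mat d m" and R: "sym_pos_def m R" and p: "p \<in> carrier_vec d"
begin

definition opt :: "real Matrix.vec" where "opt = mat_inv R *\<^sub>v (transpose_mat B *\<^sub>v p)"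

definition G :: "real mat" where "G = B * mat_inv R * transpose_mat B"

lemma Rc: "R \<in> carrier_mat m m" and Rt: "transpose_mat R = R"
  using R by (auto simp: sym_pos_def_def)

lemma opt_carrier: "opt \<in> carrier_vec m"
  unfolding opt_def using sym_pos_def_inverse[OF R] B p by auto

lemma R_opt: "R *\<^sub>v opt = transpose_mat B *\<^sub>v p"
proof -
  have "R *\<^sub>v opt = (R * mat_inv R) *\<^sub>v (transpose_mat B *\<^sub>v p)"
    unfolding opt_def using sym_pos_def_inverse[OF R] B p Rc by (subst assoc_mult_mat_vec[of _ m m _ m]) auto
  then show ?thesis using sym_pos_def_inverse[OF R] B p by auto
qed

lemma p_B: "u \<in> carrier_vec m \<Longrightarrow> scalar_prod p (B *\<^sub>v u) = scalar_prod (R *\<^sub>v opt) u"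
  unfolding R_opt using transpose_vec_mult_scalar[OF B _ p] by simp

lemma G_form: "scalar_prod p (G *\<^sub>v p) = scalar_prod (R *\<^sub>v opt) opt"
proof -
  have "G *\<^sub>v p = B *\<^sub>v opt"
    unfolding G_def opt_def using sym_pos_def_inverse[OF R] B p
    by (subst assoc_mult_mat_vec[of _ d m _ d], auto)+
  then show ?thesis using p_B[OF opt_carrier] by simp
qed

lemma mnorm_G: "(mnorm G p)\<^sup>2 = scalar_prod p (G *\<^sub>v p)" "(mnorm G p)\<^sup>2 = scalar_prod opt (R *\<^sub>v opt)"
proof -
  have e: "scalar_prod p (G *\<^sub>v p) = scalar_prod opt (R *\<^sub>v opt)"
    unfolding G_form by (rule comm_scalar_prod[of _ m]) (use opt_carrier Rc in auto)
  then have "0 \<le> scalar_prod p (G *\<^sub>v p)" using sym_pos_def_form_nonneg[OF R opt_carrier] by simp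
  then show "(mnorm G p)\<^sup>2 = scalar_prod p (G *\<^sub>v p)" by (simp add: mnorm_def)
  then show "(mnorm G p)\<^sup>2 = scalar_prod opt (R *\<^sub>v opt)" using e by simp
qed

lemma complete_square:
  assumes u: "u \<in> carrier_vec m"
  shows "scalar_prod p (B *\<^sub>v u) - 1/2 * scalar_prod u (R *\<^sub>v u)
    = 1/2 * (mnorm G p)\<^sup>2 - 1/2 * scalar_prod (u - opt) (R *\<^sub>v (u - opt))"
proof -
  have c: "u \<in> carrier_vec m" "opt \<in> carrier_vec m" "R *\<^sub>v u \<in> carrier_vec m" "R *\<^sub>v opt \<in> carrier_vec m"
    using u opt_carrier Rc by auto
  have "scalar_prod (u - opt) (R *\<^sub>v (u - opt)) = scalar_prod (u - opt) (R *\<^sub>v u - R *\<^sub>v opt)"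
    using mult_minus_distrib_mat_vec[OF Rc c(1,2)] by simp
  also have "\<dots> = scalar_prod u (R *\<^sub>v u - R *\<^sub>v opt) - scalar_prod opt (R *\<^sub>v u - R *\<^sub>v opt)"
    by (rule minus_scalar_prod_distrib[of _ m]) (use c in auto)
  also have "scalar_prod u (R *\<^sub>v u - R *\<^sub>v opt) = scalar_prod u (R *\<^sub>v u) - scalar_prod u (R *\<^sub>v opt)"
    by (rule scalar_prod_minus_distrib[of _ m]) (use c in auto)
  also have "scalar_prod opt (R *\<^sub>v u - R *\<^sub>v opt) = scalar_prod opt (R *\<^sub>v u) - scalar_prod opt (R *\<^sub>v opt)"
    by (rule scalar_prod_minus_distrib[of _ m]) (use c in auto)
  also have "scalar_prod opt (R *\<^sub>v u) = scalar_prod (R *\<^sub>v opt) u"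
    by (rule symmetric_bilinear[OF Rc Rt c(2,1)])
  also have "scalar_prod u (R *\<^sub>v opt) = scalar_prod (R *\<^sub>v opt) u"
    by (rule comm_scalar_prod[OF c(1,4)])
  finally show ?thesis unfolding p_B[OF u] mnorm_G(2) by linarith
qed

end

section \<open>Pointwise maximization of the Hamiltonian\<close>

text \<open>The inclusion of the \<open>k\<close>-th factor into the product of the blocks.\<close>

definition embed :: "nat \<Rightarrow> (nat \<Rightarrow> nat) \<Rightarrow> nat \<Rightarrow> real Matrix.vec \<Rightarrow> real Matrix.vec" where
  "embed N m k w = Matrix.vec (\<Sum>l = 1..N. m l) (\<lambda>i. if (\<Sum>l = 1..<k. m l) \<le> i \<and> i < (\<Sum>l = 1..<k. m l) + m k
     then vec_index w (i - (\<Sum>l = 1..<k. m l)) else 0)"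

text \<open>Blocks occupy disjoint ranges of indices: the \<open>l\<close>-th one lies entirely before or after the \<open>k\<close>-th one
  if \<open>l \<noteq> k\<close>.\<close>

lemma blk_embed:
  assumes "k \<in> {1..N}" "l \<in> {1..N}" "w \<in> carrier_vec (m k)"
  shows "blk m l (embed N m k w) = (if l = k then w else 0\<^sub>v (m l))"
proof (rule eq_vecI)
  fix i assume "i < dim_vec (if l = k then w else 0\<^sub>v (m l))"
  then have i: "i < m l" using assms(3) by (auto split: if_splits)
  have idx: "vec_index (blk m l (embed N m k w)) i = (if (\<Sum>j = 1..<k. m j) \<le> (\<Sum>j = 1..<l. m j) + i \<and>
      (\<Sum>j = 1..<l. m j) + i < (\<Sum>j = 1..<k. m j) + m k
     then vec_index w ((\<Sum>j = 1..<l. m j) + i - (\<Sum>j = 1..<k. m j)) else 0)"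
    unfolding blk_index[of i m l, OF i] embed_def using blk_offset_less[of l N i m, OF assms(2) i] by simp
  have mono: "(\<Sum>j = 1..<a. m j) + m a \<le> (\<Sum>j = 1..<b. m j)" if "a < b" "1 \<le> a" for a b
  proof -
    have "(\<Sum>j = 1..<a. m j) + m a = (\<Sum>j = 1..<Suc a. m j)" using that by simp
    also have "\<dots> \<le> (\<Sum>j = 1..<b. m j)" using that by (intro sum_mono2) auto
    finally show ?thesis .
  qed
  consider "l = k" | "l < k" | "k < l" by linarith
  then show "vec_index (blk m l (embed N m k w)) i = vec_index (if l = k then w else 0\<^sub>v (m l)) i"
  proof cases
    case 1
    then show ?thesis unfolding idx using i by simp
  next
    case 2
    then show ?thesis unfolding idx using i mono[of l k] assms by simp
  next
    case 3
    then show ?thesis unfolding idx using i mono[of k l] assms by simp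
  qed
qed (use assms(3) in \<open>auto simp: blk_def\<close>)

lemma embed_U_LQ:
  assumes "k \<in> {1..N}" "w \<in> carrier_vec (m k)"
  shows "embed N m k w \<in> U_LQ N m"
  unfolding U_LQ_def using assms by (auto simp: blk_embed intro!: bexI[of _ k]) (simp add: embed_def)

lemma zero_U_LQ:
  assumes "N \<ge> 1"
  shows "0\<^sub>v (\<Sum>l = 1..N. m l) \<in> U_LQ N m"
  unfolding U_LQ_def using assms blk_offset_less[of _ N _ m]
  by (auto intro!: bexI[of _ 1] eq_vecI simp: blk_def)

text \<open>Separated from the trajectory because the maximization over the control set takes place at a fixed time.\<close>

locale lq_data =
  fixes N :: nat and d m :: "nat \<Rightarrow> nat" and Bk Rk :: "nat \<Rightarrow> real mat" and lam :: "nat \<Rightarrow> real"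
  assumes N: "N \<ge> 1"
    and Bk: "\<And>k. k \<in> {1..N} \<Longrightarrow> Bk k \<in> carrier_mat (d k) (m k)"
    and Rk: "\<And>k. k \<in> {1..N} \<Longrightarrow> sym_pos_def (m k) (Rk k)"
    and lam: "\<And>k. k \<in> {1..N} \<Longrightarrow> lam k > 0"
begin

abbreviation "nx \<equiv> (\<Sum>k = 1..N. d k)"
abbreviation "nu \<equiv> (\<Sum>k = 1..N. m k)"
abbreviation "B \<equiv> blkdiag N Bk"
abbreviation "R \<equiv> blkdiag N Rk"

definition feedback :: "nat \<Rightarrow> real Matrix.vec \<Rightarrow> real Matrix.vec" where
  "feedback k p = mat_inv (Rk k) *\<^sub>v (transpose_mat (Bk k) *\<^sub>v blk d k p)"

definition G :: "nat \<Rightarrow> real mat" where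
  "G k = Bk k * mat_inv (Rk k) * transpose_mat (Bk k)"

definition gain :: "nat \<Rightarrow> real Matrix.vec \<Rightarrow> real" where
  "gain k p = (mnorm (G k) (blk d k p))\<^sup>2"

text \<open>The part of the Hamiltonian that depends on the control.\<close>

definition ctrl_ham :: "real Matrix.vec \<Rightarrow> real Matrix.vec \<Rightarrow> real" where
  "ctrl_ham p u = scalar_prod p (B *\<^sub>v u) - 1/2 * scalar_prod u (R *\<^sub>v u) + sparsity N m lam u"

abbreviation "lamt \<equiv> (\<Sum>k = 1..N. lam k)"
abbreviation "lam' k \<equiv> (\<Sum>l \<in> {1..N} - {k}. lam l)"

text \<open>The maximum of \<open>ctrl_ham p\<close> over \<open>U_LQ\<close>. A block whose gain is below \<open>2 \<lambda>\<^sub>k\<close> contributes a value below that of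
  the zero control, so the formula may range over all blocks.\<close>

definition max_ham :: "real Matrix.vec \<Rightarrow> real" where
  "max_ham p = (MAX k\<in>{1..N}. max lamt (lam' k + 1/2 * gain k p))"

lemma B_carrier: "B \<in> carrier_mat nx nu" by (rule blkdiag_carrier[OF Bk])

lemma Rk_carrier: "k \<in> {1..N} \<Longrightarrow> Rk k \<in> carrier_mat (m k) (m k)"
  using Rk by (simp add: sym_pos_def_def)

lemma R_carrier: "R \<in> carrier_mat nu nu" by (rule blkdiag_carrier[OF Rk_carrier])

lemma B_form:
  "v \<in> carrier_vec nx \<Longrightarrow> u \<in> carrier_vec nu \<Longrightarrow>
    scalar_prod v (B *\<^sub>v u) = (\<Sum>k = 1..N. scalar_prod (blk d k v) (Bk k *\<^sub>v blk m k u))"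
  by (rule blkdiag_bilinear[OF Bk])

lemma R_form:
  "v \<in> carrier_vec nu \<Longrightarrow> u \<in> carrier_vec nu \<Longrightarrow>
    scalar_prod v (R *\<^sub>v u) = (\<Sum>k = 1..N. scalar_prod (blk m k v) (Rk k *\<^sub>v blk m k u))"
  by (rule blkdiag_bilinear[OF Rk_carrier])

lemma R_form_nonneg:
  assumes "u \<in> carrier_vec nu"
  shows "0 \<le> scalar_prod u (R *\<^sub>v u)"
  unfolding R_form[OF assms assms]
  by (intro sum_nonneg sym_pos_def_form_nonneg[OF Rk]) auto

lemma single_block: "k \<in> {1..N} \<Longrightarrow> single_block (d k) (m k) (Bk k) (Rk k) (blk d k p)"
  by (simp add: single_block_def Bk Rk)

lemma feedback_eq: "k \<in> {1..N} \<Longrightarrow> single_block.opt (Bk k) (Rk k) (blk d k p) = feedback k p"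
  unfolding feedback_def by (rule single_block.opt_def[OF single_block])

lemma G_eq: "k \<in> {1..N} \<Longrightarrow> single_block.G (Bk k) (Rk k) = G k"
  unfolding G_def by (rule single_block.G_def[OF single_block])

lemma feedback_carrier: "k \<in> {1..N} \<Longrightarrow> feedback k p \<in> carrier_vec (m k)"
  using single_block.opt_carrier[OF single_block] feedback_eq by metis

lemma gain_eq:
  assumes "k \<in> {1..N}"
  shows "gain k p = scalar_prod (blk d k p) (G k *\<^sub>v blk d k p)"
    "gain k p = scalar_prod (feedback k p) (Rk k *\<^sub>v feedback k p)"
  using single_block.mnorm_G[OF single_block[OF assms], of p]
  unfolding feedback_eq[OF assms] G_eq[OF assms] gain_def by auto

lemma G_carrier: "k \<in> {1..N} \<Longrightarrow> G k \<in> carrier_mat (d k) (d k)"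
  unfolding G_def using Bk[of k] sym_pos_def_inverse(1)[OF Rk[of k]] by auto

lemma block_complete_square:
  assumes "k \<in> {1..N}" "u \<in> carrier_vec (m k)"
  shows "scalar_prod (blk d k p) (Bk k *\<^sub>v u) - 1/2 * scalar_prod u (Rk k *\<^sub>v u)
    = 1/2 * gain k p - 1/2 * scalar_prod (u - feedback k p) (Rk k *\<^sub>v (u - feedback k p))"
  using single_block.complete_square[OF single_block[OF assms(1)] assms(2), of p]
  unfolding feedback_eq[OF assms(1)] G_eq[OF assms(1)] gain_def .

lemma ctrl_ham_blocks:
  assumes "p \<in> carrier_vec nx" "u \<in> carrier_vec nu"
  shows "ctrl_ham p u = (\<Sum>k = 1..N. scalar_prod (blk d k p) (Bk k *\<^sub>v blk m k u)
     - 1/2 * scalar_prod (blk m k u) (Rk k *\<^sub>v blk m k u) + lam k * (if blk m k u = 0\<^sub>v (m k) then 1 else 0))"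
  unfolding ctrl_ham_def sparsity_def B_form[OF assms] R_form[OF assms(2) assms(2)]
  by (simp add: sum.distrib sum_subtractf sum_distrib_left)

text \<open>A control with only one possibly nonzero block \<open>j\<close> collects \<open>\<lambda>\<^sub>l\<close> from every other block. In block \<open>j\<close> it
  trades the reward \<open>\<lambda>\<^sub>j\<close> for inactivity against the quadratic gain.\<close>

lemma ctrl_ham_active_block:
  assumes p: "p \<in> carrier_vec nx" and u: "u \<in> carrier_vec nu" and j: "j \<in> {1..N}"
    and zero: "\<And>l. l \<in> {1..N} - {j} \<Longrightarrow> blk m l u = 0\<^sub>v (m l)"
  shows "ctrl_ham p u = lam' j + (if blk m j u = 0\<^sub>v (m j) then lam j else
     1/2 * gain j p - 1/2 * scalar_prod (blk m j u - feedback j p) (Rk j *\<^sub>v (blk m j u - feedback j p)))"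
proof -
  let ?h = "\<lambda>k. scalar_prod (blk d k p) (Bk k *\<^sub>v blk m k u)
     - 1/2 * scalar_prod (blk m k u) (Rk k *\<^sub>v blk m k u) + lam k * (if blk m k u = 0\<^sub>v (m k) then 1 else 0)"
  have z: "?h k = lam k" if "k \<in> {1..N}" "blk m k u = 0\<^sub>v (m k)" for k
    unfolding that(2) using Bk[OF that(1)] Rk_carrier[OF that(1)]
    by (simp add: scalar_prod_sum[of _ "d k"] mult_mat_vec_sum[of _ "d k" "m k"])
  have "ctrl_ham p u = (\<Sum>k = 1..N. ?h k)" by (rule ctrl_ham_blocks[OF p u])
  also have "\<dots> = ?h j + (\<Sum>k \<in> {1..N} - {j}. ?h k)" using j by (intro sum.remove) auto
  also have "(\<Sum>k \<in> {1..N} - {j}. ?h k) = lam' j"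
    by (rule sum.cong[OF refl]) (use z zero in blast)
  also have "?h j = (if blk m j u = 0\<^sub>v (m j) then lam j else
     1/2 * gain j p - 1/2 * scalar_prod (blk m j u - feedback j p) (Rk j *\<^sub>v (blk m j u - feedback j p)))"
  proof (cases "blk m j u = 0\<^sub>v (m j)")
    case True
    with z[OF j] show ?thesis by simp
  next
    case False
    with block_complete_square[OF j, of "blk m j u" p] show ?thesis by simp
  qed
  finally show ?thesis by simp
qed

lemma lamt_eq: "j \<in> {1..N} \<Longrightarrow> lamt = lam' j + lam j"
  using sum.remove[of "{1..N}" j lam] by simp

lemma U_LQ_E:
  assumes "u \<in> U_LQ N m"
  obtains j where "j \<in> {1..N}" "u \<in> carrier_vec nu" "\<And>l. l \<in> {1..N} - {j} \<Longrightarrow> blk m l u = 0\<^sub>v (m l)"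
  using assms unfolding U_LQ_def by blast

lemma U_LQ_carrier: "u \<in> U_LQ N m \<Longrightarrow> u \<in> carrier_vec nu"
  by (auto simp: U_LQ_def)

lemma lamt_le_max_ham: "lamt \<le> max_ham p"
  unfolding max_ham_def using N by (subst Max_ge_iff) (auto intro!: bexI[of _ 1])

lemma gain_le_max_ham:
  assumes "j \<in> {1..N}" shows "lam' j + 1/2 * gain j p \<le> max_ham p"
  unfolding max_ham_def using assms by (subst Max_ge_iff) (auto intro!: bexI[of _ j])

lemma max_ham_le:
  assumes "lamt \<le> c" "\<And>j. j \<in> {1..N} \<Longrightarrow> lam' j + 1/2 * gain j p \<le> c"
  shows "max_ham p \<le> c"
  unfolding max_ham_def using N assms by (subst Max_le_iff) auto

lemma ctrl_ham_le_max_ham: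
  assumes p: "p \<in> carrier_vec nx" and u: "u \<in> U_LQ N m"
  shows "ctrl_ham p u \<le> max_ham p"
proof -
  obtain j where j: "j \<in> {1..N}" "u \<in> carrier_vec nu" "\<And>l. l \<in> {1..N} - {j} \<Longrightarrow> blk m l u = 0\<^sub>v (m l)"
    using U_LQ_E[OF u] by blast
  have "0 \<le> scalar_prod (blk m j u - feedback j p) (Rk j *\<^sub>v (blk m j u - feedback j p))"
    by (rule sym_pos_def_form_nonneg[OF Rk[OF j(1)]]) (use feedback_carrier[OF j(1)] in auto)
  moreover have "ctrl_ham p u = lam' j + (if blk m j u = 0\<^sub>v (m j) then lam j else
     1/2 * gain j p - 1/2 * scalar_prod (blk m j u - feedback j p) (Rk j *\<^sub>v (blk m j u - feedback j p)))"
    by (rule ctrl_ham_active_block[OF p j(2,1,3)])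
  ultimately show ?thesis
    using lamt_le_max_ham[of p] gain_le_max_ham[OF j(1), of p] lamt_eq[OF j(1)] by auto
qed

lemma ctrl_ham_zero:
  assumes p: "p \<in> carrier_vec nx"
  shows "ctrl_ham p (0\<^sub>v nu) = lamt"
proof -
  have z: "blk m l (0\<^sub>v nu) = 0\<^sub>v (m l)" if "l \<in> {1..N}" for l
    using blk_offset_less[OF that, of _ m] by (intro eq_vecI) (auto simp: blk_def)
  have 1: "(1::nat) \<in> {1..N}" using N by simp
  show ?thesis
    using ctrl_ham_active_block[OF p _ 1, of "0\<^sub>v nu"] z lamt_eq[OF 1] 1 by simp
qed

text \<open>This is only an inequality because the feedback may vanish. Then the gain is 0, while the value
  contains the additional reward \<open>\<lambda>\<^sub>k\<close>.\<close>

lemma ctrl_ham_feedback: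
  assumes p: "p \<in> carrier_vec nx" and k: "k \<in> {1..N}"
  shows "lam' k + 1/2 * gain k p \<le> ctrl_ham p (embed N m k (feedback k p))"
proof -
  let ?u = "embed N m k (feedback k p)"
  note w = feedback_carrier[OF k, of p]
  have u: "?u \<in> carrier_vec nu" by (simp add: embed_def)
  have z: "blk m l ?u = 0\<^sub>v (m l)" if "l \<in> {1..N} - {k}" for l
    using blk_embed[of k N l "feedback k p" m] k w that by simp
  have b: "blk m k ?u = feedback k p" using blk_embed[of k N k "feedback k p" m] k w by simp
  have Rw: "Rk k *\<^sub>v 0\<^sub>v (m k) = 0\<^sub>v (m k)"
    using Rk_carrier[OF k] by (intro eq_vecI) (auto simp: scalar_prod_def)
  have "feedback k p - feedback k p = 0\<^sub>v (m k)" using w by auto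
  moreover have "ctrl_ham p ?u = lam' k + (if blk m k ?u = 0\<^sub>v (m k) then lam k else
     1/2 * gain k p - 1/2 * scalar_prod (blk m k ?u - feedback k p) (Rk k *\<^sub>v (blk m k ?u - feedback k p)))"
    by (rule ctrl_ham_active_block[OF p u k z])
  ultimately show ?thesis
    unfolding b
    using gain_eq(2)[OF k, of p] lam[OF k] Rw by auto
qed

text \<open>The \<open>N + 1\<close> comparisons bound \<open>\<Sum>\<^sub>k \<lambda>\<^sub>k\<close> and all \<open>\<lambda>'\<^sub>k + 1/2 \<parallel>p\<^sup>k\<parallel>\<^sup>2\<close> by the value at \<open>u\<close>. If the block \<open>s\<close> of \<open>u\<close>
  is nonzero, completing the square leaves a nonpositive remainder, which must vanish, so this block is
  the feedback; if it is zero, the value at \<open>u\<close> is \<open>\<Sum>\<^sub>k \<lambda>\<^sub>k\<close>. In both cases the conditions on the threshold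
  \<open>2 \<lambda>\<^sub>s\<close> and on the argument of the maximum are comparisons of these numbers.\<close>

lemma maximizing_control:
  assumes p: "p \<in> carrier_vec nx" and u: "u \<in> U_LQ N m"
    and max0: "ctrl_ham p (0\<^sub>v nu) \<le> ctrl_ham p u"
    and maxk: "\<And>k. k \<in> {1..N} \<Longrightarrow> ctrl_ham p (embed N m k (feedback k p)) \<le> ctrl_ham p u"
    and s: "s \<in> {1..N}" "\<And>l. l \<in> {1..N} - {s} \<Longrightarrow> blk m l u = 0\<^sub>v (m l)"
  shows "ctrl_ham p u = max_ham p"
    and "blk m s u \<in>
            (if (mnorm (G s) (blk d s p))\<^sup>2 > 2 * lam s
             then {feedback s p}
             else if (mnorm (G s) (blk d s p))\<^sup>2 = 2 * lam s
             then {0\<^sub>v (m s)} \<union> {feedback s p}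
             else {0\<^sub>v (m s)})"
    and "is_arg_max
          (\<lambda>k. if (mnorm (G k) (blk d k p))\<^sup>2 \<ge> 2 * lam k
               then lam' k + 1/2 * (mnorm (G k) (blk d k p))\<^sup>2
               else lamt)
          (\<lambda>k. k \<in> {1..N}) s"
proof -
  have uc: "u \<in> carrier_vec nu" using u by (rule U_LQ_carrier)
  have lamt_le: "lamt \<le> ctrl_ham p u" using max0 ctrl_ham_zero[OF p] by simp
  have gain_le: "lam' k + 1/2 * gain k p \<le> ctrl_ham p u" if "k \<in> {1..N}" for k
    using ctrl_ham_feedback[OF p that] maxk[OF that] by simp
  show eq: "ctrl_ham p u = max_ham p"
    using ctrl_ham_le_max_ham[OF p u] max_ham_le[OF lamt_le gain_le] by simp
  have H: "ctrl_ham p u = lam' s + (if blk m s u = 0\<^sub>v (m s) then lam s else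
     1/2 * gain s p - 1/2 * scalar_prod (blk m s u - feedback s p) (Rk s *\<^sub>v (blk m s u - feedback s p)))"
    by (rule ctrl_ham_active_block[OF p uc s])
  let ?e = "blk m s u - feedback s p"
  have ec: "?e \<in> carrier_vec (m s)" using feedback_carrier[OF s(1)] by simp
  have e0: "0 \<le> scalar_prod ?e (Rk s *\<^sub>v ?e)" by (rule sym_pos_def_form_nonneg[OF Rk[OF s(1)] ec])
  have cases: "(blk m s u = 0\<^sub>v (m s) \<and> ctrl_ham p u = lamt) \<or>
     (blk m s u = feedback s p \<and> ctrl_ham p u = lam' s + 1/2 * gain s p)"
  proof (cases "blk m s u = 0\<^sub>v (m s)")
    case True
    then show ?thesis using H lamt_eq[OF s(1)] by simp
  next
    case False
    then have "ctrl_ham p u = lam' s + (1/2 * gain s p - 1/2 * scalar_prod ?e (Rk s *\<^sub>v ?e))" using H by simp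
    with gain_le[OF s(1)] e0 have z: "scalar_prod ?e (Rk s *\<^sub>v ?e) = 0" and H': "ctrl_ham p u = lam' s + 1/2 * gain s p" by auto
    have "?e = 0\<^sub>v (m s)" by (rule sym_pos_def_form_zero[OF Rk[OF s(1)] ec z])
    then have "blk m s u = feedback s p"
      using feedback_carrier[OF s(1), of p] by (intro eq_vecI) (auto simp: vec_eq_iff blk_def)
    with H' show ?thesis by simp
  qed
  from cases show "blk m s u \<in>
            (if (mnorm (G s) (blk d s p))\<^sup>2 > 2 * lam s
             then {feedback s p}
             else if (mnorm (G s) (blk d s p))\<^sup>2 = 2 * lam s
             then {0\<^sub>v (m s)} \<union> {feedback s p}
             else {0\<^sub>v (m s)})"
    using lamt_le gain_le[OF s(1)] lamt_eq[OF s(1)] unfolding gain_def by auto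
  let ?f = "\<lambda>k. if (mnorm (G k) (blk d k p))\<^sup>2 \<ge> 2 * lam k
               then lam' k + 1/2 * (mnorm (G k) (blk d k p))\<^sup>2 else lamt"
  have f_le: "?f k \<le> ctrl_ham p u" if "k \<in> {1..N}" for k
    using lamt_le gain_le[OF that] unfolding gain_def by auto
  have "?f s = ctrl_ham p u"
    using cases lamt_le gain_le[OF s(1)] lamt_eq[OF s(1)] unfolding gain_def by auto
  then show "is_arg_max ?f (\<lambda>k. k \<in> {1..N}) s"
    unfolding is_arg_max_linorder using s(1) f_le by simp
qed

end

section \<open>Costs and perturbed trajectories\<close>

lemma ext_integral_eq_integral:
  assumes f: "integrable (lebesgue_on {0..T}) f"
  shows "ext_integral T f = ereal (\<integral>t. f t \<partial>lebesgue_on {0..T})"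
proof -
  let ?M = "lebesgue_on {0..T}"
  have fin: "(\<integral>\<^sup>+ t. ennreal (f t) \<partial>?M) \<noteq> \<infinity>" "(\<integral>\<^sup>+ t. ennreal (- f t) \<partial>?M) \<noteq> \<infinity>"
    using f by (auto simp: real_integrable_def)
  have e: "enn2ereal a = ereal (enn2real a)" if "a \<noteq> \<infinity>" for a
    using that by (cases a rule: ennreal_cases) auto
  show ?thesis
    unfolding ext_integral_def e[OF fin(1)] e[OF fin(2)] real_lebesgue_integral_def[OF f] by simp
qed

text \<open>A cost that is bounded below has a finite negative part, so finiteness of the difference is finiteness
  of the positive part.\<close>

lemma integrable_if_ext_integral_finite:
  assumes meas: "f \<in> borel_measurable (lebesgue_on {0..T})"
    and lb: "\<And>t. t \<in> {0..T} \<Longrightarrow> - K \<le> f t"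
    and fin: "ext_integral T f < \<infinity>"
  shows "integrable (lebesgue_on {0..T}) f"
proof -
  let ?M = "lebesgue_on {0..T}"
  have "(\<integral>\<^sup>+ t. ennreal (- f t) \<partial>?M) \<le> (\<integral>\<^sup>+ t. ennreal K \<partial>?M)"
    using lb by (intro nn_integral_mono ennreal_leI) (force simp: space_restrict_space)
  also have "\<dots> < \<infinity>"
    using emeasure_lborel_Icc_eq[of 0 T] by (simp add: emeasure_restrict_space ennreal_mult_less_top)
  finally have neg: "(\<integral>\<^sup>+ t. ennreal (- f t) \<partial>?M) \<noteq> \<infinity>" by simp
  have "(\<integral>\<^sup>+ t. ennreal (f t) \<partial>?M) \<noteq> \<infinity>"
  proof
    assume "(\<integral>\<^sup>+ t. ennreal (f t) \<partial>?M) = \<infinity>"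
    then have "ext_integral T f = \<infinity>"
      using neg unfolding ext_integral_def
      by (cases "(\<integral>\<^sup>+ t. ennreal (- f t) \<partial>?M)" rule: ennreal_cases) auto
    with fin show False by simp
  qed
  with meas neg show ?thesis by (simp add: real_integrable_def)
qed

lemma quadratic_form_bound:
  fixes M :: "real mat"
  assumes M: "M \<in> carrier_mat n n"
  obtains K where "K \<ge> 0" "\<And>v c. v \<in> carrier_vec n \<Longrightarrow> (\<And>i. i < n \<Longrightarrow> \<bar>vec_index v i\<bar> \<le> c) \<Longrightarrow>
     \<bar>scalar_prod v (M *\<^sub>v v)\<bar> \<le> K * c\<^sup>2"
proof (rule that[of "\<Sum>i<n. \<Sum>j<n. \<bar>M $$ (i, j)\<bar>"])
  show "0 \<le> (\<Sum>i<n. \<Sum>j<n. \<bar>M $$ (i, j)\<bar>)" by (intro sum_nonneg) auto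
  fix v :: "real Matrix.vec" and c :: real assume v: "v \<in> carrier_vec n" and c: "\<And>i. i < n \<Longrightarrow> \<bar>vec_index v i\<bar> \<le> c"
  have "scalar_prod v (M *\<^sub>v v) = (\<Sum>i<n. vec_index v i * vec_index (M *\<^sub>v v) i)"
    by (rule scalar_prod_sum[OF mult_mat_vec_carrier[OF M v]])
  also have "\<dots> = (\<Sum>i<n. \<Sum>j<n. vec_index v i * (M $$ (i, j) * vec_index v j))"
    by (intro sum.cong refl) (simp only: lessThan_iff mult_mat_vec_sum[OF M v] sum_distrib_left)
  finally have "\<bar>scalar_prod v (M *\<^sub>v v)\<bar> \<le> (\<Sum>i<n. \<bar>\<Sum>j<n. vec_index v i * (M $$ (i, j) * vec_index v j)\<bar>)"
    by simp
  also have "\<dots> \<le> (\<Sum>i<n. \<Sum>j<n. \<bar>vec_index v i * (M $$ (i, j) * vec_index v j)\<bar>)"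
    by (intro sum_mono sum_abs)
  also have "\<dots> \<le> (\<Sum>i<n. \<Sum>j<n. \<bar>M $$ (i, j)\<bar> * c\<^sup>2)"
  proof (intro sum_mono)
    fix i j assume ij: "i \<in> {..<n}" "j \<in> {..<n}"
    then have "\<bar>vec_index v i\<bar> * \<bar>vec_index v j\<bar> \<le> c * c"
      using c[of i] c[of j] by (intro mult_mono) auto
    then have "\<bar>M $$ (i, j)\<bar> * (\<bar>vec_index v i\<bar> * \<bar>vec_index v j\<bar>) \<le> \<bar>M $$ (i, j)\<bar> * (c * c)"
      by (intro mult_left_mono) auto
    then show "\<bar>vec_index v i * (M $$ (i, j) * vec_index v j)\<bar> \<le> \<bar>M $$ (i, j)\<bar> * c\<^sup>2"
      by (simp add: abs_mult power2_eq_square mult_ac)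
  qed
  finally show "\<bar>scalar_prod v (M *\<^sub>v v)\<bar> \<le> (\<Sum>i<n. \<Sum>j<n. \<bar>M $$ (i, j)\<bar>) * c\<^sup>2"
    by (simp add: sum_distrib_right)
qed

context lq_data
begin

text \<open>The running cost of the control. The running cost of the state is continuous in time, hence
  always integrable.\<close>

definition ctrl_cost :: "real Matrix.vec \<Rightarrow> real" where
  "ctrl_cost u = 1/2 * scalar_prod u (R *\<^sub>v u) - sparsity N m lam u"

lemma sparsity_bounds: "0 \<le> sparsity N m lam u" "sparsity N m lam u \<le> lamt"
  unfolding sparsity_def using lam
  by (auto intro!: sum_nonneg sum_mono mult_nonneg_nonneg less_imp_le[OF lam] simp: less_imp_le[OF lam])

lemma blk_eq_zero_iff: "blk m k u = 0\<^sub>v (m k) \<longleftrightarrow> (\<forall>i<m k. vec_index u ((\<Sum>l = 1..<k. m l) + i) = 0)"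
  by (auto simp: vec_eq_iff blk_def)

lemma inactive_set_measurable:
  assumes u: "vec_measurable T nu u" and k: "k \<in> {1..N}"
  shows "{t \<in> space (lebesgue_on {0..T}). blk m k (u t) = 0\<^sub>v (m k)} \<in> sets (lebesgue_on {0..T})"
proof -
  have "{t \<in> space (lebesgue_on {0..T}). \<forall>i\<in>{..<m k}. vec_index (u t) ((\<Sum>l = 1..<k. m l) + i) = 0} \<in> sets (lebesgue_on {0..T})"
  proof (rule sets.sets_Collect_finite_All)
    fix i assume i: "i \<in> {..<m k}"
    then have [measurable]: "(\<lambda>t. vec_index (u t) ((\<Sum>l = 1..<k. m l) + i)) \<in> borel_measurable (lebesgue_on {0..T})"
      using u blk_offset_less[OF k, of i m] unfolding vec_measurable_def by auto
    show "{t \<in> space (lebesgue_on {0..T}). vec_index (u t) ((\<Sum>l = 1..<k. m l) + i) = 0} \<in> sets (lebesgue_on {0..T})"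
      by measurable
  qed auto
  then show ?thesis unfolding blk_eq_zero_iff by (simp only: Ball_def lessThan_iff)
qed

lemma ctrl_cost_measurable:
  assumes u: "vec_measurable T nu u" and c: "\<And>t. t \<in> {0..T} \<Longrightarrow> u t \<in> carrier_vec nu"
  shows "(\<lambda>t. ctrl_cost (u t)) \<in> borel_measurable (lebesgue_on {0..T})"
proof -
  let ?M = "lebesgue_on {0..T}"
  have ui: "(\<lambda>t. vec_index (u t) i) \<in> borel_measurable ?M" if "i < nu" for i
    using u that by (simp add: vec_measurable_def)
  have "(\<lambda>t. \<Sum>i<nu. vec_index (u t) i * (\<Sum>j<nu. R $$ (i, j) * vec_index (u t) j)) \<in> borel_measurable ?M"
    by (intro borel_measurable_sum borel_measurable_times borel_measurable_const ui) auto
  moreover have "(\<lambda>t. \<Sum>k = 1..N. lam k * (if blk m k (u t) = 0\<^sub>v (m k) then 1 else 0)) \<in> borel_measurable ?M"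
    by (intro borel_measurable_sum borel_measurable_times borel_measurable_const measurable_If
        inactive_set_measurable[OF u]) auto
  ultimately have "(\<lambda>t. 1/2 * (\<Sum>i<nu. vec_index (u t) i * (\<Sum>j<nu. R $$ (i, j) * vec_index (u t) j))
     - (\<Sum>k = 1..N. lam k * (if blk m k (u t) = 0\<^sub>v (m k) then 1 else 0))) \<in> borel_measurable ?M"
    by (intro borel_measurable_diff borel_measurable_times borel_measurable_const)
  moreover have "ctrl_cost (u t) = 1/2 * (\<Sum>i<nu. vec_index (u t) i * (\<Sum>j<nu. R $$ (i, j) * vec_index (u t) j))
     - (\<Sum>k = 1..N. lam k * (if blk m k (u t) = 0\<^sub>v (m k) then 1 else 0))" if "t \<in> space ?M" for t
  proof -
    have uc: "u t \<in> carrier_vec nu" using c that by (simp add: space_restrict_space)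
    have "scalar_prod (u t) (R *\<^sub>v u t) = (\<Sum>i<nu. vec_index (u t) i * vec_index (R *\<^sub>v u t) i)"
      by (rule scalar_prod_sum) (use R_carrier uc in auto)
    also have "\<dots> = (\<Sum>i<nu. vec_index (u t) i * (\<Sum>j<nu. R $$ (i, j) * vec_index (u t) j))"
      by (rule sum.cong[OF refl]) (use mult_mat_vec_sum[OF R_carrier uc] in simp)
    finally show ?thesis unfolding ctrl_cost_def sparsity_def by simp
  qed
  ultimately show ?thesis by (subst measurable_cong) auto
qed

lemma ctrl_cost_integrable_bounded:
  assumes u: "vec_measurable T nu u" and c: "\<And>t. t \<in> {0..T} \<Longrightarrow> u t \<in> carrier_vec nu"
    and bd: "\<And>t i. t \<in> {0..T} \<Longrightarrow> i < nu \<Longrightarrow> \<bar>vec_index (u t) i\<bar> \<le> b"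
  shows "integrable (lebesgue_on {0..T}) (\<lambda>t. ctrl_cost (u t))"
proof -
  obtain K where K: "K \<ge> 0" "\<And>v c. v \<in> carrier_vec nu \<Longrightarrow> (\<And>i. i < nu \<Longrightarrow> \<bar>vec_index v i\<bar> \<le> c) \<Longrightarrow>
     \<bar>scalar_prod v (R *\<^sub>v v)\<bar> \<le> K * c\<^sup>2"
    using quadratic_form_bound[OF R_carrier] by blast
  show ?thesis
  proof (rule finite_measure.integrable_const_bound[where B = "K * b\<^sup>2 + lamt"])
    show "finite_measure (lebesgue_on {0..T})" by (rule finite_measure_lebesgue_on) simp
    show "(\<lambda>t. ctrl_cost (u t)) \<in> borel_measurable (lebesgue_on {0..T})" by (rule ctrl_cost_measurable[OF u c])
    show "AE t in lebesgue_on {0..T}. norm (ctrl_cost (u t)) \<le> K * b\<^sup>2 + lamt"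
    proof (rule AE_I2)
      fix t assume "t \<in> space (lebesgue_on {0..T})"
      then have t: "t \<in> {0..T}" by (simp add: space_restrict_space)
      have "\<bar>scalar_prod (u t) (R *\<^sub>v u t)\<bar> \<le> K * b\<^sup>2" by (rule K(2)[OF c[OF t] bd[OF t]])
      then show "norm (ctrl_cost (u t)) \<le> K * b\<^sup>2 + lamt"
        using sparsity_bounds[of "u t"] unfolding ctrl_cost_def real_norm_def by linarith
    qed
  qed
qed

lemma ctrl_ham_eq: "ctrl_ham p u = scalar_prod p (B *\<^sub>v u) - ctrl_cost u"
  by (simp add: ctrl_ham_def ctrl_cost_def)

lemma quad_cost_split: "quad_cost Q R x u - sparsity N m lam u = 1/2 * scalar_prod x (Q *\<^sub>v x) + ctrl_cost u"
  by (simp add: quad_cost_def ctrl_cost_def algebra_simps)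

end

lemma vec_ac_deriv_integrable:
  assumes f: "vec_ac_deriv T n f f'" and i: "i < n"
  shows "integrable (lebesgue_on {0..T}) (\<lambda>t. vec_index (f t) i)"
  using f i abs_cont_continuous
  by (intro continuous_imp_integrable_real) (auto simp: vec_ac_deriv_def ac_deriv_def)

locale lq_optimal = lq_data +
  fixes T :: real and A Q Qh :: "real mat" and xbar :: "real Matrix.vec" and xs us :: "real \<Rightarrow> real Matrix.vec"
  assumes T: "T > 0"
    and A: "A \<in> carrier_mat nx nx" and Q: "Q \<in> carrier_mat nx nx" and Qh: "Qh \<in> carrier_mat nx nx"
    and Q_sym: "\<And>v w. v \<in> carrier_vec nx \<Longrightarrow> w \<in> carrier_vec nx \<Longrightarrow> scalar_prod v (Q *\<^sub>v w) = scalar_prod (Q *\<^sub>v v) w"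
    and Qh_sym: "\<And>v w. v \<in> carrier_vec nx \<Longrightarrow> w \<in> carrier_vec nx \<Longrightarrow> scalar_prod v (Qh *\<^sub>v w) = scalar_prod (Qh *\<^sub>v v) w"
    and minimizer: "local_minimizer T (lq_admissible T N d m A B xbar) (lq_cost T N m lam Q R Qh) xs us"
begin

abbreviation "M \<equiv> lebesgue_on {0..T}"
abbreviation "cost \<equiv> lq_cost T N m lam Q R Qh"
abbreviation "admissible_pair \<equiv> lq_admissible T N d m A B xbar"

lemma admissible: "admissible_pair xs us"
  using minimizer by (simp add: local_minimizer_def)

lemma xs_carrier: "t \<in> {0..T} \<Longrightarrow> xs t \<in> carrier_vec nx"
  and xs_init: "xs 0 = xbar"
  and us_U: "t \<in> {0..T} \<Longrightarrow> us t \<in> U_LQ N m"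
  and us_measurable: "vec_measurable T nu us"
  using admissible by (auto simp: lq_admissible_def)

lemma us_carrier: "t \<in> {0..T} \<Longrightarrow> us t \<in> carrier_vec nu"
  using us_U U_LQ_carrier by blast

lemma xs_deriv: "vec_ac_deriv T nx xs (\<lambda>t. A *\<^sub>v xs t + B *\<^sub>v us t)"
  using admissible xs_carrier by (intro vec_ac_derivI) (auto simp: lq_admissible_def)

lemma mult_B_carrier: "B *\<^sub>v u \<in> carrier_vec nx"
  by (rule carrier_vecI) (simp only: dim_mult_mat_vec carrier_matD(1)[OF B_carrier])

lemma mult_mat_vec_integrable:
  assumes f: "vec_ac_deriv T nx f f'" and c: "\<And>t. t \<in> {0..T} \<Longrightarrow> f t \<in> carrier_vec nx"
    and L: "L \<in> carrier_mat nx nx" and i: "i < nx"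
  shows "integrable M (\<lambda>t. vec_index (L *\<^sub>v f t) i)"
proof -
  have "integrable M (\<lambda>t. \<Sum>j<nx. L $$ (i, j) * vec_index (f t) j)"
    using vec_ac_deriv_integrable[OF f] by (intro Bochner_Integration.integrable_sum integrable_mult_right) auto
  moreover have "vec_index (L *\<^sub>v f t) i = (\<Sum>j<nx. L $$ (i, j) * vec_index (f t) j)" if "t \<in> space M" for t
    by (rule mult_mat_vec_sum[OF L c i]) (use that in \<open>simp add: space_restrict_space\<close>)
  ultimately show ?thesis by (subst Bochner_Integration.integrable_cong) auto
qed

lemma Bus_integrable:
  assumes i: "i < nx"
  shows "integrable M (\<lambda>t. vec_index (B *\<^sub>v us t) i)"
proof -
  have "integrable M (\<lambda>t. vec_index (A *\<^sub>v xs t + B *\<^sub>v us t) i)"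
    using xs_deriv i T by (intro ac_deriv_integral(1)) (auto simp: vec_ac_deriv_def)
  then have "integrable M (\<lambda>t. vec_index (A *\<^sub>v xs t + B *\<^sub>v us t) i - vec_index (A *\<^sub>v xs t) i)"
    by (intro Bochner_Integration.integrable_diff mult_mat_vec_integrable[OF xs_deriv xs_carrier A i])
  moreover have "vec_index (A *\<^sub>v xs t + B *\<^sub>v us t) i - vec_index (A *\<^sub>v xs t) i = vec_index (B *\<^sub>v us t) i" for t
    using i B_carrier by simp
  ultimately show ?thesis by simp
qed

text \<open>The \<open>L\<^sup>1\<close> distance to the optimal control, seen through \<open>B\<close>, which is how a control acts on the state.\<close>

definition ctrl_dist :: "(real \<Rightarrow> real Matrix.vec) \<Rightarrow> real" where
  "ctrl_dist u = (\<integral>t. (\<Sum>l<nx. \<bar>vec_index (B *\<^sub>v u t - B *\<^sub>v us t) l\<bar>) \<partial>M)"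

definition admissible_control :: "(real \<Rightarrow> real Matrix.vec) \<Rightarrow> bool" where
  "admissible_control u \<longleftrightarrow> (\<forall>t\<in>{0..T}. u t \<in> U_LQ N m) \<and> vec_measurable T nu u \<and>
     (\<forall>i<nx. integrable M (\<lambda>t. vec_index (B *\<^sub>v u t) i))"

lemma ctrl_diff_integrable:
  assumes "admissible_control u" "i < nx"
  shows "integrable M (\<lambda>t. vec_index (B *\<^sub>v u t - B *\<^sub>v us t) i)"
proof -
  have "integrable M (\<lambda>t. vec_index (B *\<^sub>v u t) i - vec_index (B *\<^sub>v us t) i)"
    using assms Bus_integrable by (intro Bochner_Integration.integrable_diff) (auto simp: admissible_control_def)
  moreover have "vec_index (B *\<^sub>v u t) i - vec_index (B *\<^sub>v us t) i = vec_index (B *\<^sub>v u t - B *\<^sub>v us t) i" for t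
    using assms(2) B_carrier by simp
  ultimately show ?thesis by simp
qed

text \<open>The difference \<open>y\<close> of the trajectory under \<open>u\<close> and the optimal trajectory.\<close>

definition perturbation :: "(real \<Rightarrow> real Matrix.vec) \<Rightarrow> (real \<Rightarrow> real Matrix.vec) \<Rightarrow> bool" where
  "perturbation u y \<longleftrightarrow> (\<forall>t. y t \<in> carrier_vec nx) \<and>
     vec_ac_deriv T nx y (\<lambda>t. A *\<^sub>v y t + (B *\<^sub>v u t - B *\<^sub>v us t)) \<and> y 0 = 0\<^sub>v nx \<and>
     admissible_pair (\<lambda>t. xs t + y t) u"

lemma perturbed_trajectory:
  obtains C where "C \<ge> 0"
    "\<And>u. admissible_control u \<Longrightarrow> \<exists>y. perturbation u y \<and>
        (\<forall>t\<in>{0..T}. \<forall>i<nx. \<bar>vec_index (y t) i\<bar> \<le> C * ctrl_dist u) \<and> (\<forall>t\<in>{0..T}. vnorm (y t) \<le> C * ctrl_dist u)"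
proof -
  obtain C where C: "C \<ge> 0"
    "\<And>g. (\<And>t. g t \<in> carrier_vec nx) \<Longrightarrow>
      (\<And>l. l < nx \<Longrightarrow> integrable (lebesgue_on {0..T}) (\<lambda>t. vec_index (g t) l)) \<Longrightarrow>
      \<exists>y. (\<forall>t. y t \<in> carrier_vec nx) \<and> vec_ac_deriv T nx y (\<lambda>t. A *\<^sub>v y t + g t) \<and> y 0 = 0\<^sub>v nx \<and>
        (\<forall>t\<in>{0..T}. \<forall>i<nx. \<bar>vec_index (y t) i\<bar> \<le> C * (\<integral>s. (\<Sum>l<nx. \<bar>vec_index (g s) l\<bar>) \<partial>lebesgue_on {0..T}))"
    using vec_linear_ode_forced[OF A, of T] by blast
  \<comment> \<open>one factor for two bounds: \<open>1 \<le> K\<close> is used for the components, \<open>nx \<le> K\<close> for the norm\<close>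
  define K where "K = real (Suc nx)"
  have K: "1 \<le> K" "real nx \<le> K" unfolding K_def by (simp_all only: of_nat_Suc)
  show thesis
  proof (rule that[of "K * C"])
    show "0 \<le> K * C" using C(1) K(1) by simp
    fix u assume u: "admissible_control u"
    let ?g = "\<lambda>t. B *\<^sub>v u t - B *\<^sub>v us t"
    have gc: "?g t \<in> carrier_vec nx" for t using mult_B_carrier by simp
    from C(2)[of ?g, OF gc ctrl_diff_integrable[OF u]] obtain y where
      y: "\<And>t. y t \<in> carrier_vec nx" "vec_ac_deriv T nx y (\<lambda>t. A *\<^sub>v y t + ?g t)" "y 0 = 0\<^sub>v nx"
        "\<And>t i. t \<in> {0..T} \<Longrightarrow> i < nx \<Longrightarrow> \<bar>vec_index (y t) i\<bar> \<le> C * ctrl_dist u"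
      unfolding ctrl_dist_def by blast
    have d0: "0 \<le> ctrl_dist u" unfolding ctrl_dist_def by (intro Bochner_Integration.integral_nonneg sum_nonneg) auto
    have le: "C * ctrl_dist u \<le> K * C * ctrl_dist u"
      using mult_right_mono[OF K(1) C(1)] d0 by (intro mult_right_mono) auto
    have comp: "\<bar>vec_index (y t) i\<bar> \<le> K * C * ctrl_dist u" if "t \<in> {0..T}" "i < nx" for t i
      using y(4)[OF that] le by linarith
    have norm: "vnorm (y t) \<le> K * C * ctrl_dist u" if t: "t \<in> {0..T}" for t
    proof -
      have "vnorm (y t) \<le> (\<Sum>i<nx. \<bar>vec_index (y t) i\<bar>)" by (rule vnorm_le_sum_abs[OF y(1)])
      also have "\<dots> \<le> (\<Sum>i<nx. C * ctrl_dist u)" by (rule sum_mono) (use y(4)[OF t] in auto)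
      also have "\<dots> = real nx * C * ctrl_dist u" by (simp only: sum_constant card_lessThan mult.assoc)
      also have "\<dots> \<le> K * C * ctrl_dist u"
        by (rule mult_right_mono[OF mult_right_mono[OF K(2) C(1)] d0])
      finally show ?thesis .
    qed
    have "vec_ac_deriv T nx (\<lambda>t. xs t + y t) (\<lambda>t. (A *\<^sub>v xs t + B *\<^sub>v us t) + (A *\<^sub>v y t + ?g t))"
      by (rule vec_ac_deriv_add[OF xs_deriv y(2)]) (intro y(1) add_carrier_vec mult_mat_vec_carrier[OF A] gc)+
    then have xy: "vec_ac_deriv T nx (\<lambda>t. xs t + y t) (\<lambda>t. A *\<^sub>v (xs t + y t) + B *\<^sub>v u t)"
    proof (rule vec_ac_deriv_cong_on)
      fix t assume t: "t \<in> {0..T}"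
      have "A *\<^sub>v (xs t + y t) = A *\<^sub>v xs t + A *\<^sub>v y t"
        by (rule mult_add_distrib_mat_vec[OF A xs_carrier[OF t] y(1)])
      then show "(A *\<^sub>v xs t + B *\<^sub>v us t) + (A *\<^sub>v y t + ?g t) = A *\<^sub>v (xs t + y t) + B *\<^sub>v u t"
        using A B_carrier by (intro eq_vecI) auto
    qed simp
    have xyc: "xs t + y t \<in> carrier_vec nx" if "t \<in> {0..T}" for t using xs_carrier[OF that] y(1) by simp
    have "xs 0 + y 0 = xbar" using xs_carrier[of 0] T xs_init y(3) by simp
    then have "admissible_pair (\<lambda>t. xs t + y t) u"
      unfolding lq_admissible_def
      using u xyc vec_ac_deriv_imp_abs_continuous[OF xy xyc] vec_ac_deriv_imp_AE[OF xy]
      by (simp add: admissible_control_def)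
    with y have "perturbation u y" by (simp add: perturbation_def)
    with comp norm show "\<exists>y. perturbation u y \<and>
        (\<forall>t\<in>{0..T}. \<forall>i<nx. \<bar>vec_index (y t) i\<bar> \<le> K * C * ctrl_dist u) \<and> (\<forall>t\<in>{0..T}. vnorm (y t) \<le> K * C * ctrl_dist u)"
      by (intro exI[of _ y]) simp
  qed
qed

end

section \<open>Finiteness of the minimal cost\<close>

lemma vec_ac_deriv_continuous:
  "vec_ac_deriv T n f f' \<Longrightarrow> i < n \<Longrightarrow> continuous_on {0..T} (\<lambda>t. vec_index (f t) i)"
  using abs_cont_continuous by (auto simp: vec_ac_deriv_def ac_deriv_def)

lemma continuous_scalar_prod:
  assumes "\<And>i. i < n \<Longrightarrow> continuous_on S (\<lambda>t. vec_index (f t) i)"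
    "\<And>i. i < n \<Longrightarrow> continuous_on S (\<lambda>t. vec_index (g t) i)"
    "\<And>t. t \<in> S \<Longrightarrow> g t \<in> carrier_vec n"
  shows "continuous_on S (\<lambda>t. scalar_prod (f t) (g t :: real Matrix.vec))"
proof -
  have "continuous_on S (\<lambda>t. \<Sum>i<n. vec_index (f t) i * vec_index (g t) i)"
    using assms(1,2) by (intro continuous_on_sum continuous_on_mult) auto
  then show ?thesis
    by (rule continuous_on_eq) (simp add: scalar_prod_sum[OF assms(3)])
qed

lemma continuous_mult_mat_vec:
  fixes L :: "real mat"
  assumes L: "L \<in> carrier_mat r n" and f: "\<And>i. i < n \<Longrightarrow> continuous_on S (\<lambda>t. vec_index (f t) i)"
    "\<And>t. t \<in> S \<Longrightarrow> f t \<in> carrier_vec n" and i: "i < r"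
  shows "continuous_on S (\<lambda>t. vec_index (L *\<^sub>v f t) i)"
proof -
  have "continuous_on S (\<lambda>t. \<Sum>j<n. L $$ (i, j) * vec_index (f t) j)"
    using f(1) by (intro continuous_on_sum continuous_on_mult) auto
  then show ?thesis
    by (rule continuous_on_eq) (simp only: mult_mat_vec_sum[OF L f(2) i])
qed

lemma continuous_add_vec:
  fixes f g :: "real \<Rightarrow> real Matrix.vec"
  assumes "continuous_on S (\<lambda>t. vec_index (f t) i)" "continuous_on S (\<lambda>t. vec_index (g t) i)"
    "\<And>t. g t \<in> carrier_vec n" "i < n"
  shows "continuous_on S (\<lambda>t. vec_index (f t + g t) i)"
proof -
  have "vec_index (f t) i + vec_index (g t) i = vec_index (f t + g t) i" for t
    using assms(3)[of t] assms(4) by simp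
  then show ?thesis using continuous_on_add[OF assms(1,2)] by simp
qed

lemma quadratic_expansion:
  fixes Q :: "real mat"
  assumes Q: "Q \<in> carrier_mat n n" and x: "x \<in> carrier_vec n" and y: "y \<in> carrier_vec n"
    and sym: "\<And>v w. v \<in> carrier_vec n \<Longrightarrow> w \<in> carrier_vec n \<Longrightarrow> scalar_prod v (Q *\<^sub>v w) = scalar_prod (Q *\<^sub>v v) w"
  shows "1/2 * scalar_prod (x + y) (Q *\<^sub>v (x + y)) =
    1/2 * scalar_prod x (Q *\<^sub>v x) + scalar_prod (Q *\<^sub>v x) y + 1/2 * scalar_prod y (Q *\<^sub>v y)"
proof -
  note c = x y mult_mat_vec_carrier[OF Q x] mult_mat_vec_carrier[OF Q y]
  have "scalar_prod (x + y) (Q *\<^sub>v (x + y)) = scalar_prod (x + y) (Q *\<^sub>v x + Q *\<^sub>v y)"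
    using mult_add_distrib_mat_vec[OF Q x y] by simp
  also have "\<dots> = scalar_prod x (Q *\<^sub>v x + Q *\<^sub>v y) + scalar_prod y (Q *\<^sub>v x + Q *\<^sub>v y)"
    by (rule add_scalar_prod_distrib[of _ n]) (use c in auto)
  also have "scalar_prod x (Q *\<^sub>v x + Q *\<^sub>v y) = scalar_prod x (Q *\<^sub>v x) + scalar_prod x (Q *\<^sub>v y)"
    by (rule scalar_prod_add_distrib[of _ n]) (use c in auto)
  also have "scalar_prod y (Q *\<^sub>v x + Q *\<^sub>v y) = scalar_prod y (Q *\<^sub>v x) + scalar_prod y (Q *\<^sub>v y)"
    by (rule scalar_prod_add_distrib[of _ n]) (use c in auto)
  also have "scalar_prod x (Q *\<^sub>v y) = scalar_prod (Q *\<^sub>v x) y" by (rule sym[OF x y])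
  also have "scalar_prod y (Q *\<^sub>v x) = scalar_prod (Q *\<^sub>v x) y" by (rule comm_scalar_prod[OF y c(3)])
  finally show ?thesis by simp
qed

context lq_optimal
begin

lemma cost_eq:
  assumes xc: "\<And>t. t \<in> {0..T} \<Longrightarrow> x t \<in> carrier_vec nx"
    and x: "\<And>i. i < nx \<Longrightarrow> continuous_on {0..T} (\<lambda>t. vec_index (x t) i)"
    and u: "integrable M (\<lambda>t. ctrl_cost (u t))"
  shows "integrable M (\<lambda>t. 1/2 * scalar_prod (x t) (Q *\<^sub>v x t))"
    and "cost x u =
      ereal ((\<integral>t. 1/2 * scalar_prod (x t) (Q *\<^sub>v x t) \<partial>M) + (\<integral>t. ctrl_cost (u t) \<partial>M) + 1/2 * scalar_prod (x T) (Qh *\<^sub>v x T))"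
proof -
  have "continuous_on {0..T} (\<lambda>t. 1/2 * scalar_prod (x t) (Q *\<^sub>v x t))"
    by (intro continuous_on_mult continuous_on_const continuous_scalar_prod[of nx] continuous_mult_mat_vec[OF Q]
        x xc mult_mat_vec_carrier[OF Q])
  then show xi: "integrable M (\<lambda>t. 1/2 * scalar_prod (x t) (Q *\<^sub>v x t))"
    by (rule continuous_imp_integrable_real)
  have "ext_integral T (\<lambda>t. quad_cost Q R (x t) (u t) - sparsity N m lam (u t))
     = ereal (\<integral>t. 1/2 * scalar_prod (x t) (Q *\<^sub>v x t) + ctrl_cost (u t) \<partial>M)"
    unfolding quad_cost_split by (rule ext_integral_eq_integral) (rule Bochner_Integration.integrable_add[OF xi u])
  also have "(\<integral>t. 1/2 * scalar_prod (x t) (Q *\<^sub>v x t) + ctrl_cost (u t) \<partial>M)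
    = (\<integral>t. 1/2 * scalar_prod (x t) (Q *\<^sub>v x t) \<partial>M) + (\<integral>t. ctrl_cost (u t) \<partial>M)"
    by (rule Bochner_Integration.integral_add[OF xi u])
  finally show "cost x u =
      ereal ((\<integral>t. 1/2 * scalar_prod (x t) (Q *\<^sub>v x t) \<partial>M) + (\<integral>t. ctrl_cost (u t) \<partial>M) + 1/2 * scalar_prod (x T) (Qh *\<^sub>v x T))"
    unfolding lq_cost_def by simp
qed

text \<open>The running cost is bounded below, because the form of \<open>R\<close> is nonnegative, the rewards are bounded and
  the state cost is continuous in time.\<close>

lemma us_cost_integrable_if_finite:
  assumes fin: "cost xs us < \<infinity>"
  shows "integrable M (\<lambda>t. ctrl_cost (us t))"
proof -
  let ?q = "\<lambda>t. 1/2 * scalar_prod (xs t) (Q *\<^sub>v xs t)"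
  have cont: "continuous_on {0..T} ?q"
    by (intro continuous_on_mult continuous_on_const continuous_scalar_prod[of nx] continuous_mult_mat_vec[OF Q]
        vec_ac_deriv_continuous[OF xs_deriv] xs_carrier mult_mat_vec_carrier[OF Q])
  then have "compact (?q ` {0..T})" using compact_continuous_image by blast
  then obtain K where K: "\<forall>y\<in>?q ` {0..T}. norm y \<le> K" using compact_imp_bounded bounded_iff by metis
  have qi: "integrable M ?q" using cont by (rule continuous_imp_integrable_real)
  have "integrable M (\<lambda>t. ?q t + ctrl_cost (us t))"
  proof (rule integrable_if_ext_integral_finite[where K = "K + lamt"])
    show "(\<lambda>t. ?q t + ctrl_cost (us t)) \<in> borel_measurable M"
      by (intro borel_measurable_add borel_measurable_integrable[OF qi] ctrl_cost_measurable us_measurable us_carrier)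
    fix t assume t: "t \<in> {0..T}"
    have "norm (?q t) \<le> K" using K t by blast
    moreover have "- lamt \<le> ctrl_cost (us t)"
      using R_form_nonneg[OF us_carrier[OF t]] sparsity_bounds[of "us t"] unfolding ctrl_cost_def by linarith
    ultimately show "- (K + lamt) \<le> ?q t + ctrl_cost (us t)" unfolding real_norm_def by linarith
  next
    show "ext_integral T (\<lambda>t. ?q t + ctrl_cost (us t)) < \<infinity>"
      using fin unfolding lq_cost_def quad_cost_split by (cases "ext_integral T (\<lambda>t. ?q t + ctrl_cost (us t))") auto
  qed
  then have "integrable M (\<lambda>t. (?q t + ctrl_cost (us t)) - ?q t)"
    using qi by (rule Bochner_Integration.integrable_diff)
  then show ?thesis by simp
qed

lemma vnorm_sup_le:
  assumes "\<And>t. t \<in> {0..T} \<Longrightarrow> y t \<in> carrier_vec nx" "\<And>t. t \<in> {0..T} \<Longrightarrow> vnorm (y t) \<le> e"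
  shows "(SUP t\<in>{0..T}. vnorm ((xs t + y t) - xs t)) \<le> e"
proof (rule cSUP_least)
  show "{0..T} \<noteq> {}" using T by simp
  fix t assume t: "t \<in> {0..T}"
  have "(xs t + y t) - xs t = y t" using xs_carrier[OF t] assms(1)[OF t] by (intro eq_vecI) auto
  then show "vnorm ((xs t + y t) - xs t) \<le> e" using assms(2)[OF t] by simp
qed

text \<open>Replacing large values by 0, instead of clipping them, keeps the control in the nonconvex set \<open>U_LQ\<close>.\<close>

definition cutoff :: "nat \<Rightarrow> real \<Rightarrow> real Matrix.vec" where
  "cutoff k t = (if \<forall>i\<in>{..<nu}. \<bar>vec_index (us t) i\<bar> \<le> real k then us t else 0\<^sub>v nu)"

lemma cutoff_U: "t \<in> {0..T} \<Longrightarrow> cutoff k t \<in> U_LQ N m"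
  using us_U zero_U_LQ[OF N] by (auto simp: cutoff_def)

lemma cutoff_set_measurable:
  "{t \<in> space M. \<forall>i\<in>{..<nu}. \<bar>vec_index (us t) i\<bar> \<le> real k} \<in> sets M"
proof (rule sets.sets_Collect_finite_All)
  fix i assume i: "i \<in> {..<nu}"
  then have [measurable]: "(\<lambda>t. vec_index (us t) i) \<in> borel_measurable M"
    using us_measurable by (simp add: vec_measurable_def)
  show "{t \<in> space M. \<bar>vec_index (us t) i\<bar> \<le> real k} \<in> sets M" by measurable
qed auto

lemma cutoff_measurable: "vec_measurable T nu (cutoff k)"
  unfolding vec_measurable_def
proof (intro allI impI)
  fix i assume i: "i < nu"
  have "(\<lambda>t. if \<forall>i\<in>{..<nu}. \<bar>vec_index (us t) i\<bar> \<le> real k then vec_index (us t) i else 0) \<in> borel_measurable M"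
    using us_measurable i cutoff_set_measurable
    by (intro measurable_If borel_measurable_const) (auto simp: vec_measurable_def)
  moreover have "vec_index (cutoff k t) i = (if \<forall>i\<in>{..<nu}. \<bar>vec_index (us t) i\<bar> \<le> real k then vec_index (us t) i else 0)" for t
    using i by (simp add: cutoff_def)
  ultimately show "(\<lambda>t. vec_index (cutoff k t) i) \<in> borel_measurable M" by simp
qed

lemma B_zero: "B *\<^sub>v 0\<^sub>v nu = 0\<^sub>v nx"
  using B_carrier by (intro eq_vecI) (auto simp: scalar_prod_def)

lemma cutoff_admissible: "admissible_control (cutoff k)"
  unfolding admissible_control_def
proof (intro conjI ballI allI impI)
  fix i assume i: "i < nx"
  have "integrable M (\<lambda>t. (if \<forall>i\<in>{..<nu}. \<bar>vec_index (us t) i\<bar> \<le> real k then 1 else 0) * vec_index (B *\<^sub>v us t) i)"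
  proof (rule integrable_bounded_mult[OF Bus_integrable[OF i], where K=1])
    show "(\<lambda>t. if \<forall>i\<in>{..<nu}. \<bar>vec_index (us t) i\<bar> \<le> real k then 1 else 0) \<in> borel_measurable M"
      by (intro measurable_If cutoff_set_measurable borel_measurable_const)
  qed auto
  moreover have "(if \<forall>i\<in>{..<nu}. \<bar>vec_index (us t) i\<bar> \<le> real k then 1 else 0) * vec_index (B *\<^sub>v us t) i
     = vec_index (B *\<^sub>v cutoff k t) i" for t
    using i B_zero by (simp add: cutoff_def)
  ultimately show "integrable M (\<lambda>t. vec_index (B *\<^sub>v cutoff k t) i)" by simp
qed (erule cutoff_U, rule cutoff_measurable)

lemma cutoff_cost_integrable: "integrable M (\<lambda>t. ctrl_cost (cutoff k t))"
  by (rule ctrl_cost_integrable_bounded[OF cutoff_measurable U_LQ_carrier[OF cutoff_U], where b="real k"])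
    (auto simp: cutoff_def)

text \<open>Dominated convergence with the bound \<open>|B u\<^sub>*|\<close>: at each time the cutoff eventually agrees with \<open>u\<^sub>*\<close>.\<close>

lemma cutoff_dist: "(\<lambda>k. ctrl_dist (cutoff k)) \<longlonglongrightarrow> 0"
proof -
  let ?g = "\<lambda>t. \<Sum>l<nx. \<bar>vec_index (B *\<^sub>v us t) l\<bar>"
  let ?h = "\<lambda>k t. \<Sum>l<nx. \<bar>vec_index (B *\<^sub>v cutoff k t - B *\<^sub>v us t) l\<bar>"
  have "(\<lambda>k. \<integral>t. ?h k t \<partial>M) \<longlonglongrightarrow> (\<integral>t. 0 \<partial>M)"
  proof (rule integral_dominated_convergence[where w="?g"])
    show "integrable M ?g" by (intro Bochner_Integration.integrable_sum integrable_abs Bus_integrable) auto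
    show "?h k \<in> borel_measurable M" for k
      by (intro borel_measurable_integrable Bochner_Integration.integrable_sum integrable_abs
          ctrl_diff_integrable[OF cutoff_admissible]) auto
    have "norm (?h k t) \<le> ?g t" for k t
    proof -
      have "norm (?h k t) = ?h k t" by (simp add: sum_nonneg)
      also have "\<dots> \<le> ?g t"
      proof (rule sum_mono)
        fix l assume "l \<in> {..<nx}"
        then have l: "l < nx" by simp
        have "vec_index (B *\<^sub>v cutoff k t - B *\<^sub>v us t) l = vec_index (B *\<^sub>v cutoff k t) l - vec_index (B *\<^sub>v us t) l"
          using l B_carrier by simp
        moreover have "vec_index (B *\<^sub>v cutoff k t) l = vec_index (B *\<^sub>v us t) l \<or> vec_index (B *\<^sub>v cutoff k t) l = 0"
          using l B_zero by (auto simp: cutoff_def)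
        ultimately show "\<bar>vec_index (B *\<^sub>v cutoff k t - B *\<^sub>v us t) l\<bar> \<le> \<bar>vec_index (B *\<^sub>v us t) l\<bar>" by auto
      qed
      finally show ?thesis .
    qed
    then show "AE t in M. norm (?h k t) \<le> ?g t" for k by simp
    have "(\<lambda>k. ?h k t) \<longlonglongrightarrow> 0" for t
    proof (rule tendsto_eventually)
      obtain k0 where k0: "(\<Sum>i<nu. \<bar>vec_index (us t) i\<bar>) \<le> real k0" using real_arch_simple by blast
      have "?h k t = 0" if "k0 \<le> k" for k
      proof -
        have "\<bar>vec_index (us t) i\<bar> \<le> real k" if "i < nu" for i
        proof -
          have "\<bar>vec_index (us t) i\<bar> \<le> (\<Sum>i<nu. \<bar>vec_index (us t) i\<bar>)"
            using that by (intro member_le_sum) auto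
          also have "\<dots> \<le> real k" using k0 \<open>k0 \<le> k\<close> by linarith
          finally show ?thesis .
        qed
        then have "cutoff k t = us t" by (simp add: cutoff_def)
        then show ?thesis using B_carrier by (intro sum.neutral) auto
      qed
      then show "\<forall>\<^sub>F k in sequentially. ?h k t = 0" unfolding eventually_sequentially by blast
    qed
    then show "AE t in M. (\<lambda>k. ?h k t) \<longlonglongrightarrow> 0" by simp
  qed simp
  then show ?thesis by (simp add: ctrl_dist_def)
qed

text \<open>For large \<open>k\<close> the trajectory of the \<open>k\<close>-th cutoff is so close to \<open>x\<^sub>*\<close> that it competes with the minimizer, and its
  cost is finite.\<close>

lemma us_cost_integrable: "integrable M (\<lambda>t. ctrl_cost (us t))"
proof -
  obtain e where e: "e > 0" and opt: "\<And>x u. admissible_pair x u \<Longrightarrow>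
      (SUP t\<in>{0..T}. vnorm (x t - xs t)) \<le> e \<Longrightarrow> cost xs us \<le> cost x u"
    using minimizer unfolding local_minimizer_def by blast
  obtain C where C: "C \<ge> 0" and per: "\<And>u. admissible_control u \<Longrightarrow> \<exists>y. perturbation u y \<and>
        (\<forall>t\<in>{0..T}. \<forall>i<nx. \<bar>vec_index (y t) i\<bar> \<le> C * ctrl_dist u) \<and> (\<forall>t\<in>{0..T}. vnorm (y t) \<le> C * ctrl_dist u)"
    using perturbed_trajectory by blast
  have "(\<lambda>k. C * ctrl_dist (cutoff k)) \<longlonglongrightarrow> C * 0" by (intro tendsto_mult tendsto_const cutoff_dist)
  then have "\<forall>\<^sub>F k in sequentially. C * ctrl_dist (cutoff k) < e" using e by (intro order_tendstoD) auto
  then obtain k where k: "C * ctrl_dist (cutoff k) < e"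
    using eventually_happens'[OF sequentially_bot] by blast
  from per[OF cutoff_admissible, of k] obtain y where py: "perturbation (cutoff k) y"
    and small: "\<And>t. t \<in> {0..T} \<Longrightarrow> vnorm (y t) \<le> C * ctrl_dist (cutoff k)" by blast
  note y = py[unfolded perturbation_def, THEN conjunct1, rule_format]
    py[unfolded perturbation_def, THEN conjunct2, THEN conjunct1]
  have adm: "admissible_pair (\<lambda>t. xs t + y t) (cutoff k)" using py by (simp add: perturbation_def)
  have "(SUP t\<in>{0..T}. vnorm ((xs t + y t) - xs t)) \<le> e"
  proof (rule vnorm_sup_le)
    fix t assume "t \<in> {0..T}"
    from small[OF this] k show "vnorm (y t) \<le> e" by linarith
  qed (rule y(1))
  from opt[OF adm this] have le: "cost xs us \<le> cost (\<lambda>t. xs t + y t) (cutoff k)" .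
  have "continuous_on {0..T} (\<lambda>t. vec_index (xs t + y t) i)" if i: "i < nx" for i
    by (rule continuous_add_vec[OF vec_ac_deriv_continuous[OF xs_deriv i] vec_ac_deriv_continuous[OF y(2) i] y(1) i])
  then have "cost (\<lambda>t. xs t + y t) (cutoff k) < \<infinity>"
    using cost_eq(2)[of "\<lambda>t. xs t + y t" "cutoff k", OF _ _ cutoff_cost_integrable] xs_carrier y(1) by simp
  with le have "cost xs us < \<infinity>" by (rule order_le_less_trans)
  then show ?thesis by (rule us_cost_integrable_if_finite)
qed

lemma adjoint_exists:
  obtains p where "\<And>t. p t \<in> carrier_vec nx"
    "vec_ac_deriv T nx p (\<lambda>t. - (transpose_mat A *\<^sub>v p t) + Q *\<^sub>v xs t)" "p T = - (Qh *\<^sub>v xs T)"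
proof -
  have At: "- transpose_mat A \<in> carrier_mat nx nx" using A by simp
  have g: "Q *\<^sub>v xs t \<in> carrier_vec nx" for t
    by (rule carrier_vecI) (simp only: dim_mult_mat_vec carrier_matD(1)[OF Q])
  have pT: "- (Qh *\<^sub>v xs T) \<in> carrier_vec nx"
    using mult_mat_vec_carrier[OF Qh xs_carrier[of T]] T by simp
  obtain p where p: "\<And>t. p t \<in> carrier_vec nx" "vec_ac_deriv T nx p (\<lambda>t. (- transpose_mat A) *\<^sub>v p t + Q *\<^sub>v xs t)"
    "p T = - (Qh *\<^sub>v xs T)"
    using vec_linear_ode_terminal[OF At g mult_mat_vec_integrable[OF xs_deriv xs_carrier Q] pT] by blast
  have "(- transpose_mat A) *\<^sub>v p t = - (transpose_mat A *\<^sub>v p t)" for t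
    using A p(1)[of t] by (intro uminus_mult_mat_vec) auto
  with p(2) have "vec_ac_deriv T nx p (\<lambda>t. - (transpose_mat A *\<^sub>v p t) + Q *\<^sub>v xs t)" by simp
  from that[OF p(1) this p(3)] show thesis .
qed

end

section \<open>Needle perturbations\<close>

lemma window_set_measurable: "{t \<in> space (lebesgue_on {0..T}). t \<in> {a..b::real}} \<in> sets (lebesgue_on {0..T})"
proof -
  have "{a..b} \<inter> {0..T} \<in> sets (lebesgue_on {0..T})" by (auto simp: sets_restrict_space)
  then show ?thesis by (simp add: space_restrict_space Int_def conj_commute)
qed

lemma integral_lebesgue_on_window:
  fixes h :: "real \<Rightarrow> real"
  assumes h: "integrable (lebesgue_on {0..T}) h" and ab: "0 \<le> a" "a \<le> b" "b \<le> T"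
  shows "integrable (lebesgue_on {0..T}) (\<lambda>t. if t \<in> {a..b} then h t else 0)"
    and "(\<integral>t. (if t \<in> {a..b} then h t else 0) \<partial>lebesgue_on {0..T}) = integral {0..b} h - integral {0..a} h"
proof -
  let ?M = "lebesgue_on {0..T}"
  have "(\<lambda>t. (if t \<in> {a..b} then 1 else 0) :: real) \<in> borel_measurable ?M"
    by (intro measurable_If window_set_measurable borel_measurable_const)
  then have "integrable ?M (\<lambda>t. (if t \<in> {a..b} then 1 else 0) * h t)"
    by (rule integrable_bounded_mult[OF h, where K=1]) auto
  moreover have "(if t \<in> {a..b} then 1 else 0) * h t = (if t \<in> {a..b} then h t else 0)" for t by simp
  ultimately show i: "integrable ?M (\<lambda>t. if t \<in> {a..b} then h t else 0)" by simp
  have hi: "h integrable_on {0..T}" by (rule integrable_on_lebesgue_on[OF h]) simp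
  have "(\<integral>t. (if t \<in> {a..b} then h t else 0) \<partial>?M) = integral {0..T} (\<lambda>t. if t \<in> {a..b} then h t else 0)"
    by (rule lebesgue_integral_eq_integral[OF i]) simp
  also have "\<dots> = integral {a..b} h"
  proof -
    have "{a..b} \<inter> {0..T} = {a..b}" using ab by auto
    then show ?thesis by (simp only: integral_if_mem)
  qed
  also have "\<dots> = integral {0..b} h - integral {0..a} h"
    using Henstock_Kurzweil_Integration.integral_combine[of 0 a b h] ab integrable_on_subinterval[OF hi, of 0 b] by auto
  finally show "(\<integral>t. (if t \<in> {a..b} then h t else 0) \<partial>?M) = integral {0..b} h - integral {0..a} h" .
qed

text \<open>Divide by \<open>b - a\<close>. Since \<open>\<Gamma>\<close> is differentiable at \<open>a\<close>, \<open>(\<Gamma> b - \<Gamma> a)\<^sup>2 / (b - a)\<close> is the product of a convergent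
  quotient and a factor that tends to 0.\<close>

lemma derivative_nonneg_if_quadratic_lower_bound:
  fixes F \<Gamma> :: "real \<Rightarrow> real"
  assumes F: "(F has_real_derivative f) (at a within {0..T})" and G: "(\<Gamma> has_real_derivative \<gamma>) (at a within {0..T})"
    and a: "0 \<le> a" "a < T" and e: "e > 0"
    and ineq: "\<And>b. a < b \<Longrightarrow> b \<le> T \<Longrightarrow> \<Gamma> b - \<Gamma> a \<le> e \<Longrightarrow> 0 \<le> K * (\<Gamma> b - \<Gamma> a)\<^sup>2 + (F b - F a)"
  shows "0 \<le> f"
proof -
  have at: "at a within {a<..T} \<le> at a within {0..T}"
    by (rule at_le) (use a in auto)
  have nb: "at a within {a<..T} \<noteq> bot"
  proof -
    have "{a<..T} - {a} = {a..T} - {a}" by auto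
    then have "at a within {a<..T} = at a within {a..T}" unfolding at_within_def by simp
    then show ?thesis using a(2) trivial_limit_at_right_real[of a] by (simp add: at_within_Icc_at_right)
  qed
  have F': "((\<lambda>b. (F b - F a) / (b - a)) \<longlongrightarrow> f) (at a within {a<..T})"
    using F at unfolding has_field_derivative_iff by (rule tendsto_mono[rotated])
  have G': "((\<lambda>b. (\<Gamma> b - \<Gamma> a) / (b - a)) \<longlongrightarrow> \<gamma>) (at a within {a<..T})"
    using G at unfolding has_field_derivative_iff by (rule tendsto_mono[rotated])
  have "(\<Gamma> \<longlongrightarrow> \<Gamma> a) (at a within {0..T})"
    using DERIV_continuous[OF G] by (simp add: continuous_within)
  then have G0: "(\<Gamma> \<longlongrightarrow> \<Gamma> a) (at a within {a<..T})" by (rule tendsto_mono[OF at])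
  then have "((\<lambda>b. \<Gamma> b - \<Gamma> a) \<longlongrightarrow> \<Gamma> a - \<Gamma> a) (at a within {a<..T})" by (intro tendsto_intros)
  then have G1: "((\<lambda>b. \<Gamma> b - \<Gamma> a) \<longlongrightarrow> 0) (at a within {a<..T})" by simp
  have "((\<lambda>b. K * (((\<Gamma> b - \<Gamma> a) / (b - a)) * (\<Gamma> b - \<Gamma> a)) + (F b - F a) / (b - a)) \<longlongrightarrow> K * (\<gamma> * 0) + f) (at a within {a<..T})"
    by (intro tendsto_intros F' G' G1)
  moreover have "\<forall>\<^sub>F b in at a within {a<..T}. 0 \<le> K * (((\<Gamma> b - \<Gamma> a) / (b - a)) * (\<Gamma> b - \<Gamma> a)) + (F b - F a) / (b - a)"
  proof -
    have "\<forall>\<^sub>F b in at a within {a<..T}. \<Gamma> b - \<Gamma> a < e" using G1 e by (intro order_tendstoD) auto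
    moreover have "\<forall>\<^sub>F b in at a within {a<..T}. b \<in> {a<..T}" by (simp add: eventually_at_filter)
    ultimately show ?thesis
    proof eventually_elim
      case (elim b)
      then have "0 \<le> (K * (\<Gamma> b - \<Gamma> a)\<^sup>2 + (F b - F a)) / (b - a)"
        using ineq[of b] by (intro divide_nonneg_pos) auto
      then show ?case by (simp add: add_divide_distrib power2_eq_square)
    qed
  qed
  ultimately have "0 \<le> K * (\<gamma> * 0) + f" by (rule tendsto_lowerbound[OF _ _ nb])
  then show ?thesis by simp
qed

locale lq_adjoint = lq_optimal +
  fixes p :: "real \<Rightarrow> real Matrix.vec"
  assumes p_carrier: "\<And>t. p t \<in> carrier_vec nx"
    and p_deriv: "vec_ac_deriv T nx p (\<lambda>t. - (transpose_mat A *\<^sub>v p t) + Q *\<^sub>v xs t)"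
    and p_T: "p T = - (Qh *\<^sub>v xs T)"
begin

lemma p_B_integrable:
  assumes "\<And>i. i < nx \<Longrightarrow> integrable M (\<lambda>t. vec_index (B *\<^sub>v u t) i)"
  shows "integrable M (\<lambda>t. scalar_prod (p t) (B *\<^sub>v u t))"
proof -
  have "integrable M (\<lambda>t. \<Sum>i<nx. vec_index (p t) i * vec_index (B *\<^sub>v u t) i)"
    by (intro Bochner_Integration.integrable_sum integrable_continuous_mult assms vec_ac_deriv_continuous[OF p_deriv]) auto
  then show ?thesis by (simp only: scalar_prod_sum[OF mult_B_carrier])
qed

lemma ctrl_ham_integrable:
  assumes "admissible_control u" "integrable M (\<lambda>t. ctrl_cost (u t))"
  shows "integrable M (\<lambda>t. ctrl_ham (p t) (u t))"
  unfolding ctrl_ham_eq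
  by (intro Bochner_Integration.integrable_diff p_B_integrable assms(2)) (use assms(1) in \<open>simp add: admissible_control_def\<close>)

lemma us_admissible_control: "admissible_control us"
  unfolding admissible_control_def using us_U us_measurable Bus_integrable by blast

lemma us_ctrl_ham_integrable: "integrable M (\<lambda>t. ctrl_ham (p t) (us t))"
  by (rule ctrl_ham_integrable[OF us_admissible_control us_cost_integrable])

text \<open>Expand the two quadratic state costs around \<open>x\<^sub>*\<close>. The cross terms \<open>\<integral> \<langle>Q x\<^sub>*, y\<rangle>\<close> and \<open>\<langle>Qh x\<^sub>*(T), y(T)\<rangle>\<close> are
  removed by \<open>adjoint_identity\<close> and the terminal condition for \<open>p\<close>, which leave \<open>- \<integral> \<langle>p, B (u - u\<^sub>*)\<rangle>\<close>.\<close>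

lemma cost_increment:
  assumes u: "admissible_control u" and ui: "integrable M (\<lambda>t. ctrl_cost (u t))"
    and pert: "perturbation u y"
  shows "integrable M (\<lambda>t. 1/2 * scalar_prod (y t) (Q *\<^sub>v y t))"
    and "cost (\<lambda>t. xs t + y t) u = cost xs us +
      ereal ((\<integral>t. 1/2 * scalar_prod (y t) (Q *\<^sub>v y t) \<partial>M) + 1/2 * scalar_prod (y T) (Qh *\<^sub>v y T)
        + (\<integral>t. ctrl_ham (p t) (us t) - ctrl_ham (p t) (u t) \<partial>M))"
proof -
  let ?g = "\<lambda>t. B *\<^sub>v u t - B *\<^sub>v us t"
  have y: "\<And>t. y t \<in> carrier_vec nx" "vec_ac_deriv T nx y (\<lambda>t. A *\<^sub>v y t + ?g t)" "y 0 = 0\<^sub>v nx"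
    using pert by (auto simp only: perturbation_def)
  have TT: "T \<in> {0..T}" "0 \<le> T" using T by auto
  note xcont = vec_ac_deriv_continuous[OF xs_deriv] and ycont = vec_ac_deriv_continuous[OF y(2)]
  have xyc: "xs t + y t \<in> carrier_vec nx" if "t \<in> {0..T}" for t using xs_carrier[OF that] y(1) by simp
  have xycont: "continuous_on {0..T} (\<lambda>t. vec_index (xs t + y t) i)" if i: "i < nx" for i
    by (rule continuous_add_vec[OF xcont[OF i] ycont[OF i] y(1) i])
  note c0 = cost_eq[OF xs_carrier xcont us_cost_integrable]
  note c1 = cost_eq[OF xyc xycont ui]
  have qy: "integrable M (\<lambda>t. 1/2 * scalar_prod (y t) (Q *\<^sub>v y t))"
    by (rule cost_eq(1)[OF y(1) ycont ui])
  then show "integrable M (\<lambda>t. 1/2 * scalar_prod (y t) (Q *\<^sub>v y t))" .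
  have gc: "?g t \<in> carrier_vec nx" for t using mult_B_carrier by simp
  note adj = adjoint_identity[OF A Q TT(2) p_carrier xs_carrier y(1) gc p_deriv y(2,3)]
  have pg: "scalar_prod (p t) (?g t) = scalar_prod (p t) (B *\<^sub>v u t) - scalar_prod (p t) (B *\<^sub>v us t)" for t
    by (rule scalar_prod_minus_distrib[OF p_carrier mult_B_carrier mult_B_carrier])
  have pgi: "integrable M (\<lambda>t. scalar_prod (p t) (?g t))"
    unfolding pg using u us_admissible_control
    by (intro Bochner_Integration.integrable_diff p_B_integrable) (auto simp only: admissible_control_def)
  have cross: "integrable M (\<lambda>t. scalar_prod (Q *\<^sub>v xs t) (y t))"
    using Bochner_Integration.integrable_diff[OF adj(1) pgi] by simp
  have adj2: "scalar_prod (p T) (y T) = (\<integral>t. scalar_prod (Q *\<^sub>v xs t) (y t) \<partial>M) + (\<integral>t. scalar_prod (p t) (?g t) \<partial>M)"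
    using adj(2) Bochner_Integration.integral_add[OF cross pgi] by simp
  have pT: "scalar_prod (p T) (y T) = - scalar_prod (Qh *\<^sub>v xs T) (y T)"
    unfolding p_T using y(1)[of T] Qh by (intro scalar_prod_uminus_left) auto
  have run: "(\<integral>t. 1/2 * scalar_prod (xs t + y t) (Q *\<^sub>v (xs t + y t)) \<partial>M)
      = (\<integral>t. 1/2 * scalar_prod (xs t) (Q *\<^sub>v xs t) \<partial>M) + (\<integral>t. scalar_prod (Q *\<^sub>v xs t) (y t) \<partial>M)
        + (\<integral>t. 1/2 * scalar_prod (y t) (Q *\<^sub>v y t) \<partial>M)"
  proof -
    have "(\<integral>t. 1/2 * scalar_prod (xs t + y t) (Q *\<^sub>v (xs t + y t)) \<partial>M)
      = (\<integral>t. 1/2 * scalar_prod (xs t) (Q *\<^sub>v xs t) + scalar_prod (Q *\<^sub>v xs t) (y t) + 1/2 * scalar_prod (y t) (Q *\<^sub>v y t) \<partial>M)"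
      by (rule Bochner_Integration.integral_cong[OF refl])
        (rule quadratic_expansion[OF Q xs_carrier y(1) Q_sym], simp_all only: space_restrict_space Int_iff space_completion)
    also have "\<dots> = (\<integral>t. 1/2 * scalar_prod (xs t) (Q *\<^sub>v xs t) + scalar_prod (Q *\<^sub>v xs t) (y t) \<partial>M) + (\<integral>t. 1/2 * scalar_prod (y t) (Q *\<^sub>v y t) \<partial>M)"
      by (rule Bochner_Integration.integral_add[OF Bochner_Integration.integrable_add[OF c0(1) cross] qy])
    also have "(\<integral>t. 1/2 * scalar_prod (xs t) (Q *\<^sub>v xs t) + scalar_prod (Q *\<^sub>v xs t) (y t) \<partial>M)
      = (\<integral>t. 1/2 * scalar_prod (xs t) (Q *\<^sub>v xs t) \<partial>M) + (\<integral>t. scalar_prod (Q *\<^sub>v xs t) (y t) \<partial>M)"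
      by (rule Bochner_Integration.integral_add[OF c0(1) cross])
    finally show ?thesis .
  qed
  have fin: "1/2 * scalar_prod (xs T + y T) (Qh *\<^sub>v (xs T + y T)) =
    1/2 * scalar_prod (xs T) (Qh *\<^sub>v xs T) + scalar_prod (Qh *\<^sub>v xs T) (y T) + 1/2 * scalar_prod (y T) (Qh *\<^sub>v y T)"
    by (rule quadratic_expansion[OF Qh xs_carrier[OF TT(1)] y(1) Qh_sym])
  have ham: "(\<integral>t. ctrl_ham (p t) (us t) - ctrl_ham (p t) (u t) \<partial>M)
     = - (\<integral>t. scalar_prod (p t) (?g t) \<partial>M) + (\<integral>t. ctrl_cost (u t) \<partial>M) - (\<integral>t. ctrl_cost (us t) \<partial>M)"
  proof -
    have "(\<integral>t. ctrl_ham (p t) (us t) - ctrl_ham (p t) (u t) \<partial>M)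
      = (\<integral>t. (ctrl_cost (u t) - ctrl_cost (us t)) - scalar_prod (p t) (?g t) \<partial>M)"
      unfolding ctrl_ham_eq pg by (rule Bochner_Integration.integral_cong[OF refl]) simp
    also have "\<dots> = (\<integral>t. ctrl_cost (u t) - ctrl_cost (us t) \<partial>M) - (\<integral>t. scalar_prod (p t) (?g t) \<partial>M)"
      by (rule Bochner_Integration.integral_diff[OF Bochner_Integration.integrable_diff[OF ui us_cost_integrable] pgi])
    also have "(\<integral>t. ctrl_cost (u t) - ctrl_cost (us t) \<partial>M) = (\<integral>t. ctrl_cost (u t) \<partial>M) - (\<integral>t. ctrl_cost (us t) \<partial>M)"
      by (rule Bochner_Integration.integral_diff[OF ui us_cost_integrable])
    finally show ?thesis by simp
  qed
  show "cost (\<lambda>t. xs t + y t) u = cost xs us +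
      ereal ((\<integral>t. 1/2 * scalar_prod (y t) (Q *\<^sub>v y t) \<partial>M) + 1/2 * scalar_prod (y T) (Qh *\<^sub>v y T)
        + (\<integral>t. ctrl_ham (p t) (us t) - ctrl_ham (p t) (u t) \<partial>M))"
  proof -
    have c0': "cost xs us = ereal ((\<integral>t. 1/2 * scalar_prod (xs t) (Q *\<^sub>v xs t) \<partial>M)
        + (\<integral>t. ctrl_cost (us t) \<partial>M) + 1/2 * scalar_prod (xs T) (Qh *\<^sub>v xs T))"
      by (rule c0(2))
    have c1': "cost (\<lambda>t. xs t + y t) u =
        ereal ((\<integral>t. 1/2 * scalar_prod (xs t + y t) (Q *\<^sub>v (xs t + y t)) \<partial>M)
        + (\<integral>t. ctrl_cost (u t) \<partial>M) + 1/2 * scalar_prod (xs T + y T) (Qh *\<^sub>v (xs T + y T)))"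
      by (rule c1(2))
    show ?thesis
      unfolding c0' c1' run fin ham plus_ereal.simps ereal.inject using adj2 pT by linarith
  qed
qed

text \<open>Local optimality applies once \<open>ctrl_dist u\<close> is small, and the quadratic terms of \<open>cost_increment\<close> are at most
  a constant times its square because the state perturbation is at most a constant times \<open>ctrl_dist u\<close>.\<close>

lemma needle_inequality:
  obtains K e where "e > 0"
    "\<And>u. admissible_control u \<Longrightarrow> integrable M (\<lambda>t. ctrl_cost (u t)) \<Longrightarrow> ctrl_dist u \<le> e \<Longrightarrow>
      0 \<le> K * (ctrl_dist u)\<^sup>2 + (\<integral>t. ctrl_ham (p t) (us t) - ctrl_ham (p t) (u t) \<partial>M)"
proof -
  obtain e where e: "e > 0" and opt: "\<And>x u. admissible_pair x u \<Longrightarrow>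
      (SUP t\<in>{0..T}. vnorm (x t - xs t)) \<le> e \<Longrightarrow> cost xs us \<le> cost x u"
    using minimizer unfolding local_minimizer_def by blast
  obtain C where C: "C \<ge> 0" and per: "\<And>u. admissible_control u \<Longrightarrow> \<exists>y. perturbation u y \<and>
        (\<forall>t\<in>{0..T}. \<forall>i<nx. \<bar>vec_index (y t) i\<bar> \<le> C * ctrl_dist u) \<and> (\<forall>t\<in>{0..T}. vnorm (y t) \<le> C * ctrl_dist u)"
    using perturbed_trajectory by blast
  obtain KQ where KQ: "KQ \<ge> 0" "\<And>v c. v \<in> carrier_vec nx \<Longrightarrow> (\<And>i. i < nx \<Longrightarrow> \<bar>vec_index v i\<bar> \<le> c) \<Longrightarrow>
     \<bar>scalar_prod v (Q *\<^sub>v v)\<bar> \<le> KQ * c\<^sup>2" using quadratic_form_bound[OF Q] by blast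
  obtain KH where KH: "KH \<ge> 0" "\<And>v c. v \<in> carrier_vec nx \<Longrightarrow> (\<And>i. i < nx \<Longrightarrow> \<bar>vec_index v i\<bar> \<le> c) \<Longrightarrow>
     \<bar>scalar_prod v (Qh *\<^sub>v v)\<bar> \<le> KH * c\<^sup>2" using quadratic_form_bound[OF Qh] by blast
  define K where "K = (T * KQ + KH) / 2 * C\<^sup>2"
  show thesis
  \<comment> \<open>\<open>C * (e / (C + 1)) \<le> e\<close>, also for \<open>C = 0\<close>: perturbations of this size stay in the neighbourhood of local optimality\<close>
  proof (rule that[of "e / (C + 1)" K])
    show "e / (C + 1) > 0" using e C by simp
    fix u assume u: "admissible_control u" and ui: "integrable M (\<lambda>t. ctrl_cost (u t))" and small: "ctrl_dist u \<le> e / (C + 1)"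
    from per[OF u] obtain y where pert: "perturbation u y"
      and comp: "\<And>t i. t \<in> {0..T} \<Longrightarrow> i < nx \<Longrightarrow> \<bar>vec_index (y t) i\<bar> \<le> C * ctrl_dist u"
      and small_y: "\<And>t. t \<in> {0..T} \<Longrightarrow> vnorm (y t) \<le> C * ctrl_dist u" by blast
    have yc: "\<And>t. y t \<in> carrier_vec nx" and adm: "admissible_pair (\<lambda>t. xs t + y t) u"
      using pert by (auto simp only: perturbation_def)
    have "C * ctrl_dist u \<le> C * (e / (C + 1))" using small C by (rule mult_left_mono)
    also have "\<dots> \<le> e" using C e by (simp add: field_simps)
    finally have Ce: "C * ctrl_dist u \<le> e" .
    have "(SUP t\<in>{0..T}. vnorm ((xs t + y t) - xs t)) \<le> e"
    proof (rule vnorm_sup_le)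
      fix t assume "t \<in> {0..T}"
      from small_y[OF this] Ce show "vnorm (y t) \<le> e" by linarith
    qed (rule yc)
    from opt[OF adm this] have "cost xs us \<le> cost (\<lambda>t. xs t + y t) u" .
    moreover have "cost xs us = ereal ((\<integral>t. 1/2 * scalar_prod (xs t) (Q *\<^sub>v xs t) \<partial>M)
        + (\<integral>t. ctrl_cost (us t) \<partial>M) + 1/2 * scalar_prod (xs T) (Qh *\<^sub>v xs T))"
      by (rule cost_eq(2)[OF xs_carrier vec_ac_deriv_continuous[OF xs_deriv] us_cost_integrable])
    ultimately have "0 \<le> (\<integral>t. 1/2 * scalar_prod (y t) (Q *\<^sub>v y t) \<partial>M) + 1/2 * scalar_prod (y T) (Qh *\<^sub>v y T)
        + (\<integral>t. ctrl_ham (p t) (us t) - ctrl_ham (p t) (u t) \<partial>M)"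
      unfolding cost_increment(2)[OF u ui pert]
      by (simp only: plus_ereal.simps ereal_less_eq(3) le_add_same_cancel1)
    moreover have "(\<integral>t. 1/2 * scalar_prod (y t) (Q *\<^sub>v y t) \<partial>M) \<le> T * (KQ / 2 * (C * ctrl_dist u)\<^sup>2)"
    proof -
      have "(\<integral>t. 1/2 * scalar_prod (y t) (Q *\<^sub>v y t) \<partial>M) \<le> (\<integral>t. KQ / 2 * (C * ctrl_dist u)\<^sup>2 \<partial>M)"
      proof (rule integral_mono)
        show "integrable M (\<lambda>t. 1/2 * scalar_prod (y t) (Q *\<^sub>v y t))" by (rule cost_increment(1)[OF u ui pert])
        show "integrable M (\<lambda>t. KQ / 2 * (C * ctrl_dist u)\<^sup>2)"
          by (intro continuous_imp_integrable_real continuous_on_const)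
        fix t assume "t \<in> space M"
        then have t: "t \<in> {0..T}" by (simp add: space_restrict_space)
        show "1/2 * scalar_prod (y t) (Q *\<^sub>v y t) \<le> KQ / 2 * (C * ctrl_dist u)\<^sup>2"
          using KQ(2)[OF yc comp[OF t]] by (simp add: abs_le_iff)
      qed
      also have "\<dots> = T * (KQ / 2 * (C * ctrl_dist u)\<^sup>2)"
        using T by (simp add: measure_restrict_space space_restrict_space)
      finally show ?thesis .
    qed
    moreover have "1/2 * scalar_prod (y T) (Qh *\<^sub>v y T) \<le> KH / 2 * (C * ctrl_dist u)\<^sup>2"
    proof -
      have "T \<in> {0..T}" using T by simp
      from KH(2)[OF yc comp[OF this]] show ?thesis by (simp add: abs_le_iff)
    qed
    ultimately have "0 \<le> T * (KQ / 2 * (C * ctrl_dist u)\<^sup>2) + KH / 2 * (C * ctrl_dist u)\<^sup>2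
        + (\<integral>t. ctrl_ham (p t) (us t) - ctrl_ham (p t) (u t) \<partial>M)" by linarith
    also have "T * (KQ / 2 * (C * ctrl_dist u)\<^sup>2) + KH / 2 * (C * ctrl_dist u)\<^sup>2 = K * (ctrl_dist u)\<^sup>2"
      by (simp add: K_def power_mult_distrib algebra_simps add_divide_distrib)
    finally show "0 \<le> K * (ctrl_dist u)\<^sup>2 + (\<integral>t. ctrl_ham (p t) (us t) - ctrl_ham (p t) (u t) \<partial>M)" .
  qed
qed

end

section \<open>The maximum condition and the constancy of the Hamiltonian\<close>

lemma has_derivative_scalar_prod:
  assumes f: "vec_has_deriv_at T n f f' t" and g: "vec_has_deriv_at T n g g' t" and t: "t \<in> {0..T}"
    and c: "\<And>s. s \<in> {0..T} \<Longrightarrow> g s \<in> carrier_vec n" "g' \<in> carrier_vec n"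
  shows "((\<lambda>s. scalar_prod (f s) (g s)) has_real_derivative scalar_prod f' (g t) + scalar_prod (f t) g') (at t within {0..T})"
proof -
  have "((\<lambda>s. \<Sum>i<n. vec_index (f s) i * vec_index (g s) i) has_real_derivative
    (\<Sum>i<n. vec_index f' i * vec_index (g t) i + vec_index g' i * vec_index (f t) i)) (at t within {0..T})"
    using f g by (intro DERIV_sum DERIV_mult) (auto simp: vec_has_deriv_at_def)
  moreover have "(\<Sum>i<n. vec_index f' i * vec_index (g t) i + vec_index g' i * vec_index (f t) i)
     = scalar_prod f' (g t) + scalar_prod (f t) g'"
    by (simp only: scalar_prod_sum[OF c(1)[OF t]] scalar_prod_sum[OF c(2)] sum.distrib mult.commute[of "vec_index g' _" _])
  ultimately have d: "((\<lambda>s. \<Sum>i<n. vec_index (f s) i * vec_index (g s) i) has_real_derivative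
    scalar_prod f' (g t) + scalar_prod (f t) g') (at t within {0..T})" by simp
  show ?thesis
    by (rule has_field_derivative_transform_within[OF d, where d=1]) (use t in \<open>auto simp: scalar_prod_sum[OF c(1)]\<close>)
qed

lemma has_derivative_mult_mat_vec:
  assumes f: "vec_has_deriv_at T n f f' t" and L: "L \<in> carrier_mat r n" and t: "t \<in> {0..T}"
    and c: "\<And>s. s \<in> {0..T} \<Longrightarrow> f s \<in> carrier_vec n" "f' \<in> carrier_vec n"
  shows "vec_has_deriv_at T r (\<lambda>s. L *\<^sub>v f s) (L *\<^sub>v f') t"
  unfolding vec_has_deriv_at_def
proof (intro allI impI)
  fix i assume i: "i < r"
  have d: "((\<lambda>s. \<Sum>j<n. L $$ (i, j) * vec_index (f s) j) has_real_derivative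
    (\<Sum>j<n. L $$ (i, j) * vec_index f' j)) (at t within {0..T})"
    using f by (intro DERIV_sum DERIV_cmult) (auto simp: vec_has_deriv_at_def)
  show "((\<lambda>s. vec_index (L *\<^sub>v f s) i) has_real_derivative vec_index (L *\<^sub>v f') i) (at t within {0..T})"
    unfolding mult_mat_vec_sum[OF L c(2) i]
    by (rule has_field_derivative_transform_within[OF d, where d=1]) (use t mult_mat_vec_sum[OF L c(1) i] in auto)
qed

context lq_data
begin

text \<open>The selection \<open>\<sigma>\<close>. For a value in \<open>U_LQ\<close> at most one block is nonzero, so the least one is the active
  block; if \<open>u = 0\<close>, every block may be chosen.\<close>

definition active_block :: "real Matrix.vec \<Rightarrow> nat" where
  "active_block u = (if \<exists>k\<in>{1..N}. blk m k u \<noteq> 0\<^sub>v (m k)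
     then LEAST k. k \<in> {1..N} \<and> blk m k u \<noteq> 0\<^sub>v (m k) else 1)"

lemma active_block_range: "active_block u \<in> {1..N}"
proof (cases "\<exists>k\<in>{1..N}. blk m k u \<noteq> 0\<^sub>v (m k)")
  case True
  then obtain k where "k \<in> {1..N} \<and> blk m k u \<noteq> 0\<^sub>v (m k)" by blast
  from LeastI[of "\<lambda>k. k \<in> {1..N} \<and> blk m k u \<noteq> 0\<^sub>v (m k)", OF this] True
  show ?thesis by (simp only: active_block_def if_True)
next
  case False
  then show ?thesis using N by (simp add: active_block_def)
qed

lemma inactive_blocks:
  assumes u: "u \<in> U_LQ N m" and l: "l \<in> {1..N} - {active_block u}"
  shows "blk m l u = 0\<^sub>v (m l)"
proof (rule ccontr)
  assume nz: "blk m l u \<noteq> 0\<^sub>v (m l)"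
  let ?P = "\<lambda>k. k \<in> {1..N} \<and> blk m k u \<noteq> 0\<^sub>v (m k)"
  have l': "?P l" using nz l by simp
  then have "active_block u = (LEAST k. ?P k)" unfolding active_block_def by (metis (mono_tags, lifting))
  moreover have "?P (LEAST k. ?P k)" by (rule LeastI[of ?P, OF l'])
  ultimately have a: "?P (active_block u)" by simp
  obtain j where j: "\<And>l. l \<in> {1..N} - {j} \<Longrightarrow> blk m l u = 0\<^sub>v (m l)" using U_LQ_E[OF u] by blast
  have "l = j" using j[of l] l' by blast
  moreover have "active_block u = j" using j[of "active_block u"] a by blast
  ultimately show False using l by simp
qed

lemma active_block_measurable:
  assumes u: "vec_measurable T nu u"
  shows "(\<lambda>t. active_block (u t)) \<in> measurable (lebesgue_on {0..T}) (count_space {1..N})"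
proof -
  let ?M = "lebesgue_on {0..T}"
  let ?Z = "\<lambda>k t. blk m k (u t) = 0\<^sub>v (m k)"
  have Z: "{t \<in> space ?M. ?Z k t} \<in> sets ?M" if "k \<in> {1..N}" for k
    by (rule inactive_set_measurable[OF u that])
  have "{t \<in> space ?M. active_block (u t) = j} \<in> sets ?M" if j: "j \<in> {1..N}" for j
  proof -
    \<comment> \<open>1 is also the value when no block is active\<close>
    have eq: "active_block (u t) = j \<longleftrightarrow> (\<not> ?Z j t \<and> (\<forall>l\<in>{1..<j}. ?Z l t)) \<or> (j = 1 \<and> (\<forall>l\<in>{1..N}. ?Z l t))" for t
    proof (cases "\<exists>k\<in>{1..N}. \<not> ?Z k t")
      case True
      let ?P = "\<lambda>k. k \<in> {1..N} \<and> \<not> ?Z k t"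
      have ex: "\<exists>k. ?P k" using True by blast
      have a: "active_block (u t) = (LEAST k. ?P k)" using True by (simp only: active_block_def if_True)
      show ?thesis
      proof
        assume "active_block (u t) = j"
        then have L: "j = (LEAST k. ?P k)" using a by simp
        have "?P j" unfolding L by (rule LeastI_ex[OF ex])
        moreover have "?Z l t" if "l \<in> {1..<j}" for l
          using not_less_Least[of l ?P] that j unfolding L[symmetric] by auto
        ultimately show "(\<not> ?Z j t \<and> (\<forall>l\<in>{1..<j}. ?Z l t)) \<or> (j = 1 \<and> (\<forall>l\<in>{1..N}. ?Z l t))" by blast
      next
        assume "(\<not> ?Z j t \<and> (\<forall>l\<in>{1..<j}. ?Z l t)) \<or> (j = 1 \<and> (\<forall>l\<in>{1..N}. ?Z l t))"
        then have h: "\<not> ?Z j t" "\<And>l. l \<in> {1..<j} \<Longrightarrow> ?Z l t" using True by blast+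
        show "active_block (u t) = j"
          unfolding a
        proof (rule Least_equality)
          show "?P j" using h j by blast
          fix k assume k: "?P k"
          show "j \<le> k" using h(2)[of k] k by (metis atLeastLessThan_iff atLeastAtMost_iff not_le)
        qed
      qed
    next
      case False
      then have "active_block (u t) = 1" by (simp only: active_block_def if_False)
      then show ?thesis using False j by auto
    qed
    have f1: "{t \<in> space ?M. \<forall>l\<in>{1..<j}. ?Z l t} \<in> sets ?M"
      by (rule sets.sets_Collect_finite_All) (use Z j in auto)
    have f2: "{t \<in> space ?M. \<forall>l\<in>{1..N}. ?Z l t} \<in> sets ?M"
      by (rule sets.sets_Collect_finite_All) (use Z in auto)
    show ?thesis
      unfolding eq by (intro sets.sets_Collect_disj sets.sets_Collect_conj sets.sets_Collect_neg sets.sets_Collect_const f1 f2 Z j)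
  qed
  then show ?thesis
    using active_block_range
    by (subst measurable_count_space_eq2) (auto simp: vimage_def Int_def conj_commute)
qed

lemma gain_ac_deriv:
  assumes k: "k \<in> {1..N}" and p: "vec_ac_deriv T nx p p'"
  shows "\<exists>f'. ac_deriv T (\<lambda>t. gain k (p t)) f'"
proof -
  have b: "vec_ac_deriv T (d k) (\<lambda>t. blk d k (p t)) (\<lambda>t. blk d k (p' t))"
    unfolding vec_ac_deriv_def
  proof (intro allI impI)
    fix i assume i: "i < d k"
    show "ac_deriv T (\<lambda>t. vec_index (blk d k (p t)) i) (\<lambda>t. vec_index (blk d k (p' t)) i)"
      unfolding blk_index[of i d k, OF i] using p blk_offset_less[of k N i d, OF k i] by (simp only: vec_ac_deriv_def)
  qed
  show ?thesis
    unfolding gain_eq(1)[OF k]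
    by (rule exI) (rule ac_deriv_scalar_prod[OF b vec_ac_deriv_mult_mat_vec[OF G_carrier[OF k] b]];
        intro mult_mat_vec_carrier[OF G_carrier[OF k]] blk_carrier)
qed

text \<open>Each gain is a quadratic function of \<open>p\<close>, and a maximum of finitely many functions remains.\<close>

lemma max_ham_ac_deriv:
  assumes p: "vec_ac_deriv T nx p p'"
  shows "\<exists>f'. ac_deriv T (\<lambda>t. max_ham (p t)) f'"
  unfolding max_ham_def
proof (rule ac_deriv_Max)
  fix k assume k: "k \<in> {1..N}"
  from gain_ac_deriv[OF this p] obtain f' where f': "ac_deriv T (\<lambda>t. gain k (p t)) f'" by blast
  show "\<exists>f'. ac_deriv T (\<lambda>t. max lamt (lam' k + 1/2 * gain k (p t))) f'"
    by (rule ac_deriv_max[OF ac_deriv_const ac_deriv_add[OF ac_deriv_const ac_deriv_cmult[OF f']]])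
qed (use N in auto)

lemma feedback_continuous:
  assumes k: "k \<in> {1..N}" and p: "\<And>i. i < nx \<Longrightarrow> continuous_on S (\<lambda>t. vec_index (p t) i)" and i: "i < nu"
  shows "continuous_on S (\<lambda>t. vec_index (embed N m k (feedback k (p t))) i)"
proof -
  have Bt: "transpose_mat (Bk k) \<in> carrier_mat (m k) (d k)" using Bk[OF k] by simp
  note Ri = sym_pos_def_inverse(1)[OF Rk[OF k]]
  have "continuous_on S (\<lambda>t. vec_index (blk d k (p t)) j)" if "j < d k" for j
    unfolding blk_index[of j d k, OF that] by (rule p[OF blk_offset_less[of k N j d, OF k that]])
  then have "continuous_on S (\<lambda>t. vec_index (feedback k (p t)) j)" if "j < m k" for j
    unfolding feedback_def
    by (intro continuous_mult_mat_vec[OF Ri] continuous_mult_mat_vec[OF Bt] that mult_mat_vec_carrier[OF Bt] blk_carrier)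
  then show ?thesis
    using i by (cases "(\<Sum>l = 1..<k. m l) \<le> i \<and> i < (\<Sum>l = 1..<k. m l) + m k") (auto simp: embed_def)
qed

end

context lq_adjoint
begin

text \<open>The needle is the control that equals \<open>v\<close> on \<open>[a, b]\<close> and \<open>u\<^sub>*\<close> elsewhere. With \<open>F\<close> and \<open>\<Gamma>\<close> the indefinite
  integrals of \<open>H(t, u\<^sub>*) - H(t, v)\<close> and \<open>|B (v - u\<^sub>*)|\<close>, minimality says
  \<open>0 \<le> K (\<Gamma> b - \<Gamma> a)\<^sup>2 + (F b - F a)\<close>, and \<open>F\<close> and \<open>\<Gamma>\<close> are differentiable almost everywhere.\<close>

lemma AE_ctrl_ham_le:
  assumes vU: "\<And>t. t \<in> {0..T} \<Longrightarrow> v t \<in> U_LQ N m"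
    and vc: "\<And>i. i < nu \<Longrightarrow> continuous_on {0..T} (\<lambda>t. vec_index (v t) i)"
  shows "AE t in M. ctrl_ham (p t) (v t) \<le> ctrl_ham (p t) (us t)"
proof -
  have vcar: "v t \<in> carrier_vec nu" if "t \<in> {0..T}" for t by (rule U_LQ_carrier[OF vU[OF that]])
  have vmeas: "vec_measurable T nu v"
    unfolding vec_measurable_def by (intro allI impI continuous_imp_measurable_on_sets_lebesgue vc) auto
  have vadm: "admissible_control v"
    unfolding admissible_control_def
  proof (intro conjI ballI allI impI vU vmeas)
    fix i assume "i < nx"
    then show "integrable M (\<lambda>t. vec_index (B *\<^sub>v v t) i)"
      by (intro continuous_imp_integrable_real continuous_mult_mat_vec[OF B_carrier] vc vcar)
  qed
  have vcost: "integrable M (\<lambda>t. ctrl_cost (v t))"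
  proof -
    have "continuous_on {0..T} (\<lambda>t. \<Sum>i<nu. \<bar>vec_index (v t) i\<bar>)"
      by (intro continuous_on_sum continuous_on_rabs vc) auto
    then have "compact ((\<lambda>t. \<Sum>i<nu. \<bar>vec_index (v t) i\<bar>) ` {0..T})" using compact_continuous_image by blast
    then obtain b where b: "\<forall>y\<in>(\<lambda>t. \<Sum>i<nu. \<bar>vec_index (v t) i\<bar>) ` {0..T}. norm y \<le> b"
      using compact_imp_bounded bounded_iff by metis
    show ?thesis
    proof (rule ctrl_cost_integrable_bounded[OF vmeas vcar, where b=b])
      fix t i assume t: "t \<in> {0..T}" and i: "i < nu"
      have "\<bar>vec_index (v t) i\<bar> \<le> (\<Sum>i<nu. \<bar>vec_index (v t) i\<bar>)" using i by (intro member_le_sum) auto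
      also have "\<dots> \<le> norm (\<Sum>i<nu. \<bar>vec_index (v t) i\<bar>)" by simp
      also have "\<dots> \<le> b" using b t by blast
      finally show "\<bar>vec_index (v t) i\<bar> \<le> b" .
    qed
  qed
  obtain K e where e: "e > 0" and needle:
    "\<And>u. admissible_control u \<Longrightarrow> integrable M (\<lambda>t. ctrl_cost (u t)) \<Longrightarrow> ctrl_dist u \<le> e \<Longrightarrow>
      0 \<le> K * (ctrl_dist u)\<^sup>2 + (\<integral>t. ctrl_ham (p t) (us t) - ctrl_ham (p t) (u t) \<partial>M)"
    using needle_inequality by blast
  define f where "f = (\<lambda>t. ctrl_ham (p t) (us t) - ctrl_ham (p t) (v t))"
  define \<gamma> where "\<gamma> = (\<lambda>t. \<Sum>l<nx. \<bar>vec_index (B *\<^sub>v v t - B *\<^sub>v us t) l\<bar>)"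
  have fi: "integrable M f"
    unfolding f_def by (intro Bochner_Integration.integrable_diff us_ctrl_ham_integrable ctrl_ham_integrable[OF vadm vcost])
  have gi: "integrable M \<gamma>"
    unfolding \<gamma>_def by (intro Bochner_Integration.integrable_sum integrable_abs ctrl_diff_integrable[OF vadm]) auto
  define F where "F = (\<lambda>t. integral {0..t} f)"
  define \<Gamma> where "\<Gamma> = (\<lambda>t. integral {0..t} \<gamma>)"
  have ineq: "0 \<le> K * (\<Gamma> b - \<Gamma> a)\<^sup>2 + (F b - F a)"
    if a0: "0 \<le> a" and ab: "a < b" and bT: "b \<le> T" and small: "\<Gamma> b - \<Gamma> a \<le> e" for a b
  proof -
    note win = integral_lebesgue_on_window[OF _ a0 less_imp_le[OF ab] bT]
    define u where "u = (\<lambda>t. if t \<in> {a..b} then v t else us t)"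
    have "vec_measurable T nu u"
      unfolding vec_measurable_def
    proof (intro allI impI)
      fix i assume i: "i < nu"
      have "(\<lambda>t. if t \<in> {a..b} then vec_index (v t) i else vec_index (us t) i) \<in> borel_measurable M"
        using vmeas us_measurable i by (intro measurable_If window_set_measurable) (auto simp only: vec_measurable_def)
      moreover have "vec_index (u t) i = (if t \<in> {a..b} then vec_index (v t) i else vec_index (us t) i)" for t
        by (simp add: u_def)
      ultimately show "(\<lambda>t. vec_index (u t) i) \<in> borel_measurable M" by simp
    qed
    moreover have "integrable M (\<lambda>t. vec_index (B *\<^sub>v u t) i)" if i: "i < nx" for i
    proof -
      have "integrable M (\<lambda>t. vec_index (B *\<^sub>v us t) i + (if t \<in> {a..b} then vec_index (B *\<^sub>v v t - B *\<^sub>v us t) i else 0))"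
        by (intro Bochner_Integration.integrable_add Bus_integrable[OF i] win(1)[OF ctrl_diff_integrable[OF vadm i]])
      moreover have "vec_index (B *\<^sub>v us t) i + (if t \<in> {a..b} then vec_index (B *\<^sub>v v t - B *\<^sub>v us t) i else 0)
         = vec_index (B *\<^sub>v u t) i" for t
        using i B_carrier by (simp add: u_def)
      ultimately show ?thesis by simp
    qed
    moreover have "u t \<in> U_LQ N m" if "t \<in> {0..T}" for t
      using vU[OF that] us_U[OF that] by (simp add: u_def)
    ultimately have uadm: "admissible_control u" unfolding admissible_control_def by blast
    have "integrable M (\<lambda>t. ctrl_cost (us t) + (if t \<in> {a..b} then ctrl_cost (v t) - ctrl_cost (us t) else 0))"
      by (intro Bochner_Integration.integrable_add us_cost_integrable
          win(1)[OF Bochner_Integration.integrable_diff[OF vcost us_cost_integrable]])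
    moreover have "ctrl_cost (us t) + (if t \<in> {a..b} then ctrl_cost (v t) - ctrl_cost (us t) else 0) = ctrl_cost (u t)" for t
      by (simp add: u_def)
    ultimately have ucost: "integrable M (\<lambda>t. ctrl_cost (u t))" by simp
    have "ctrl_dist u = (\<integral>t. (if t \<in> {a..b} then \<gamma> t else 0) \<partial>M)"
      unfolding ctrl_dist_def
    proof (rule Bochner_Integration.integral_cong[OF refl])
      fix t
      have "(\<Sum>l<nx. \<bar>vec_index (B *\<^sub>v us t - B *\<^sub>v us t) l\<bar>) = 0"
        using B_carrier by (intro sum.neutral) auto
      then show "(\<Sum>l<nx. \<bar>vec_index (B *\<^sub>v u t - B *\<^sub>v us t) l\<bar>) = (if t \<in> {a..b} then \<gamma> t else 0)"
        by (cases "t \<in> {a..b}") (simp_all only: u_def \<gamma>_def if_True if_False)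
    qed
    also have "\<dots> = \<Gamma> b - \<Gamma> a" unfolding \<Gamma>_def by (rule win(2)[OF gi])
    finally have dist: "ctrl_dist u = \<Gamma> b - \<Gamma> a" .
    have "(\<integral>t. ctrl_ham (p t) (us t) - ctrl_ham (p t) (u t) \<partial>M) = (\<integral>t. (if t \<in> {a..b} then f t else 0) \<partial>M)"
      by (rule Bochner_Integration.integral_cong[OF refl]) (simp add: u_def f_def)
    also have "\<dots> = F b - F a" unfolding F_def by (rule win(2)[OF fi])
    finally have ham: "(\<integral>t. ctrl_ham (p t) (us t) - ctrl_ham (p t) (u t) \<partial>M) = F b - F a" .
    show ?thesis using needle[OF uadm ucost] small unfolding dist ham by simp
  qed
  \<comment> \<open>the needle lies to the right of \<open>t\<close>\<close>
  have "AE t in M. t \<noteq> T"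
    by (rule AE_lebesgue_onI[of "{T}"]) auto
  moreover have "AE t in M. t \<in> {0..T}" by (rule AE_I2) (simp add: space_restrict_space)
  moreover note AE_has_derivative_integral[OF fi] AE_has_derivative_integral[OF gi]
  ultimately show ?thesis
  proof eventually_elim
    case (elim t)
    have "0 \<le> f t"
      by (rule derivative_nonneg_if_quadratic_lower_bound[of F "f t" t T \<Gamma> "\<gamma> t" e K])
        (use elim e ineq[of t] in \<open>auto simp: F_def \<Gamma>_def\<close>)
    then show ?case by (simp add: f_def)
  qed
qed

lemma AE_maximality:
  "AE t in M. ctrl_ham (p t) (0\<^sub>v nu) \<le> ctrl_ham (p t) (us t) \<and>
     (\<forall>k\<in>{1..N}. ctrl_ham (p t) (embed N m k (feedback k (p t))) \<le> ctrl_ham (p t) (us t))"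
proof -
  have "AE t in M. ctrl_ham (p t) (0\<^sub>v nu) \<le> ctrl_ham (p t) (us t)"
    by (rule AE_ctrl_ham_le[OF zero_U_LQ[OF N]]) simp
  moreover have "AE t in M. \<forall>k\<in>{1..N}. ctrl_ham (p t) (embed N m k (feedback k (p t))) \<le> ctrl_ham (p t) (us t)"
  proof (rule AE_finite_allI)
    fix k assume k: "k \<in> {1..N}"
    show "AE t in M. ctrl_ham (p t) (embed N m k (feedback k (p t))) \<le> ctrl_ham (p t) (us t)"
    proof (rule AE_ctrl_ham_le)
      show "embed N m k (feedback k (p t)) \<in> U_LQ N m" for t
        by (rule embed_U_LQ[of k N _ m, OF k feedback_carrier[OF k]])
      show "continuous_on {0..T} (\<lambda>t. vec_index (embed N m k (feedback k (p t))) i)" if "i < nu" for i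
        by (rule feedback_continuous[OF k vec_ac_deriv_continuous[OF p_deriv] that])
    qed
  qed simp
  ultimately show ?thesis by eventually_elim simp
qed

text \<open>The value at \<open>u\<^sub>*(t)\<close> dominates the values at the candidates among which the maximum is attained.\<close>

lemma AE_ctrl_ham_max: "AE t in M. ctrl_ham (p t) (us t) = max_ham (p t)"
proof -
  have "AE t in M. t \<in> {0..T}" by (rule AE_I2) (simp add: space_restrict_space)
  with AE_maximality show ?thesis
  proof eventually_elim
    case (elim t)
    show ?case
      by (rule maximizing_control(1)[OF p_carrier us_U[OF elim(2)] _ _ active_block_range inactive_blocks[OF us_U[OF elim(2)]]])
        (use elim(1) in auto)
  qed
qed

definition max_hamiltonian :: "real \<Rightarrow> real" where
  "max_hamiltonian t = scalar_prod (p t) (A *\<^sub>v xs t) - 1/2 * scalar_prod (xs t) (Q *\<^sub>v xs t) + max_ham (p t)"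

lemma rhs_carrier: "t \<in> {0..T} \<Longrightarrow> A *\<^sub>v xs t + B *\<^sub>v us t \<in> carrier_vec nx"
  using mult_mat_vec_carrier[OF A xs_carrier] mult_B_carrier by simp

lemma max_hamiltonian_ac_deriv: "\<exists>h'. ac_deriv T max_hamiltonian h'"
proof -
  note Ax = vec_ac_deriv_mult_mat_vec[OF A xs_deriv xs_carrier rhs_carrier]
  note Qx = vec_ac_deriv_mult_mat_vec[OF Q xs_deriv xs_carrier rhs_carrier]
  have 1: "ac_deriv T (\<lambda>t. scalar_prod (p t) (A *\<^sub>v xs t)) (\<lambda>t. scalar_prod (- (transpose_mat A *\<^sub>v p t) + Q *\<^sub>v xs t) (A *\<^sub>v xs t)
      + scalar_prod (p t) (A *\<^sub>v (A *\<^sub>v xs t + B *\<^sub>v us t)))"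
    by (rule ac_deriv_scalar_prod[OF p_deriv Ax mult_mat_vec_carrier[OF A xs_carrier] mult_mat_vec_carrier[OF A rhs_carrier]])
  have 2: "ac_deriv T (\<lambda>t. scalar_prod (xs t) (Q *\<^sub>v xs t)) (\<lambda>t. scalar_prod (A *\<^sub>v xs t + B *\<^sub>v us t) (Q *\<^sub>v xs t)
      + scalar_prod (xs t) (Q *\<^sub>v (A *\<^sub>v xs t + B *\<^sub>v us t)))"
    by (rule ac_deriv_scalar_prod[OF xs_deriv Qx mult_mat_vec_carrier[OF Q xs_carrier] mult_mat_vec_carrier[OF Q rhs_carrier]])
  obtain m' where 3: "ac_deriv T (\<lambda>t. max_ham (p t)) m'" using max_ham_ac_deriv[OF p_deriv] by blast
  have eq: "max_hamiltonian = (\<lambda>t. scalar_prod (p t) (A *\<^sub>v xs t) + (- 1/2) * scalar_prod (xs t) (Q *\<^sub>v xs t) + max_ham (p t))"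
    by (rule ext) (simp add: max_hamiltonian_def)
  show ?thesis unfolding eq by (rule exI) (rule ac_deriv_add[OF ac_deriv_add[OF 1 ac_deriv_cmult[OF 2]] 3])
qed

text \<open>With the control fixed, \<open>p' = - A\<^sup>T p + Q x\<close> and \<open>x' = A x + B u\<close> are the negative of the derivative with
  respect to \<open>x\<close> and the derivative with respect to \<open>p\<close> of the Hamiltonian, so its derivative along the
  trajectory is \<open>\<langle>p', x'\<rangle> - \<langle>p', x'\<rangle> = 0\<close>.\<close>

lemma hamiltonian_stationary_at_fixed_control:
  assumes t: "t \<in> {0..T}"
    and dx: "vec_has_deriv_at T nx xs (A *\<^sub>v xs t + B *\<^sub>v us t) t"
    and dp: "vec_has_deriv_at T nx p (- (transpose_mat A *\<^sub>v p t) + Q *\<^sub>v xs t) t"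
  shows "((\<lambda>s. scalar_prod (p s) (A *\<^sub>v xs s) - 1/2 * scalar_prod (xs s) (Q *\<^sub>v xs s) + ctrl_ham (p s) (us t))
    has_real_derivative 0) (at t within {0..T})"
proof -
  let ?x' = "A *\<^sub>v xs t + B *\<^sub>v us t" and ?p' = "- (transpose_mat A *\<^sub>v p t) + Q *\<^sub>v xs t"
  have x'c: "?x' \<in> carrier_vec nx" by (rule rhs_carrier[OF t])
  have Ac: "A *\<^sub>v xs s \<in> carrier_vec nx" "Q *\<^sub>v xs s \<in> carrier_vec nx" if "s \<in> {0..T}" for s
    using mult_mat_vec_carrier[OF A xs_carrier[OF that]] mult_mat_vec_carrier[OF Q xs_carrier[OF that]] .
  have Atc: "transpose_mat A *\<^sub>v p t \<in> carrier_vec nx" using A p_carrier by auto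
  have p'c: "?p' \<in> carrier_vec nx" using Atc Ac(2)[OF t] by simp
  have Ax'c: "A *\<^sub>v ?x' \<in> carrier_vec nx" "Q *\<^sub>v ?x' \<in> carrier_vec nx"
    using mult_mat_vec_carrier[OF A x'c] mult_mat_vec_carrier[OF Q x'c] .
  have d1: "((\<lambda>s. scalar_prod (p s) (A *\<^sub>v xs s)) has_real_derivative scalar_prod ?p' (A *\<^sub>v xs t) + scalar_prod (p t) (A *\<^sub>v ?x')) (at t within {0..T})"
    by (rule has_derivative_scalar_prod[OF dp has_derivative_mult_mat_vec[OF dx A t xs_carrier x'c] t Ac(1) Ax'c(1)])
  have d2: "((\<lambda>s. scalar_prod (xs s) (Q *\<^sub>v xs s)) has_real_derivative scalar_prod ?x' (Q *\<^sub>v xs t) + scalar_prod (xs t) (Q *\<^sub>v ?x')) (at t within {0..T})"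
    by (rule has_derivative_scalar_prod[OF dx has_derivative_mult_mat_vec[OF dx Q t xs_carrier x'c] t Ac(2) Ax'c(2)])
  have c0: "vec_has_deriv_at T nx (\<lambda>s. B *\<^sub>v us t) (0\<^sub>v nx) t"
    unfolding vec_has_deriv_at_def by auto
  have d3: "((\<lambda>s. scalar_prod (p s) (B *\<^sub>v us t)) has_real_derivative scalar_prod ?p' (B *\<^sub>v us t) + scalar_prod (p t) (0\<^sub>v nx)) (at t within {0..T})"
    by (rule has_derivative_scalar_prod[OF dp c0 t mult_B_carrier zero_carrier_vec])
  have d: "((\<lambda>s. scalar_prod (p s) (A *\<^sub>v xs s) - 1/2 * scalar_prod (xs s) (Q *\<^sub>v xs s) + (scalar_prod (p s) (B *\<^sub>v us t) - ctrl_cost (us t)))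
    has_real_derivative (scalar_prod ?p' (A *\<^sub>v xs t) + scalar_prod (p t) (A *\<^sub>v ?x'))
      - 1/2 * (scalar_prod ?x' (Q *\<^sub>v xs t) + scalar_prod (xs t) (Q *\<^sub>v ?x'))
      + (scalar_prod ?p' (B *\<^sub>v us t) + scalar_prod (p t) (0\<^sub>v nx) - 0)) (at t within {0..T})"
    by (intro DERIV_add DERIV_diff DERIV_cmult DERIV_const d1 d2 d3)
  have e1: "scalar_prod ?p' (A *\<^sub>v xs t) + scalar_prod ?p' (B *\<^sub>v us t) = scalar_prod ?p' ?x'"
    by (rule scalar_prod_add_distrib[OF p'c Ac(1)[OF t] mult_B_carrier, symmetric])
  have e2: "scalar_prod ?p' ?x' = - scalar_prod (p t) (A *\<^sub>v ?x') + scalar_prod (Q *\<^sub>v xs t) ?x'"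
  proof -
    have "scalar_prod ?p' ?x' = scalar_prod (- (transpose_mat A *\<^sub>v p t)) ?x' + scalar_prod (Q *\<^sub>v xs t) ?x'"
      by (rule add_scalar_prod_distrib[OF _ Ac(2)[OF t] x'c]) (use Atc in simp)
    also have "scalar_prod (- (transpose_mat A *\<^sub>v p t)) ?x' = - scalar_prod (transpose_mat A *\<^sub>v p t) ?x'"
      by (rule scalar_prod_uminus_left) (use Atc x'c in \<open>simp only: carrier_vecD\<close>)
    also have "scalar_prod (transpose_mat A *\<^sub>v p t) ?x' = scalar_prod (p t) (A *\<^sub>v ?x')"
      by (rule transpose_vec_mult_scalar[OF A x'c p_carrier])
    finally show ?thesis .
  qed
  have e3: "scalar_prod ?x' (Q *\<^sub>v xs t) = scalar_prod (Q *\<^sub>v xs t) ?x'" by (rule comm_scalar_prod[OF x'c Ac(2)[OF t]])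
  have e4: "scalar_prod (xs t) (Q *\<^sub>v ?x') = scalar_prod (Q *\<^sub>v xs t) ?x'" by (rule Q_sym[OF xs_carrier[OF t] x'c])
  have e5: "scalar_prod (p t) (0\<^sub>v nx) = 0" using p_carrier by simp
  have "(scalar_prod ?p' (A *\<^sub>v xs t) + scalar_prod (p t) (A *\<^sub>v ?x'))
      - 1/2 * (scalar_prod ?x' (Q *\<^sub>v xs t) + scalar_prod (xs t) (Q *\<^sub>v ?x'))
      + (scalar_prod ?p' (B *\<^sub>v us t) + scalar_prod (p t) (0\<^sub>v nx) - 0) = 0"
  proof -
    have arith: "(a + c) - 1/2 * (q + q) + (b + 0 - 0) = 0" if "a + b = - c + q" for a b c q :: real
      using that by (simp add: algebra_simps)
    show ?thesis unfolding e3 e4 e5 by (rule arith) (use e1 e2 in \<open>simp only:\<close>)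
  qed
  with d show ?thesis unfolding ctrl_ham_eq by (simp only:)
qed

lemma max_hamiltonian_constant:
  assumes "t \<in> {0..T}"
  shows "max_hamiltonian t = max_hamiltonian 0"
proof -
  obtain h' where h': "ac_deriv T max_hamiltonian h'" using max_hamiltonian_ac_deriv by blast
  show ?thesis
  proof (rule constant_if_touched_from_below[OF h' _ assms])
    have "AE t in M. t \<in> {0..T}" by (rule AE_I2) (simp add: space_restrict_space)
    with AE_ctrl_ham_max vec_ac_deriv_imp_AE[OF xs_deriv] vec_ac_deriv_imp_AE[OF p_deriv]
    show "AE t in M. \<exists>\<phi>. (\<phi> has_real_derivative 0) (at t within {0..T}) \<and>
        \<phi> t = max_hamiltonian t \<and> (\<forall>s\<in>{0..T}. \<phi> s \<le> max_hamiltonian s)"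
    proof eventually_elim
      case (elim t)
      let ?\<phi> = "\<lambda>s. scalar_prod (p s) (A *\<^sub>v xs s) - 1/2 * scalar_prod (xs s) (Q *\<^sub>v xs s) + ctrl_ham (p s) (us t)"
      have "(?\<phi> has_real_derivative 0) (at t within {0..T})"
        by (rule hamiltonian_stationary_at_fixed_control[OF elim(4,2,3)])
      moreover have "?\<phi> t = max_hamiltonian t" using elim(1) by (simp add: max_hamiltonian_def)
      moreover have "?\<phi> s \<le> max_hamiltonian s" for s
        using ctrl_ham_le_max_ham[OF p_carrier us_U[OF elim(4)], of s] by (simp add: max_hamiltonian_def)
      ultimately show ?case by (intro exI[of _ ?\<phi>]) blast
    qed
  qed
qed

lemma AE_hamiltonian_constant:
  "AE t in M. scalar_prod (p t) (A *\<^sub>v xs t + B *\<^sub>v us t) + sparsity N m lam (us t)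
     - quad_cost Q R (xs t) (us t) = max_hamiltonian 0"
proof -
  have "AE t in M. t \<in> {0..T}" by (rule AE_I2) (simp add: space_restrict_space)
  with AE_ctrl_ham_max show ?thesis
  proof eventually_elim
    case (elim t)
    have "scalar_prod (p t) (A *\<^sub>v xs t + B *\<^sub>v us t) = scalar_prod (p t) (A *\<^sub>v xs t) + scalar_prod (p t) (B *\<^sub>v us t)"
      by (rule scalar_prod_add_distrib[OF p_carrier mult_mat_vec_carrier[OF A xs_carrier[OF elim(2)]] mult_B_carrier])
    then have "scalar_prod (p t) (A *\<^sub>v xs t + B *\<^sub>v us t) + sparsity N m lam (us t)
     - quad_cost Q R (xs t) (us t) = max_hamiltonian t"
      using elim(1) quad_cost_split[of Q "xs t" "us t"] unfolding ctrl_ham_eq max_hamiltonian_def by linarith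
    then show ?case using max_hamiltonian_constant[OF elim(2)] by simp
  qed
qed

end

theorem theorem4p1:
  fixes N :: nat and T :: real and d m :: "nat \<Rightarrow> nat"
    and Ak Bk Qk Rk Qhk :: "nat \<Rightarrow> real mat"
    and A B Q R Qh :: "real mat"
    and lam lam' :: "nat \<Rightarrow> real" and lamt :: real
    and xbark :: "nat \<Rightarrow> real Matrix.vec" and xbar :: "real Matrix.vec"
    and G :: "nat \<Rightarrow> real mat"
    and xs us :: "real \<Rightarrow> real Matrix.vec"
  assumes "N \<ge> 1" and "T > 0"
    and "\<And>k. k \<in> {1..N} \<Longrightarrow> Ak k \<in> carrier_mat (d k) (d k)"
    and "\<And>k. k \<in> {1..N} \<Longrightarrow> Bk k \<in> carrier_mat (d k) (m k)"
    and "\<And>k. k \<in> {1..N} \<Longrightarrow> sym_nonneg_def (d k) (Qk k)"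
    and "\<And>k. k \<in> {1..N} \<Longrightarrow> sym_nonneg_def (d k) (Qhk k)"
    and "\<And>k. k \<in> {1..N} \<Longrightarrow> sym_pos_def (m k) (Rk k)"
    and "\<And>k. k \<in> {1..N} \<Longrightarrow> lam k > 0"
    and "\<And>k. k \<in> {1..N} \<Longrightarrow> xbark k \<in> carrier_vec (d k)"
    and "A = blkdiag N Ak" and "B = blkdiag N Bk" and "Q = blkdiag N Qk"
    and "R = blkdiag N Rk" and "Qh = blkdiag N Qhk" and "xbar = blkvec N xbark"
    and "\<And>k. lam' k = (\<Sum>l \<in> {1..N} - {k}. lam l)"
    and "lamt = (\<Sum>k = 1..N. lam k)"
    and "\<And>k. G k = Bk k * mat_inv (Rk k) * transpose_mat (Bk k)"
    and "local_minimizer T (lq_admissible T N d m A B xbar) (lq_cost T N m lam Q R Qh) xs us"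
  shows "(\<exists>(p :: real \<Rightarrow> real Matrix.vec) (\<sigma> :: real \<Rightarrow> nat).
      (\<forall>t \<in> {0..T}. p t \<in> carrier_vec (\<Sum>k = 1..N. d k)) \<and>
      vec_abs_continuous T p \<and>
      \<sigma> \<in> measurable (lebesgue_on {0..T}) (count_space {1..N}) \<and>
      xs 0 = xbar \<and> p T = - (Qh *\<^sub>v xs T) \<and>
      (AE t in lebesgue_on {0..T}.
        vec_has_deriv_at T (\<Sum>k = 1..N. d k) xs (A *\<^sub>v xs t + B *\<^sub>v us t) t \<and>
        vec_has_deriv_at T (\<Sum>k = 1..N. d k) p (- (transpose_mat A *\<^sub>v p t) + Q *\<^sub>v xs t) t \<and>
        (\<forall>k \<in> {1..N}.
          (k \<noteq> \<sigma> t \<longrightarrow> blk m k (us t) = 0\<^sub>v (m k)) \<and>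
          (k = \<sigma> t \<longrightarrow> blk m k (us t) \<in>
            (if (mnorm (G k) (blk d k (p t)))\<^sup>2 > 2 * lam k
             then {mat_inv (Rk k) *\<^sub>v (transpose_mat (Bk k) *\<^sub>v blk d k (p t))}
             else if (mnorm (G k) (blk d k (p t)))\<^sup>2 = 2 * lam k
             then {0\<^sub>v (m k)} \<union> {mat_inv (Rk k) *\<^sub>v (transpose_mat (Bk k) *\<^sub>v blk d k (p t))}
             else {0\<^sub>v (m k)}))) \<and>
        is_arg_max
          (\<lambda>k. if (mnorm (G k) (blk d k (p t)))\<^sup>2 \<ge> 2 * lam k
               then lam' k + 1/2 * (mnorm (G k) (blk d k (p t)))\<^sup>2
               else lamt)
          (\<lambda>k. k \<in> {1..N}) (\<sigma> t)) \<and>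
      (\<exists>c :: real. AE t in lebesgue_on {0..T}.
        scalar_prod (p t) (A *\<^sub>v xs t + B *\<^sub>v us t) + sparsity N m lam (us t)
          - quad_cost Q R (xs t) (us t) = c))"
proof -
  have Bk: "\<And>k. k \<in> {1..N} \<Longrightarrow> Bk k \<in> carrier_mat (d k) (m k)"
    and Rk: "\<And>k. k \<in> {1..N} \<Longrightarrow> sym_pos_def (m k) (Rk k)"
    and lam: "\<And>k. k \<in> {1..N} \<Longrightarrow> lam k > 0" and T: "T > 0" and N: "N \<ge> 1"
    using assms by blast+
  let ?n = "\<Sum>k = 1..N. d k"
  have sym: "M k \<in> carrier_mat (d k) (d k) \<and> transpose_mat (M k) = M k"
    if "\<And>k. k \<in> {1..N} \<Longrightarrow> sym_nonneg_def (d k) (M k)" "k \<in> {1..N}" for k and M :: "nat \<Rightarrow> real mat"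
    using that by (simp add: sym_nonneg_def_def)
  note symQ = sym[of Qk, OF assms(5)] and symQh = sym[of Qhk, OF assms(6)]
  have A: "A \<in> carrier_mat ?n ?n" unfolding assms(10) by (rule blkdiag_carrier[OF assms(3)])
  have Q: "Q \<in> carrier_mat ?n ?n" unfolding assms(12) by (rule blkdiag_carrier) (use symQ in blast)
  have Qh: "Qh \<in> carrier_mat ?n ?n" unfolding assms(14) by (rule blkdiag_carrier) (use symQh in blast)
  have Q_sym: "scalar_prod v (Q *\<^sub>v w) = scalar_prod (Q *\<^sub>v v) w" if "v \<in> carrier_vec ?n" "w \<in> carrier_vec ?n" for v w
    unfolding assms(12) by (rule blkdiag_symmetric[OF symQ that])
  have Qh_sym: "scalar_prod v (Qh *\<^sub>v w) = scalar_prod (Qh *\<^sub>v v) w" if "v \<in> carrier_vec ?n" "w \<in> carrier_vec ?n" for v w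
    unfolding assms(14) by (rule blkdiag_symmetric[OF symQh that])
  interpret lq: lq_optimal N d m Bk Rk lam T A Q Qh xbar xs us
    by unfold_locales (use N Bk Rk lam T A Q Qh Q_sym Qh_sym assms(19) assms(11) assms(13) in blast)+
  obtain p where p: "\<And>t. p t \<in> carrier_vec ?n"
    "vec_ac_deriv T ?n p (\<lambda>t. - (transpose_mat A *\<^sub>v p t) + Q *\<^sub>v xs t)" "p T = - (Qh *\<^sub>v xs T)"
    using lq.adjoint_exists by blast
  interpret ad: lq_adjoint N d m Bk Rk lam T A Q Qh xbar xs us p
    by unfold_locales (use p in blast)+
  have G: "G k = lq.G k" for k unfolding assms(18) lq.G_def ..
  have fb: "mat_inv (Rk k) *\<^sub>v (transpose_mat (Bk k) *\<^sub>v blk d k (p t)) = lq.feedback k (p t)" for k t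
    unfolding lq.feedback_def ..
  let ?s = "\<lambda>t. lq.active_block (us t)"
  let ?C = "\<lambda>t. vec_has_deriv_at T ?n xs (A *\<^sub>v xs t + B *\<^sub>v us t) t \<and>
        vec_has_deriv_at T ?n p (- (transpose_mat A *\<^sub>v p t) + Q *\<^sub>v xs t) t \<and>
        (\<forall>k \<in> {1..N}.
          (k \<noteq> ?s t \<longrightarrow> blk m k (us t) = 0\<^sub>v (m k)) \<and>
          (k = ?s t \<longrightarrow> blk m k (us t) \<in>
            (if (mnorm (G k) (blk d k (p t)))\<^sup>2 > 2 * lam k
             then {mat_inv (Rk k) *\<^sub>v (transpose_mat (Bk k) *\<^sub>v blk d k (p t))}
             else if (mnorm (G k) (blk d k (p t)))\<^sup>2 = 2 * lam k
             then {0\<^sub>v (m k)} \<union> {mat_inv (Rk k) *\<^sub>v (transpose_mat (Bk k) *\<^sub>v blk d k (p t))}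
             else {0\<^sub>v (m k)}))) \<and>
        is_arg_max
          (\<lambda>k. if (mnorm (G k) (blk d k (p t)))\<^sup>2 \<ge> 2 * lam k
               then lam' k + 1/2 * (mnorm (G k) (blk d k (p t)))\<^sup>2
               else lamt)
          (\<lambda>k. k \<in> {1..N}) (?s t)"
  have "AE t in lebesgue_on {0..T}. t \<in> {0..T}" by (rule AE_I2) (simp add: space_restrict_space)
  with ad.AE_maximality vec_ac_deriv_imp_AE[OF lq.xs_deriv] vec_ac_deriv_imp_AE[OF p(2)]
  have C: "AE t in lebesgue_on {0..T}. ?C t"
  proof eventually_elim
    case (elim t)
    note zero = lq.inactive_blocks[OF lq.us_U[OF elim(4)]]
    note mx = lq.maximizing_control[OF p(1) lq.us_U[OF elim(4)] _ _ lq.active_block_range zero]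
    show ?case
      unfolding assms(16,17) G fb
    proof (intro conjI ballI impI)
      show "vec_has_deriv_at T ?n xs (A *\<^sub>v xs t + B *\<^sub>v us t) t" using elim(2) unfolding assms(11) .
      show "vec_has_deriv_at T ?n p (- (transpose_mat A *\<^sub>v p t) + Q *\<^sub>v xs t) t" by (rule elim(3))
      show "blk m k (us t) = 0\<^sub>v (m k)" if "k \<in> {1..N}" "k \<noteq> ?s t" for k
        using zero[of k] that by blast
      show "blk m k (us t) \<in>
            (if (mnorm (lq.G k) (blk d k (p t)))\<^sup>2 > 2 * lam k
             then {lq.feedback k (p t)}
             else if (mnorm (lq.G k) (blk d k (p t)))\<^sup>2 = 2 * lam k
             then {0\<^sub>v (m k)} \<union> {lq.feedback k (p t)}
             else {0\<^sub>v (m k)})" if "k \<in> {1..N}" "k = ?s t" for k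
        unfolding that(2) by (rule mx(2)) (use elim(1) in blast)+
      show "is_arg_max
          (\<lambda>k. if (mnorm (lq.G k) (blk d k (p t)))\<^sup>2 \<ge> 2 * lam k
               then (\<Sum>l \<in> {1..N} - {k}. lam l) + 1/2 * (mnorm (lq.G k) (blk d k (p t)))\<^sup>2
               else (\<Sum>k = 1..N. lam k))
          (\<lambda>k. k \<in> {1..N}) (?s t)"
        by (rule mx(3)) (use elim(1) in blast)+
    qed
  qed
  have ham: "\<exists>c :: real. AE t in lebesgue_on {0..T}.
        scalar_prod (p t) (A *\<^sub>v xs t + B *\<^sub>v us t) + sparsity N m lam (us t)
          - quad_cost Q R (xs t) (us t) = c"
    unfolding assms(11,13) by (rule exI) (rule ad.AE_hamiltonian_constant)
  show ?thesis
  proof (intro exI[of _ p] exI[of _ ?s] conjI)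
    show "\<forall>t \<in> {0..T}. p t \<in> carrier_vec ?n" using p(1) by blast
    show "vec_abs_continuous T p" by (rule vec_ac_deriv_imp_abs_continuous[OF p(2,1)])
    show "?s \<in> measurable (lebesgue_on {0..T}) (count_space {1..N})"
      by (rule lq.active_block_measurable[OF lq.us_measurable])
    show "xs 0 = xbar" by (rule lq.xs_init)
    show "p T = - (Qh *\<^sub>v xs T)" by (rule p(3))
  qed (rule C ham)+
qed

end
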